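(* Let $d\ge 1$ and let $u \in \mathscr{E}'(\mathbf{R}^d) + \mathscr{S}(\mathbf{R}^d)$, i.e. $u$ is the sum of a compactly supported distribution and a Schwartz function on $\mathbf{R}^d$. Then $$\mathrm{WF}_G(u) = \{0\} \times \pi_2 \mathrm{WF}(u) = \{0\} \times \Sigma(u),$$ where $\mathrm{WF}_G(u)$ is the Gabor wave front set, $\mathrm{WF}(u)$ is the classical $C^\infty$ wave front set, $\pi_2(x,\xi)=\xi$, and $\Sigma(u)$ is the set of frequency directions in no open conic neighborhood of which $\widehat u$ decays rapidly.
   Context: Notation. $\langle x\rangle = \sqrt{1+|x|^2}$. $T^*\mathbf{R}^d$ is identified with $\mathbf{R}^d\times\mathbf{R}^d=\mathbf{R}^{2d}$, and $\pi_2: T^*\mathbf{R}^d\to\mathbf{R}^d$ is the projection $\pi_2(x,\xi)=\xi$. A set is conic if it is invariant under multiplication by positive reals. The Fourier transform is $\widehat f(\xi)=\int_{\mathbf{R}^d} f(x)e^{-i\langle x,\xi\rangle}\,dx$, extended to $\mathscr{S}'(\mathbf{R}^d)$. $(\cdot,\cdot)$ denotes the action of $\mathscr{S}'$ on $\mathscr{S}$, conjugate linear in the second argument. Short-time Fourier transform. For $u\in\mathscr{S}'(\mathbf{R}^d)$ and $\varphi\in\mathscr{S}(\mathbf{R}^d)\setminus 0$, $V_\varphi u(x,\xi)=(u, M_\xi T_x\varphi)$, where $T_x\varphi(y)=\varphi(y-x)$ and $M_\xi\varphi(y)=e^{i\langle y,\xi\rangle}\varphi(y)$. Gabor wave front set.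 Let $\varphi\in\mathscr{S}(\mathbf{R}^d)\setminus 0$, $u\in\mathscr{S}'(\mathbf{R}^d)$ and $z_0\in T^*\mathbf{R}^d\setminus 0$. Then $z_0\notin \mathrm{WF}_G(u)$ if there is an open conic set $\Gamma\subseteq T^*\mathbf{R}^d\setminus 0$ with $z_0\in\Gamma$ and $\sup_{z\in\Gamma}\langle z\rangle^N|V_\varphi u(z)|<\infty$ for all $N\ge 0$. $\mathrm{WF}_G(u)\subseteq T^*\mathbf{R}^d\setminus 0$ does not depend on the choice of $\varphi$. Classical wave front set. For $(x_0,\xi_0)\in T^*\mathbf{R}^d$ with $\xi_0\ne 0$, $(x_0,\xi_0)\notin\mathrm{WF}(u)$ if there exist $\varphi\in C_c^\infty(\mathbf{R}^d)$ with $\varphi(0)\neq 0$ and an open conic set $\Gamma_2\subseteq\mathbf{R}^d\setminus 0$ with $\xi_0\in\Gamma_2$ such that $\sup_{\xi\in\Gamma_2}\langle\xi\rangle^N|V_\varphi u(x_0,\xi)|<\infty$ for all $N\ge 0$. The set $\Sigma(u)$. For $u\in\mathscr{E}'(\mathbf{R}^d)+\mathscr{S}(\mathbf{R}^d)$ (so that $\widehat u$ is a smooth function), $\Sigma(u)\subseteq\mathbf{R}^d\setminus 0$ is defined by: $\eta\in\mathbf{R}^d\setminus 0$ satisfies $\eta\notin\Sigma(u)$ if there is an open conic set $\Gamma_2\subseteq\mathbf{R}^d\setminus 0$ with $\eta\in\Gamma_2$ and $\sup_{\xi\in\Gamma_2}\langle\xi\rangle^N|\widehat u(\xi)|<\infty$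 for all $N\ge 0$. *)

theory Defs
  imports "HOL-Analysis.Analysis"
begin

text \<open>The space \<open>\<real>\<^sup>d\<close> is a type \<open>'a :: euclidean_space\<close> with \<open>d = DIM('a) \<ge> 1\<close>, and
  \<open>T\<^sup>*\<real>\<^sup>d\<close> is \<open>'a \<times> 'a\<close>, whose norm is the Euclidean norm of the \<open>2d\<close>-dimensional space.\<close>

definition japanese :: "'b::real_normed_vector \<Rightarrow> real" where
  "japanese x = sqrt (1 + (norm x)\<^sup>2)"

text \<open>Unlike the library's \<^const>\<open>conic\<close>, the scalar 0 is excluded here.\<close>

definition pos_conic :: "'b::real_vector set \<Rightarrow> bool" where
  "pos_conic \<Gamma> \<longleftrightarrow> (\<forall>z\<in>\<Gamma>. \<forall>t>0. t *\<^sub>R z \<in> \<Gamma>)"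

definition rapidly_decreasing_on :: "'b::real_normed_vector set \<Rightarrow> ('b \<Rightarrow> complex) \<Rightarrow> bool" where
  "rapidly_decreasing_on \<Gamma> F \<longleftrightarrow> (\<forall>N::nat. bdd_above ((\<lambda>z. japanese z ^ N * cmod (F z)) ` \<Gamma>))"


subsection \<open>Smooth functions, test functions and Schwartz functions\<close>

definition dir_deriv :: "'a::euclidean_space \<Rightarrow> ('a \<Rightarrow> complex) \<Rightarrow> 'a \<Rightarrow> complex" where
  "dir_deriv b f x = frechet_derivative f (at x) b"

text \<open>The list \<open>bs\<close> of basis vectors plays the role of a multi-index of order \<open>length bs\<close>.\<close>

definition iter_deriv :: "'a::euclidean_space list \<Rightarrow> ('a \<Rightarrow> complex) \<Rightarrow> 'a \<Rightarrow> complex" where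
  "iter_deriv bs f = foldr dir_deriv bs f"

definition smooth_fun :: "('a::euclidean_space \<Rightarrow> complex) \<Rightarrow> bool" where
  "smooth_fun f \<longleftrightarrow> (\<forall>bs. set bs \<subseteq> Basis \<longrightarrow> (\<forall>x. iter_deriv bs f differentiable at x))"

definition fun_support :: "('a::euclidean_space \<Rightarrow> complex) \<Rightarrow> 'a set" where
  "fun_support f = closure {x. f x \<noteq> 0}"

definition test_functions :: "('a::euclidean_space \<Rightarrow> complex) set" where
  "test_functions = {f. smooth_fun f \<and> compact (fun_support f)}"

definition schwartz :: "('a::euclidean_space \<Rightarrow> complex) set" where
  "schwartz = {f. smooth_fun f \<and> (\<forall>bs. set bs \<subseteq> Basis \<longrightarrow> rapidly_decreasing_on UNIV (iter_deriv bs f))}"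

definition schwartz_seminorm :: "nat \<Rightarrow> ('a::euclidean_space \<Rightarrow> complex) \<Rightarrow> real" where
  "schwartz_seminorm N f =
     (SUP (bs, x) \<in> {bs. set bs \<subseteq> Basis \<and> length bs \<le> N} \<times> UNIV. japanese x ^ N * cmod (iter_deriv bs f x))"


subsection \<open>Tempered distributions\<close>

text \<open>A distribution \<open>u\<close> is represented by its action \<open>u \<phi> = (u, \<phi>)\<close>, which is conjugate linear
  in \<open>\<phi>\<close>. Only the values of \<open>u\<close> on \<open>schwartz\<close> are meaningful. Continuity is with respect to the
  Frechet topology of the Schwartz space.\<close>

definition tempered :: "(('a::euclidean_space \<Rightarrow> complex) \<Rightarrow> complex) set" where
  "tempered = {u.
     (\<forall>\<phi>\<in>schwartz. \<forall>\<psi>\<in>schwartz. u (\<lambda>x. \<phi> x + \<psi> x) = u \<phi> + u \<psi>) \<and>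
     (\<forall>c. \<forall>\<phi>\<in>schwartz. u (\<lambda>x. c * \<phi> x) = cnj c * u \<phi>) \<and>
     (\<exists>C N. \<forall>\<phi>\<in>schwartz. cmod (u \<phi>) \<le> C * schwartz_seminorm N \<phi>)}"

definition fun_dist :: "('a::euclidean_space \<Rightarrow> complex) \<Rightarrow> ('a \<Rightarrow> complex) \<Rightarrow> complex" where
  "fun_dist f \<phi> = (\<integral>x. f x * cnj (\<phi> x) \<partial>lborel)"

definition dist_support :: "(('a::euclidean_space \<Rightarrow> complex) \<Rightarrow> complex) \<Rightarrow> 'a set" where
  "dist_support u =
     - \<Union>{U. open U \<and> (\<forall>\<phi>\<in>test_functions. fun_support \<phi> \<subseteq> U \<longrightarrow> u \<phi> = 0)}"

text \<open>The space \<open>\<E>'\<close>, regarded as a subspace of \<open>\<S>'\<close>.\<close>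

definition compact_dists :: "(('a::euclidean_space \<Rightarrow> complex) \<Rightarrow> complex) set" where
  "compact_dists = {u \<in> tempered. compact (dist_support u)}"

text \<open>The space \<open>\<E>' + \<S>\<close>; equality of distributions is equality on \<open>schwartz\<close>.\<close>

definition compact_plus_schwartz :: "(('a::euclidean_space \<Rightarrow> complex) \<Rightarrow> complex) set" where
  "compact_plus_schwartz =
     {u. \<exists>v\<in>compact_dists. \<exists>f\<in>schwartz. \<forall>\<phi>\<in>schwartz. u \<phi> = v \<phi> + fun_dist f \<phi>}"


subsection \<open>Fourier transform\<close>

text \<open>On functions the Fourier transform is \<open>f\<^sup>^(\<xi>) = \<integral> f(x) exp(-i\<langle>x,\<xi>\<rangle>) dx\<close>. Its formal adjoint for
  the sesquilinear pairing is \<open>\<phi> \<mapsto> \<integral> \<phi>(\<xi>) exp(i\<langle>x,\<xi>\<rangle>) d\<xi>\<close>, and the extension to \<open>\<S>'\<close> is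
  obtained by letting \<open>u\<close> act on this adjoint.\<close>

definition fourier_adjoint :: "('a::euclidean_space \<Rightarrow> complex) \<Rightarrow> 'a \<Rightarrow> complex" where
  "fourier_adjoint \<phi> x = (\<integral>\<xi>. \<phi> \<xi> * cis (x \<bullet> \<xi>) \<partial>lborel)"

definition fourier_dist ::
    "(('a::euclidean_space \<Rightarrow> complex) \<Rightarrow> complex) \<Rightarrow> ('a \<Rightarrow> complex) \<Rightarrow> complex" where
  "fourier_dist u \<phi> = u (fourier_adjoint \<phi>)"

text \<open>The smooth function that represents the distributional Fourier transform of \<open>u\<close>, meaningful
  when there is one, as for \<open>u \<in> \<E>' + \<S>\<close>.\<close>

definition fourier_fun :: "(('a::euclidean_space \<Rightarrow> complex) \<Rightarrow> complex) \<Rightarrow> 'a \<Rightarrow> complex" where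
  "fourier_fun u = (THE g. smooth_fun g \<and>
     (\<forall>\<phi>\<in>schwartz. integrable lborel (\<lambda>\<xi>. g \<xi> * cnj (\<phi> \<xi>)) \<and> fourier_dist u \<phi> = fun_dist g \<phi>))"


subsection \<open>Short-time Fourier transform and wave front sets\<close>

definition translate :: "'a::euclidean_space \<Rightarrow> ('a \<Rightarrow> complex) \<Rightarrow> 'a \<Rightarrow> complex" where
  "translate x \<phi> = (\<lambda>y. \<phi> (y - x))"

definition modulate :: "'a::euclidean_space \<Rightarrow> ('a \<Rightarrow> complex) \<Rightarrow> 'a \<Rightarrow> complex" where
  "modulate \<xi> \<phi> = (\<lambda>y. cis (y \<bullet> \<xi>) * \<phi> y)"

definition stft :: "('a::euclidean_space \<Rightarrow> complex) \<Rightarrow> (('a \<Rightarrow> complex) \<Rightarrow> complex) \<Rightarrow> 'a \<times> 'a \<Rightarrow> complex" where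
  "stft \<phi> u = (\<lambda>(x, \<xi>). u (modulate \<xi> (translate x \<phi>)))"

text \<open>The Gabor wave front set, computed with the window \<open>\<phi>\<close>.\<close>

definition WF_G :: "('a::euclidean_space \<Rightarrow> complex) \<Rightarrow> (('a \<Rightarrow> complex) \<Rightarrow> complex) \<Rightarrow> ('a \<times> 'a) set" where
  "WF_G \<phi> u = {z0. z0 \<noteq> 0 \<and>
     \<not> (\<exists>\<Gamma>. open \<Gamma> \<and> pos_conic \<Gamma> \<and> 0 \<notin> \<Gamma> \<and> z0 \<in> \<Gamma> \<and> rapidly_decreasing_on \<Gamma> (stft \<phi> u))}"

definition WF :: "(('a::euclidean_space \<Rightarrow> complex) \<Rightarrow> complex) \<Rightarrow> ('a \<times> 'a) set" where
  "WF u = {(x0, \<xi>0). \<xi>0 \<noteq> 0 \<and>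
     \<not> (\<exists>\<phi>\<in>test_functions. \<phi> 0 \<noteq> 0 \<and>
          (\<exists>\<Gamma>. open \<Gamma> \<and> pos_conic \<Gamma> \<and> 0 \<notin> \<Gamma> \<and> \<xi>0 \<in> \<Gamma> \<and>
             rapidly_decreasing_on \<Gamma> (\<lambda>\<xi>. stft \<phi> u (x0, \<xi>))))}"

definition Sigma_dir :: "(('a::euclidean_space \<Rightarrow> complex) \<Rightarrow> complex) \<Rightarrow> 'a set" where
  "Sigma_dir u = {\<eta>. \<eta> \<noteq> 0 \<and>
     \<not> (\<exists>\<Gamma>. open \<Gamma> \<and> pos_conic \<Gamma> \<and> 0 \<notin> \<Gamma> \<and> \<eta> \<in> \<Gamma> \<and> rapidly_decreasing_on \<Gamma> (fourier_fun u))}"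

end

theory Submission
  imports Defs "HOL-Probability.Characteristic_Functions" "HOL-Probability.Sinc_Integral"
begin

text \<open>
  Write \<open>u = v + f\<close> with \<open>v\<close> of compact support and \<open>f\<close> a Schwartz function. The Fourier transform of
  \<open>u\<close> is the smooth function \<open>G(\<xi>) = (v, \<theta> exp(i\<langle>\<cdot>,\<xi>\<rangle>)) + f\<^sup>^(\<xi>)\<close>, where \<open>\<theta>\<close> is a cutoff for \<open>v\<close>, and
  Fourier inversion turns \<open>V\<^sub>\<phi>u(x,\<xi>)\<close> into the convolution of \<open>G\<close> with a modulation of the rapidly
  decreasing \<open>\<phi>\<^sup>^\<close>. Hence rapid decay of \<open>G\<close> in a cone passes to \<open>V\<^sub>\<phi>u(x,\<xi>)\<close>, uniformly in \<open>x\<close>, for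
  \<open>\<xi>\<close> in a smaller cone. Conversely \<open>G\<close> is recovered from the \<open>L\<^sup>1\<close> norms of \<open>V\<^sub>\<phi>u(\<cdot>,\<xi>)\<close>. Since \<open>v\<close> has
  compact support, \<open>V\<^sub>\<phi>u(x,\<xi>)\<close> is rapidly decreasing in \<open>x\<close> and polynomially bounded in \<open>\<xi>\<close>, so only
  directions with \<open>x = 0\<close> can be singular. If no \<open>(x,\<eta>)\<close> lies in the classical wave front set, then
  finitely many windows cover the support of \<open>\<theta>\<close>, and dividing \<open>\<theta>\<close> by them writes \<open>\<theta>\<^sup>*v\<close> as a
  finite sum of distributions whose transforms decay near \<open>\<eta>\<close>.
\<close>

section \<open>Smooth functions\<close>

text \<open>Three points shape the proof. A distribution is a bare functional with one seminorm
  estimate, so every exchange of \<open>v\<close> with a limit, a derivative or an integral has to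
  be justified by estimating the error in that seminorm; these estimates are made pointwise through
  \<open>jet_norm\<close>. The constant of Fourier inversion is never evaluated: a single bump
  function provides it as a nonzero number, and rapid decay does not see constant factors. Finally,
  to recover \<open>G\<close> at a frequency \<xi> one needs the short-time transform at all points
  (x, \<xi>), while a conic neighbourhood of (0, \<eta>) contains only those with |x| at most a
  small multiple of |\<xi>|. For the others the decay in x is converted into decay in \<xi>; this
  works because the order \<open>N\<close> of polynomial growth in \<xi> is the same for every rate
  of decay in x. All transforms are expressed by \<open>fourier_adjoint\<close>, of which the
  Fourier integral is the reflection. Since \<open>fourier_fun\<close> is a definite description,
  uniqueness of the representing smooth function has to be shown as well.\<close>

lemma dir_deriv_eq: "(f has_derivative f') (at x) \<Longrightarrow> dir_deriv b f x = f' b"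
  unfolding dir_deriv_def using frechet_derivative_at by metis

lemma iter_deriv_Nil [simp]: "iter_deriv [] f = f"
  and iter_deriv_Cons [simp]: "iter_deriv (b # bs) f = dir_deriv b (iter_deriv bs f)"
  and iter_deriv_append: "iter_deriv (bs @ cs) f = iter_deriv bs (iter_deriv cs f)"
  by (simp_all add: iter_deriv_def)

text \<open>Smoothness counted to finite order, so that closure properties can be proved by
  induction on \<open>k\<close>: the derivative of a sum, product or quotient is built from
  functions of the same kind with one order less.\<close>

primrec diff_upto :: "nat \<Rightarrow> ('a::euclidean_space \<Rightarrow> complex) \<Rightarrow> bool" where
  "diff_upto 0 f \<longleftrightarrow> True"
| "diff_upto (Suc k) f \<longleftrightarrow>
     (\<forall>x. f differentiable at x) \<and> (\<forall>b\<in>Basis. diff_upto k (dir_deriv b f))"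

text \<open>The recursion removes the derivative that is applied first, which is the last element of
  the list; hence lists are split at their end.\<close>

lemma diff_upto_iff:
  "diff_upto k f \<longleftrightarrow> (\<forall>bs. set bs \<subseteq> Basis \<and> length bs < k \<longrightarrow> (\<forall>x. iter_deriv bs f differentiable at x))"
proof (induction k arbitrary: f)
  case (Suc k)
  show ?case
  proof
    assume L: "diff_upto (Suc k) f"
    show "\<forall>bs. set bs \<subseteq> Basis \<and> length bs < Suc k \<longrightarrow> (\<forall>x. iter_deriv bs f differentiable at x)"
    proof (intro allI impI)
      fix bs :: "'a list" and x
      assume bs: "set bs \<subseteq> Basis \<and> length bs < Suc k"
      show "iter_deriv bs f differentiable at x"
      proof (cases bs rule: rev_cases)
        case (snoc cs b)
        then have "diff_upto k (dir_deriv b f)" using L bs by auto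
        then show ?thesis using Suc.IH bs snoc by (simp add: iter_deriv_append)
      qed (use L in auto)
    qed
  next
    assume R: "\<forall>bs. set bs \<subseteq> Basis \<and> length bs < Suc k \<longrightarrow> (\<forall>x. iter_deriv bs f differentiable at x)"
    have "f differentiable at x" for x
      using R[rule_format, of "[]"] by simp
    moreover have "diff_upto k (dir_deriv b f)" if "b \<in> Basis" for b
    proof -
      have "iter_deriv bs (dir_deriv b f) differentiable at x"
        if "set bs \<subseteq> Basis" "length bs < k" for bs x
        using R[rule_format, of "bs @ [b]" x] that \<open>b \<in> Basis\<close> by (simp add: iter_deriv_append)
      then show ?thesis using Suc.IH by blast
    qed
    ultimately show "diff_upto (Suc k) f" by simp
  qed
qed simp

lemma smooth_fun_iff: "smooth_fun f \<longleftrightarrow> (\<forall>k. diff_upto k f)"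
  unfolding smooth_fun_def diff_upto_iff by blast

lemma diff_upto_SucI:
  assumes "\<And>x. (f has_derivative F x) (at x)" and "\<And>b. b \<in> Basis \<Longrightarrow> diff_upto k (\<lambda>x. F x b)"
  shows "diff_upto (Suc k) f"
proof -
  have "dir_deriv b f = (\<lambda>x. F x b)" for b
    using dir_deriv_eq[OF assms(1)] by blast
  then show ?thesis using assms by (auto simp: differentiable_def)
qed

lemma diff_upto_has_derivative:
  "diff_upto (Suc k) f \<Longrightarrow> (f has_derivative (\<lambda>h. dir_deriv h f x)) (at x)"
  by (simp add: dir_deriv_def frechet_derivative_works)

lemma diff_upto_Suc_imp: "diff_upto (Suc k) f \<Longrightarrow> diff_upto k f"
  by (simp add: diff_upto_iff)

lemma diff_upto_const: "diff_upto k (\<lambda>x. c)"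
proof (induction k arbitrary: c)
  case (Suc k)
  show ?case by (rule diff_upto_SucI) (rule derivative_eq_intros Suc.IH refl)+
qed simp

lemma diff_upto_add: "diff_upto k f \<Longrightarrow> diff_upto k g \<Longrightarrow> diff_upto k (\<lambda>x. f x + g x)"
proof (induction k arbitrary: f g)
  case (Suc k)
  show ?case
    by (rule diff_upto_SucI, rule has_derivative_add; (rule diff_upto_has_derivative Suc)?)
       (use Suc in auto)
qed simp

lemma diff_upto_mult: "diff_upto k f \<Longrightarrow> diff_upto k g \<Longrightarrow> diff_upto k (\<lambda>x. f x * g x)"
proof (induction k arbitrary: f g)
  case (Suc k)
  note d = diff_upto_has_derivative[OF Suc.prems(1)] diff_upto_has_derivative[OF Suc.prems(2)]
  show ?case
    by (rule diff_upto_SucI, rule has_derivative_mult[OF d])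
       (use Suc.prems[THEN diff_upto_Suc_imp] Suc.prems in \<open>auto intro!: diff_upto_add Suc.IH\<close>)
qed simp

lemma diff_upto_bounded_linear: "bounded_linear L \<Longrightarrow> diff_upto k L"
proof (cases k)
  case (Suc n)
  assume L: "bounded_linear L"
  show ?thesis unfolding Suc
    by (rule diff_upto_SucI, rule bounded_linear_imp_has_derivative[OF L], rule diff_upto_const)
qed simp

lemma diff_upto_linear_image:
  assumes "bounded_linear L" and "diff_upto k f"
  shows "diff_upto k (\<lambda>x. L (f x))"
  using assms(2)
proof (induction k arbitrary: f)
  case (Suc k)
  show ?case
    by (rule diff_upto_SucI,
        rule bounded_linear.has_derivative[OF assms(1) diff_upto_has_derivative[OF Suc.prems]])
       (use Suc in auto)
qed simp

lemma has_derivative_affine_arg: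
  assumes "(f has_derivative f') (at (r *\<^sub>R x + a))"
  shows "((\<lambda>x. f (r *\<^sub>R x + a)) has_derivative (\<lambda>h. f' (r *\<^sub>R h))) (at x)"
proof -
  have "((\<lambda>x. r *\<^sub>R x + a) has_derivative (\<lambda>h. r *\<^sub>R h)) (at x)"
    by (auto intro!: derivative_eq_intros)
  from diff_chain_at[OF this assms] show ?thesis by (simp add: o_def)
qed

lemma linear_dir_deriv: "f differentiable at x \<Longrightarrow> linear (\<lambda>h. dir_deriv h f x)"
  by (simp add: dir_deriv_def linear_frechet_derivative)

lemma diff_upto_affine_arg: "diff_upto k f \<Longrightarrow> diff_upto k (\<lambda>x. f (r *\<^sub>R x + a))"
proof (induction k arbitrary: f)
  case (Suc k)
  show ?case
  proof (rule diff_upto_SucI, rule has_derivative_affine_arg[OF diff_upto_has_derivative[OF Suc.prems]])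
    fix b :: 'a assume b: "b \<in> Basis"
    \<comment> \<open>The chain rule differentiates in the direction r b, which need not be a basis
      vector; linearity in the direction restores \<open>b\<close>.\<close>
    have "(\<lambda>x. dir_deriv (r *\<^sub>R b) f (r *\<^sub>R x + a)) = (\<lambda>x. of_real r * dir_deriv b f (r *\<^sub>R x + a))"
      using linear_cmul[OF linear_dir_deriv] Suc.prems by (fastforce simp: scaleR_conv_of_real)
    then show "diff_upto k (\<lambda>x. dir_deriv (r *\<^sub>R b) f (r *\<^sub>R x + a))"
      using Suc b by (auto intro!: diff_upto_mult diff_upto_const)
  qed
qed simp

lemma has_derivative_cis_inner:
  "((\<lambda>x. cis (x \<bullet> \<xi>)) has_derivative (\<lambda>h. \<i> * of_real (h \<bullet> \<xi>) * cis (x \<bullet> \<xi>))) (at x)"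
proof -
  have "((\<lambda>x. cis (x \<bullet> \<xi>)) has_derivative (\<lambda>h. (h \<bullet> \<xi>) *\<^sub>R (\<i> * cis (x \<bullet> \<xi>)))) (at x)"
  proof -
    have "((\<lambda>t. exp (\<i> * of_real t)) has_vector_derivative \<i> * cis (x \<bullet> \<xi>)) (at (x \<bullet> \<xi>))"
      by (auto intro!: derivative_eq_intros simp: cis_conv_exp mult.commute)
    then have "(cis has_derivative (\<lambda>t. t *\<^sub>R (\<i> * cis (x \<bullet> \<xi>)))) (at (x \<bullet> \<xi>))"
      unfolding has_vector_derivative_def cis_conv_exp .
    moreover have "((\<lambda>x. x \<bullet> \<xi>) has_derivative (\<lambda>h. h \<bullet> \<xi>)) (at x)"
      by (auto intro!: derivative_eq_intros)
    ultimately show ?thesis using diff_chain_at by (fastforce simp: o_def)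
  qed
  then show ?thesis by (simp add: scaleR_conv_of_real mult_ac)
qed

lemma diff_upto_cis: "diff_upto k (\<lambda>x. cis (x \<bullet> \<xi>))"
proof (induction k)
  case (Suc k)
  show ?case
    by (rule diff_upto_SucI, rule has_derivative_cis_inner)
       (intro diff_upto_mult diff_upto_const Suc)
qed simp

text \<open>Where \<open>S\<close> vanishes, the quotient is \<open>0 / 0 = 0\<close>.\<close>

lemma has_derivative_quotient:
  assumes a: "diff_upto (Suc k) a" and S: "diff_upto (Suc k) S" and supp: "fun_support a \<subseteq> {x. S x \<noteq> 0}"
  shows "((\<lambda>x. a x / S x) has_derivative
          (\<lambda>h. (dir_deriv h a x * S x - a x * dir_deriv h S x) / (S x * S x))) (at x)"
proof (cases "S x = 0")
  case False
  show ?thesis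
    using has_derivative_divide'[OF diff_upto_has_derivative[OF a] diff_upto_has_derivative[OF S] False]
    by (simp add: algebra_simps)
next
  case True
  then have x: "x \<in> - fun_support a" using supp by auto
  have "open (- fun_support a)" by (simp add: fun_support_def open_Compl)
  moreover have "0 = a y / S y" if "y \<in> - fun_support a" for y
    using that closure_subset[of "{x. a x \<noteq> 0}"] by (auto simp: fun_support_def)
  ultimately have "((\<lambda>x. a x / S x) has_derivative (\<lambda>h. 0)) (at x)"
    by (rule has_derivative_transform_within_open[OF has_derivative_const _ x])
  then show ?thesis using True by simp
qed

section \<open>Locality of derivatives and smoothness of quotients\<close>

lemma dir_deriv_cong_open:
  assumes "open U" "x \<in> U" "\<And>y. y \<in> U \<Longrightarrow> f y = g y"
  shows "dir_deriv b f x = dir_deriv b g x"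
proof (cases "f differentiable at x")
  case True
  then show ?thesis using frechet_derivative_transform_within_open[OF True assms]
    by (simp add: dir_deriv_def)
next
  \<comment> \<open>\<open>frechet_derivative\<close> is a Hilbert choice. Both functions have the
    same derivatives at \<open>x\<close>, so the two choices agree even when there is none.\<close>
  case False
  have "(f has_derivative D) (at x) \<longleftrightarrow> (g has_derivative D) (at x)" for D
    using has_derivative_transform_within_open[of f D x UNIV U g]
      has_derivative_transform_within_open[of g D x UNIV U f] assms by auto
  then show ?thesis by (simp add: dir_deriv_def frechet_derivative_def)
qed

lemma iter_deriv_cong_open:
  assumes "open U" "\<And>y. y \<in> U \<Longrightarrow> f y = g y" and "x \<in> U"
  shows "iter_deriv bs f x = iter_deriv bs g x"
  using assms(3)
proof (induction bs arbitrary: x)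
  case (Cons b bs)
  show ?case using dir_deriv_cong_open[OF assms(1) Cons.prems Cons.IH] by simp
qed (use assms in auto)

lemma fun_support_subsetI: "closed A \<Longrightarrow> (\<And>x. f x \<noteq> 0 \<Longrightarrow> x \<in> A) \<Longrightarrow> fun_support f \<subseteq> A"
  unfolding fun_support_def by (intro closure_minimal) auto

lemma closed_fun_support [simp]: "closed (fun_support f)"
  by (simp add: fun_support_def)

lemma not_in_fun_support: "x \<notin> fun_support f \<Longrightarrow> f x = 0"
  using closure_subset[of "{x. f x \<noteq> 0}"] by (auto simp: fun_support_def)

lemma iter_deriv_zero_fun: "set bs \<subseteq> Basis \<Longrightarrow> iter_deriv bs (\<lambda>x. 0) = (\<lambda>x. 0)"
proof (induction bs)
  case (Cons b bs)
  then show ?case using dir_deriv_eq[OF has_derivative_const] by auto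
qed simp

lemma iter_deriv_not_in_support:
  assumes "x \<notin> fun_support f" "set bs \<subseteq> Basis" shows "iter_deriv bs f x = 0"
proof -
  have "iter_deriv bs f x = iter_deriv bs (\<lambda>x. 0) x"
    by (rule iter_deriv_cong_open[of "- fun_support f"])
       (use assms in \<open>auto simp: not_in_fun_support open_Compl\<close>)
  then show ?thesis by (simp add: iter_deriv_zero_fun[OF assms(2)])
qed

text \<open>The induction closes because the derivative is again such a quotient: its numerator is
  supported in the support of \<open>a\<close>, and its denominator \<open>S * S\<close> has the
  same zeros as \<open>S\<close>.\<close>

lemma diff_upto_quotient:
  assumes "diff_upto k a" "diff_upto k S" "fun_support a \<subseteq> {x. S x \<noteq> 0}"
  shows "diff_upto k (\<lambda>x. a x / S x)"
  using assms
proof (induction k arbitrary: a S)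
  case (Suc k)
  show ?case
  proof (rule diff_upto_SucI, rule has_derivative_quotient[OF Suc.prems], rule Suc.IH)
    fix b :: 'a assume b: "b \<in> Basis"
    show "diff_upto k (\<lambda>x. S x * S x)"
      using diff_upto_Suc_imp[OF Suc.prems(2)] by (intro diff_upto_mult)
    have "diff_upto k (\<lambda>x. dir_deriv b a x * S x + a x * (- 1 * dir_deriv b S x))"
      using Suc.prems(1,2)[THEN diff_upto_Suc_imp] Suc.prems(1,2) b
      by (intro diff_upto_add diff_upto_mult diff_upto_const) auto
    then show "diff_upto k (\<lambda>x. dir_deriv b a x * S x - a x * dir_deriv b S x)"
      by simp
    have "fun_support (\<lambda>x. dir_deriv b a x * S x - a x * dir_deriv b S x) \<subseteq> fun_support a"
    proof (intro fun_support_subsetI closed_fun_support, rule ccontr)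
      fix x assume "dir_deriv b a x * S x - a x * dir_deriv b S x \<noteq> 0" "x \<notin> fun_support a"
      then show False
        using iter_deriv_not_in_support[of x a "[b]"] not_in_fun_support[of x a] b by auto
    qed
    then show "fun_support (\<lambda>x. dir_deriv b a x * S x - a x * dir_deriv b S x) \<subseteq> {x. S x * S x \<noteq> 0}"
      using Suc.prems(3) by auto
  qed
qed simp

section \<open>Closure rules for smooth functions and formulas for iterated derivatives\<close>

lemma smooth_fun_const [simp]: "smooth_fun (\<lambda>x. c)"
  and smooth_fun_add: "smooth_fun f \<Longrightarrow> smooth_fun g \<Longrightarrow> smooth_fun (\<lambda>x. f x + g x)"
  and smooth_fun_mult: "smooth_fun f \<Longrightarrow> smooth_fun g \<Longrightarrow> smooth_fun (\<lambda>x. f x * g x)"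
  and smooth_fun_bounded_linear: "bounded_linear L \<Longrightarrow> smooth_fun L"
  and smooth_fun_cnj: "smooth_fun f \<Longrightarrow> smooth_fun (\<lambda>x. cnj (f x))"
  and smooth_fun_affine_arg: "smooth_fun f \<Longrightarrow> smooth_fun (\<lambda>x. f (r *\<^sub>R x + a))"
  and smooth_fun_cis [simp]: "smooth_fun (\<lambda>x. cis (x \<bullet> \<xi>))"
  and smooth_fun_quotient: "smooth_fun f \<Longrightarrow> smooth_fun g \<Longrightarrow> fun_support f \<subseteq> {x. g x \<noteq> 0} \<Longrightarrow>
    smooth_fun (\<lambda>x. f x / g x)"
  by (simp_all add: smooth_fun_iff diff_upto_const diff_upto_add diff_upto_mult diff_upto_bounded_linear
        diff_upto_affine_arg diff_upto_cis diff_upto_quotient diff_upto_linear_image[OF bounded_linear_cnj])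

lemma smooth_fun_cmult: "smooth_fun f \<Longrightarrow> smooth_fun (\<lambda>x. c * f x)"
  by (intro smooth_fun_mult smooth_fun_const)

lemma smooth_fun_uminus: "smooth_fun f \<Longrightarrow> smooth_fun (\<lambda>x. - f x)"
  using smooth_fun_cmult[of f "-1"] by simp

lemma smooth_fun_diff: "smooth_fun f \<Longrightarrow> smooth_fun g \<Longrightarrow> smooth_fun (\<lambda>x. f x - g x)"
  using smooth_fun_add[of f "\<lambda>x. - g x"] by (simp add: smooth_fun_uminus)

lemma smooth_fun_sum: "(\<And>i. i \<in> I \<Longrightarrow> smooth_fun (f i)) \<Longrightarrow> smooth_fun (\<lambda>x. \<Sum>i\<in>I. f i x)"
  by (induction I rule: infinite_finite_induct) (auto intro: smooth_fun_add)

lemma smooth_fun_has_derivative: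
  "smooth_fun f \<Longrightarrow> (f has_derivative (\<lambda>h. dir_deriv h f x)) (at x)"
  by (simp add: smooth_fun_iff diff_upto_has_derivative[of 0])

lemma smooth_fun_differentiable: "smooth_fun f \<Longrightarrow> f differentiable at x"
  using smooth_fun_has_derivative differentiable_def by blast

lemma smooth_fun_iter_deriv: "smooth_fun f \<Longrightarrow> set bs \<subseteq> Basis \<Longrightarrow> smooth_fun (iter_deriv bs f)"
  by (simp add: smooth_fun_def flip: iter_deriv_append)

lemma smooth_fun_dir_deriv: "smooth_fun f \<Longrightarrow> b \<in> Basis \<Longrightarrow> smooth_fun (dir_deriv b f)"
  using smooth_fun_iter_deriv[of f "[b]"] by simp

lemma smooth_fun_isCont: "smooth_fun f \<Longrightarrow> isCont f x"
  using smooth_fun_differentiable differentiable_imp_continuous_within by blast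

lemma smooth_fun_continuous_on: "smooth_fun f \<Longrightarrow> continuous_on A f"
  by (simp add: continuous_at_imp_continuous_on smooth_fun_isCont)

lemma smooth_fun_measurable: "smooth_fun f \<Longrightarrow> f \<in> borel_measurable borel"
  by (simp add: smooth_fun_continuous_on borel_measurable_continuous_onI)

lemma dir_deriv_add: "smooth_fun f \<Longrightarrow> smooth_fun g \<Longrightarrow>
    dir_deriv b (\<lambda>x. f x + g x) = (\<lambda>x. dir_deriv b f x + dir_deriv b g x)"
  by (rule ext, rule dir_deriv_eq[of _ "\<lambda>h. dir_deriv h f _ + dir_deriv h g _"])
     (intro has_derivative_add smooth_fun_has_derivative)

lemma dir_deriv_mult: "smooth_fun f \<Longrightarrow> smooth_fun g \<Longrightarrow>
    dir_deriv b (\<lambda>x. f x * g x) = (\<lambda>x. dir_deriv b f x * g x + f x * dir_deriv b g x)"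
proof
  fix x assume "smooth_fun f" "smooth_fun g"
  from dir_deriv_eq[OF has_derivative_mult[OF this[THEN smooth_fun_has_derivative]]]
  show "dir_deriv b (\<lambda>x. f x * g x) x = dir_deriv b f x * g x + f x * dir_deriv b g x"
    by (simp add: add.commute)
qed

lemma dir_deriv_const: "dir_deriv b (\<lambda>x. c) = (\<lambda>x. 0)"
  using dir_deriv_eq[OF has_derivative_const] by blast

lemma dir_deriv_cmult: "smooth_fun f \<Longrightarrow> dir_deriv b (\<lambda>x. c * f x) = (\<lambda>x. c * dir_deriv b f x)"
  by (simp add: dir_deriv_mult dir_deriv_const)

lemma iter_deriv_add: "smooth_fun f \<Longrightarrow> smooth_fun g \<Longrightarrow> set bs \<subseteq> Basis \<Longrightarrow>
    iter_deriv bs (\<lambda>x. f x + g x) = (\<lambda>x. iter_deriv bs f x + iter_deriv bs g x)"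
  by (induction bs) (simp_all add: dir_deriv_add smooth_fun_iter_deriv)

lemma iter_deriv_cmult: "smooth_fun f \<Longrightarrow> set bs \<subseteq> Basis \<Longrightarrow>
    iter_deriv bs (\<lambda>x. c * f x) = (\<lambda>x. c * iter_deriv bs f x)"
  by (induction bs) (simp_all add: dir_deriv_cmult smooth_fun_iter_deriv)

lemma iter_deriv_uminus: "smooth_fun f \<Longrightarrow> set bs \<subseteq> Basis \<Longrightarrow>
    iter_deriv bs (\<lambda>x. - f x) = (\<lambda>x. - iter_deriv bs f x)"
  using iter_deriv_cmult[of f bs "-1"] by simp

lemma iter_deriv_diff: "smooth_fun f \<Longrightarrow> smooth_fun g \<Longrightarrow> set bs \<subseteq> Basis \<Longrightarrow>
    iter_deriv bs (\<lambda>x. f x - g x) = (\<lambda>x. iter_deriv bs f x - iter_deriv bs g x)"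
  using iter_deriv_add[of f "\<lambda>x. - g x" bs] by (simp add: smooth_fun_uminus iter_deriv_uminus)

lemma iter_deriv_sum: "(\<And>i. i \<in> I \<Longrightarrow> smooth_fun (f i)) \<Longrightarrow> set bs \<subseteq> Basis \<Longrightarrow>
    iter_deriv bs (\<lambda>x. \<Sum>i\<in>I. f i x) = (\<lambda>x. \<Sum>i\<in>I. iter_deriv bs (f i) x)"
  by (induction I rule: infinite_finite_induct)
     (auto simp: iter_deriv_zero_fun iter_deriv_add smooth_fun_sum)

lemma iter_deriv_affine_arg: "smooth_fun f \<Longrightarrow> set bs \<subseteq> Basis \<Longrightarrow>
    iter_deriv bs (\<lambda>x. f (r *\<^sub>R x + a)) = (\<lambda>x. of_real r ^ length bs * iter_deriv bs f (r *\<^sub>R x + a))"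
proof (induction bs)
  case (Cons b bs)
  let ?g = "iter_deriv bs f"
  have g: "smooth_fun ?g" using Cons by (simp add: smooth_fun_iter_deriv)
  have "dir_deriv b (\<lambda>x. ?g (r *\<^sub>R x + a)) = (\<lambda>x. dir_deriv (r *\<^sub>R b) ?g (r *\<^sub>R x + a))"
    using dir_deriv_eq[OF has_derivative_affine_arg[OF smooth_fun_has_derivative[OF g]]] by blast
  also have "\<dots> = (\<lambda>x. of_real r * dir_deriv b ?g (r *\<^sub>R x + a))"
    using linear_cmul[OF linear_dir_deriv[OF smooth_fun_differentiable[OF g]]]
    by (simp add: scaleR_conv_of_real)
  finally show ?case using Cons g
    by (simp add: dir_deriv_cmult smooth_fun_affine_arg mult_ac)
qed simp

lemma iter_deriv_cis: "set bs \<subseteq> Basis \<Longrightarrow>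
    iter_deriv bs (\<lambda>x. cis (x \<bullet> \<xi>)) = (\<lambda>x. (\<Prod>b\<leftarrow>bs. \<i> * of_real (b \<bullet> \<xi>)) * cis (x \<bullet> \<xi>))"
proof (induction bs)
  case (Cons b bs)
  have "dir_deriv b (\<lambda>x. cis (x \<bullet> \<xi>)) = (\<lambda>x. \<i> * of_real (b \<bullet> \<xi>) * cis (x \<bullet> \<xi>))"
    using dir_deriv_eq[OF has_derivative_cis_inner] by blast
  then show ?case using Cons by (simp add: dir_deriv_cmult; intro ext; simp)
qed simp

lemma dir_deriv_cnj: "smooth_fun f \<Longrightarrow> dir_deriv b (\<lambda>x. cnj (f x)) = (\<lambda>x. cnj (dir_deriv b f x))"
  using dir_deriv_eq[OF bounded_linear.has_derivative[OF bounded_linear_cnj smooth_fun_has_derivative]]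
  by blast

lemma iter_deriv_cnj: "smooth_fun f \<Longrightarrow> set bs \<subseteq> Basis \<Longrightarrow>
    iter_deriv bs (\<lambda>x. cnj (f x)) = (\<lambda>x. cnj (iter_deriv bs f x))"
  by (induction bs) (simp_all add: dir_deriv_cnj smooth_fun_iter_deriv)

section \<open>Weights, jets and the Schwartz space\<close>

lemma japanese_ge_1: "1 \<le> japanese x"
  by (simp add: japanese_def)

lemma japanese_pos [simp]: "0 < japanese x" and japanese_nonneg [simp]: "0 \<le> japanese x"
  using japanese_ge_1[of x] by linarith+

lemma norm_le_japanese: "norm x \<le> japanese x"
  by (simp add: japanese_def real_le_rsqrt)

lemma japanese_le: "japanese x \<le> 1 + norm x"
  unfolding japanese_def by (rule real_le_lsqrt) (auto simp: power2_eq_square algebra_simps)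

lemma japanese_mono: "norm x \<le> norm y \<Longrightarrow> japanese x \<le> japanese y"
  by (simp add: japanese_def power_mono)

lemma japanese_minus [simp]: "japanese (- x) = japanese x"
  by (simp add: japanese_def)

text \<open>Peetre's inequality, with a constant that is not sharp: |x + y|^2 is at most 2|x|^2 +
  2|y|^2, and 1 plus this is at most 4 (1 + |x|^2)(1 + |y|^2). It moves weights from one point to
  another at the cost of a weight in the difference.\<close>

lemma japanese_add_le: "japanese (x + y) \<le> 2 * japanese x * japanese y"
proof -
  have aux: "1 + c \<le> 2\<^sup>2 * ((1 + a) * (1 + b))"
    if "c \<le> 2 * a + 2 * b" "0 \<le> a" "0 \<le> b" "0 \<le> a * b" for a b c :: real
  proof -
    have "2\<^sup>2 * ((1 + a) * (1 + b)) = 4 + 4 * a + 4 * b + 4 * (a * b)"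
      by (simp add: algebra_simps)
    then show ?thesis using that by linarith
  qed
  have "(norm (x + y))\<^sup>2 \<le> (norm x + norm y)\<^sup>2"
    by (simp add: norm_triangle_ineq power_mono)
  also have "\<dots> \<le> 2 * (norm x)\<^sup>2 + 2 * (norm y)\<^sup>2"
    using sum_squares_bound[of "norm x" "norm y"] by (simp add: power2_sum)
  finally have "1 + (norm (x + y))\<^sup>2 \<le> 2\<^sup>2 * ((1 + (norm x)\<^sup>2) * (1 + (norm y)\<^sup>2))"
    using aux zero_le_power2 by (metis mult_nonneg_nonneg)
  then have "japanese (x + y) \<le> sqrt (2\<^sup>2 * ((1 + (norm x)\<^sup>2) * (1 + (norm y)\<^sup>2)))"
    unfolding japanese_def by (rule real_sqrt_le_mono)
  then show ?thesis by (simp add: japanese_def real_sqrt_mult)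
qed

lemma japanese_le_Peetre: "japanese x \<le> 2 * japanese y * japanese (x - y)"
  using japanese_add_le[of y "x - y"] by simp

lemma japanese_power_ge_1: "1 \<le> japanese x ^ n"
  using japanese_ge_1 one_le_power by blast

lemma japanese_power_pos [simp]: "0 < japanese x ^ n"
  by simp

lemma japanese_power_mono: "m \<le> n \<Longrightarrow> japanese x ^ m \<le> japanese x ^ n"
  using japanese_ge_1 power_increasing by blast

lemma japanese_power_Peetre: "japanese x ^ n \<le> 2 ^ n * japanese y ^ n * japanese (x - y) ^ n"
  using power_mono[OF japanese_le_Peetre japanese_nonneg] by (metis power_mult_distrib)

lemma continuous_on_japanese [continuous_intros]:
  "continuous_on A f \<Longrightarrow> continuous_on A (\<lambda>x. japanese (f x))"
  unfolding japanese_def by (intro continuous_intros)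

lemma borel_measurable_japanese [measurable]: "japanese \<in> borel_measurable borel"
  unfolding japanese_def by measurable

lemma rapidly_decreasing_on_iff:
  "rapidly_decreasing_on \<Gamma> F \<longleftrightarrow> (\<forall>N. \<exists>C. \<forall>z\<in>\<Gamma>. japanese z ^ N * cmod (F z) \<le> C)"
  by (auto simp: rapidly_decreasing_on_def bdd_above_def)

section \<open>Jets and the Leibniz estimate\<close>

definition multi_idx :: "nat \<Rightarrow> 'a::euclidean_space list set" where
  "multi_idx N = {bs. set bs \<subseteq> Basis \<and> length bs \<le> N}"

text \<open>A pointwise finite sum in place of the supremum in \<open>schwartz_seminorm\<close>: it
  can be estimated without first showing that anything is bounded, and weights can be distributed at
  each point separately.\<close>

definition jet_norm :: "nat \<Rightarrow> ('a::euclidean_space \<Rightarrow> complex) \<Rightarrow> 'a \<Rightarrow> real" where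
  "jet_norm N f x = (\<Sum>bs\<in>multi_idx N. cmod (iter_deriv bs f x))"

lemma finite_multi_idx [simp]: "finite (multi_idx N)"
  unfolding multi_idx_def by (rule finite_lists_length_le) simp

lemma Nil_in_multi_idx [simp]: "[] \<in> multi_idx N"
  by (simp add: multi_idx_def)

lemma card_multi_idx_pos: "0 < card (multi_idx N)"
  using Nil_in_multi_idx finite_multi_idx card_gt_0_iff by blast

lemma jet_norm_nonneg [simp]: "0 \<le> jet_norm N f x"
  by (simp add: jet_norm_def sum_nonneg)

lemma iter_deriv_le_jet_norm: "bs \<in> multi_idx N \<Longrightarrow> cmod (iter_deriv bs f x) \<le> jet_norm N f x"
  unfolding jet_norm_def by (rule member_le_sum) auto

lemma norm_le_jet_norm: "cmod (f x) \<le> jet_norm N f x"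
  using iter_deriv_le_jet_norm[of "[]"] by simp

lemma jet_norm_cmult: "smooth_fun f \<Longrightarrow> jet_norm N (\<lambda>x. c * f x) x = cmod c * jet_norm N f x"
  by (simp add: jet_norm_def iter_deriv_cmult multi_idx_def norm_mult sum_distrib_left)

lemma jet_norm_cnj: "smooth_fun f \<Longrightarrow> jet_norm N (\<lambda>x. cnj (f x)) x = jet_norm N f x"
  by (simp add: jet_norm_def iter_deriv_cnj multi_idx_def)

lemma jet_norm_add_le: "smooth_fun f \<Longrightarrow> smooth_fun g \<Longrightarrow>
    jet_norm N (\<lambda>x. f x + g x) x \<le> jet_norm N f x + jet_norm N g x"
  unfolding jet_norm_def sum.distrib[symmetric]
  by (rule sum_mono) (simp add: iter_deriv_add multi_idx_def norm_triangle_ineq)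

text \<open>Every derivative produces a factor \<open>r\<close>, harmless when
  \<open>\<bar>r\<bar> \<le> 1\<close>. This covers translations, reflections and the dilations in
  the truncation argument.\<close>

lemma jet_norm_affine_arg_le:
  assumes "smooth_fun f" "\<bar>r\<bar> \<le> 1"
  shows "jet_norm N (\<lambda>x. f (r *\<^sub>R x + a)) x \<le> jet_norm N f (r *\<^sub>R x + a)"
  unfolding jet_norm_def
proof (rule sum_mono)
  fix bs :: "'a list" assume "bs \<in> multi_idx N"
  then have "cmod (iter_deriv bs (\<lambda>x. f (r *\<^sub>R x + a)) x) =
      \<bar>r\<bar> ^ length bs * cmod (iter_deriv bs f (r *\<^sub>R x + a))"
    using assms by (simp add: iter_deriv_affine_arg multi_idx_def norm_mult norm_power)
  also have "\<dots> \<le> cmod (iter_deriv bs f (r *\<^sub>R x + a))"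
    using assms by (intro mult_left_le_one_le power_le_one) auto
  finally show "cmod (iter_deriv bs (\<lambda>x. f (r *\<^sub>R x + a)) x) \<le> cmod (iter_deriv bs f (r *\<^sub>R x + a))" .
qed

lemma jet_norm_cong_open:
  assumes "open U" "\<And>y. y \<in> U \<Longrightarrow> f y = g y" "x \<in> U"
  shows "jet_norm N f x = jet_norm N g x"
  unfolding jet_norm_def using iter_deriv_cong_open[OF assms] by simp

lemma jet_norm_zero: "jet_norm N (\<lambda>x. 0) x = 0"
  by (simp add: jet_norm_def iter_deriv_zero_fun multi_idx_def)

lemma jet_norm_not_in_support: "x \<notin> fun_support f \<Longrightarrow> jet_norm N f x = 0"
  by (simp add: jet_norm_def iter_deriv_not_in_support multi_idx_def)

text \<open>The binomial sum is avoided: the first derivative splits the product into two products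
  that satisfy the same bounds with one order less, so each order costs a factor 2.\<close>

lemma leibniz_bound:
  assumes "smooth_fun f" "smooth_fun g" "set bs \<subseteq> Basis" "0 \<le> A"
    and "\<And>cs. set cs \<subseteq> Basis \<Longrightarrow> length cs \<le> length bs \<Longrightarrow> cmod (iter_deriv cs f x) \<le> A"
    and "\<And>cs. set cs \<subseteq> Basis \<Longrightarrow> length cs \<le> length bs \<Longrightarrow> cmod (iter_deriv cs g x) \<le> B"
  shows "cmod (iter_deriv bs (\<lambda>x. f x * g x) x) \<le> 2 ^ length bs * (A * B)"
  using assms(1-3,5,6)
proof (induction bs arbitrary: f g rule: rev_induct)
  case Nil
  then show ?case using assms(4) Nil(4)[of "[]"] Nil(5)[of "[]"] by (simp add: norm_mult mult_mono)
next
  case (snoc b bs)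
  have b: "b \<in> Basis" "set bs \<subseteq> Basis" using snoc.prems by auto
  note sm = snoc.prems(1,2) smooth_fun_dir_deriv[OF snoc.prems(1) b(1)] smooth_fun_dir_deriv[OF snoc.prems(2) b(1)]
  have "cmod (iter_deriv bs (\<lambda>x. dir_deriv b f x * g x) x) \<le> 2 ^ length bs * (A * B)"
  proof (rule snoc.IH[OF sm(3,2) b(2)])
    fix cs :: "'a list" assume "set cs \<subseteq> Basis" "length cs \<le> length bs"
    then show "cmod (iter_deriv cs (dir_deriv b f) x) \<le> A"
      using snoc.prems(4)[of "cs @ [b]"] b by (simp add: iter_deriv_append)
  qed (use snoc.prems(5) in simp)
  moreover have "cmod (iter_deriv bs (\<lambda>x. f x * dir_deriv b g x) x) \<le> 2 ^ length bs * (A * B)"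
  proof (rule snoc.IH[OF sm(1,4) b(2)])
    fix cs :: "'a list" assume "set cs \<subseteq> Basis" "length cs \<le> length bs"
    then show "cmod (iter_deriv cs (dir_deriv b g) x) \<le> B"
      using snoc.prems(5)[of "cs @ [b]"] b by (simp add: iter_deriv_append)
  qed (use snoc.prems(4) in simp)
  moreover have "iter_deriv (bs @ [b]) (\<lambda>x. f x * g x) x =
      iter_deriv bs (\<lambda>x. dir_deriv b f x * g x) x + iter_deriv bs (\<lambda>x. f x * dir_deriv b g x) x"
    using sm b by (simp add: iter_deriv_append dir_deriv_mult iter_deriv_add smooth_fun_mult)
  ultimately show ?case
    using norm_triangle_ineq[of "iter_deriv bs (\<lambda>x. dir_deriv b f x * g x) x"
        "iter_deriv bs (\<lambda>x. f x * dir_deriv b g x) x"] by simp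
qed

text \<open>The constant is found before the functions and the point. Uniformity matters because one
  factor will often be an exponential whose frequency varies.\<close>

lemma jet_norm_mult_le:
  obtains C where "0 < C"
    "\<And>f g (x::'a::euclidean_space). smooth_fun f \<Longrightarrow> smooth_fun g \<Longrightarrow>
       jet_norm N (\<lambda>x. f x * g x) x \<le> C * (jet_norm N f x * jet_norm N g x)"
proof
  let ?C = "real (card (multi_idx N :: 'a list set)) * 2 ^ N"
  show "0 < ?C" by (simp add: card_multi_idx_pos)
  fix f g :: "'a \<Rightarrow> complex" and x assume fg: "smooth_fun f" "smooth_fun g"
  have "cmod (iter_deriv bs (\<lambda>x. f x * g x) x) \<le> 2 ^ N * (jet_norm N f x * jet_norm N g x)"
    if bs: "bs \<in> multi_idx N" for bs
  proof -
    have "cmod (iter_deriv bs (\<lambda>x. f x * g x) x) \<le> 2 ^ length bs * (jet_norm N f x * jet_norm N g x)"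
      using bs by (intro leibniz_bound fg iter_deriv_le_jet_norm) (auto simp: multi_idx_def)
    also have "\<dots> \<le> 2 ^ N * (jet_norm N f x * jet_norm N g x)"
      using bs by (intro mult_right_mono power_increasing) (auto simp: multi_idx_def)
    finally show ?thesis .
  qed
  from sum_bounded_above[of "multi_idx N", OF this]
  show "jet_norm N (\<lambda>x. f x * g x) x \<le> ?C * (jet_norm N f x * jet_norm N g x)"
    by (simp add: jet_norm_def mult.assoc)
qed

lemma cmod_prod_list_le:
  assumes "set bs \<subseteq> Basis"
  shows "cmod (\<Prod>b\<leftarrow>bs. \<i> * complex_of_real (b \<bullet> \<xi>)) \<le> japanese \<xi> ^ length bs"
  using assms
proof (induction bs)
  case (Cons b bs)
  have "\<bar>b \<bullet> \<xi>\<bar> \<le> norm \<xi>" using Cons Basis_le_norm[of b \<xi>] by (simp add: inner_commute)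
  then have "\<bar>b \<bullet> \<xi>\<bar> \<le> japanese \<xi>" using norm_le_japanese[of \<xi>] by linarith
  then show ?case using Cons by (auto simp: norm_mult intro!: mult_mono)
qed simp

lemma jet_norm_cis_le:
  obtains C where "0 < C" "\<And>x \<xi>::'a::euclidean_space. jet_norm N (\<lambda>x. cis (x \<bullet> \<xi>)) x \<le> C * japanese \<xi> ^ N"
proof
  let ?C = "real (card (multi_idx N :: 'a list set))"
  show "0 < ?C" by (simp add: card_multi_idx_pos)
  fix x \<xi> :: 'a
  have "cmod (iter_deriv bs (\<lambda>x. cis (x \<bullet> \<xi>)) x) \<le> japanese \<xi> ^ N" if "bs \<in> multi_idx N" for bs
  proof -
    have "cmod (iter_deriv bs (\<lambda>x. cis (x \<bullet> \<xi>)) x) \<le> japanese \<xi> ^ length bs"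
      using that cmod_prod_list_le[of bs \<xi>] by (simp add: iter_deriv_cis multi_idx_def norm_mult)
    also have "\<dots> \<le> japanese \<xi> ^ N" using that by (intro japanese_power_mono) (simp add: multi_idx_def)
    finally show ?thesis .
  qed
  from sum_bounded_above[of "multi_idx N", OF this]
  show "jet_norm N (\<lambda>x. cis (x \<bullet> \<xi>)) x \<le> ?C * japanese \<xi> ^ N" by (simp add: jet_norm_def)
qed

section \<open>Schwartz functions and their multipliers in terms of jets\<close>

lemma schwartz_smooth: "f \<in> schwartz \<Longrightarrow> smooth_fun f"
  by (simp add: schwartz_def)

lemma schwartz_iff:
  "f \<in> schwartz \<longleftrightarrow> smooth_fun f \<and> (\<forall>N M. \<exists>C. \<forall>x. japanese x ^ M * jet_norm N f x \<le> C)"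
proof safe
  fix N M assume f: "f \<in> schwartz"
  have "\<forall>bs\<in>multi_idx N. \<exists>C. \<forall>x. japanese x ^ M * cmod (iter_deriv bs f x) \<le> C"
    using f by (auto simp: schwartz_def rapidly_decreasing_on_iff multi_idx_def)
  then obtain C where C: "\<And>bs x. bs \<in> multi_idx N \<Longrightarrow> japanese x ^ M * cmod (iter_deriv bs f x) \<le> C bs"
    by metis
  have "japanese x ^ M * jet_norm N f x \<le> (\<Sum>bs\<in>multi_idx N. C bs)" for x
    unfolding jet_norm_def sum_distrib_left by (rule sum_mono) (rule C)
  then show "\<exists>C. \<forall>x. japanese x ^ M * jet_norm N f x \<le> C" by blast
next
  assume f: "smooth_fun f" and R: "\<forall>N M. \<exists>C. \<forall>x. japanese x ^ M * jet_norm N f x \<le> C"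
  have "\<exists>C. \<forall>x. japanese x ^ M * cmod (iter_deriv bs f x) \<le> C" if "set bs \<subseteq> Basis" for bs M
  proof -
    have "japanese x ^ M * cmod (iter_deriv bs f x) \<le> japanese x ^ M * jet_norm (length bs) f x" for x
      using that by (intro mult_left_mono iter_deriv_le_jet_norm) (auto simp: multi_idx_def)
    then show ?thesis using R by (meson order_trans)
  qed
  then show "f \<in> schwartz" using f by (simp add: schwartz_def rapidly_decreasing_on_iff)
qed (simp add: schwartz_def)

lemma schwartz_bound:
  assumes "f \<in> schwartz"
  obtains C where "0 \<le> C" "\<And>x. japanese x ^ M * jet_norm N f x \<le> C"
proof -
  obtain C where C: "\<And>x. japanese x ^ M * jet_norm N f x \<le> C"
    using assms schwartz_iff by metis
  moreover have "0 \<le> C" using order_trans[OF _ C] by (meson jet_norm_nonneg japanese_power_pos less_imp_le mult_nonneg_nonneg)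
  ultimately show ?thesis using that by blast
qed

lemma schwartz_bound_cmod:
  assumes "f \<in> schwartz"
  obtains C where "0 \<le> C" "\<And>x. japanese x ^ M * cmod (f x) \<le> C"
proof -
  obtain C where C: "0 \<le> C" "\<And>x. japanese x ^ M * jet_norm 0 f x \<le> C"
    using schwartz_bound[OF assms] by metis
  have "japanese x ^ M * cmod (f x) \<le> C" for x
    using order_trans[OF mult_left_mono[OF norm_le_jet_norm[of f x 0]] C(2)] by simp
  then show ?thesis using that C(1) by blast
qed

text \<open>The multipliers of the Schwartz space.\<close>

definition slow_fun :: "('a::euclidean_space \<Rightarrow> complex) \<Rightarrow> bool" where
  "slow_fun f \<longleftrightarrow> smooth_fun f \<and> (\<forall>N. \<exists>C M. \<forall>x. jet_norm N f x \<le> C * japanese x ^ M)"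

lemma slow_funI:
  assumes "smooth_fun f"
    and "\<And>bs. set bs \<subseteq> Basis \<Longrightarrow> \<exists>C M. \<forall>x. cmod (iter_deriv bs f x) \<le> C * japanese x ^ M"
  shows "slow_fun f"
  unfolding slow_fun_def
proof (intro conjI assms(1) allI)
  fix N
  have "\<forall>bs\<in>multi_idx N. \<exists>C M. \<forall>x. cmod (iter_deriv bs f x) \<le> C * japanese x ^ M"
    using assms(2) by (auto simp: multi_idx_def)
  then obtain C M where CM: "\<And>bs x. bs \<in> multi_idx N \<Longrightarrow> cmod (iter_deriv bs f x) \<le> C bs * japanese x ^ M bs"
    by metis
  \<comment> \<open>The sum of the exponents dominates each of them, and the weight is at least 1,
    so one exponent serves all indices.\<close>
  let ?M = "\<Sum>bs\<in>multi_idx N. M bs"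
  have "cmod (iter_deriv bs f x) \<le> \<bar>C bs\<bar> * japanese x ^ ?M" if bs: "bs \<in> multi_idx N" for bs x
  proof -
    have "cmod (iter_deriv bs f x) \<le> C bs * japanese x ^ M bs" using CM bs .
    also have "\<dots> \<le> \<bar>C bs\<bar> * japanese x ^ ?M"
      using bs by (intro mult_mono japanese_power_mono member_le_sum) auto
    finally show ?thesis .
  qed
  then have "jet_norm N f x \<le> (\<Sum>bs\<in>multi_idx N. \<bar>C bs\<bar>) * japanese x ^ ?M" for x
    unfolding jet_norm_def sum_distrib_right by (intro sum_mono) auto
  then show "\<exists>C M. \<forall>x. jet_norm N f x \<le> C * japanese x ^ M" by blast
qed

lemma slow_fun_smooth: "slow_fun f \<Longrightarrow> smooth_fun f"
  by (simp add: slow_fun_def)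

lemma iter_deriv_const: "set bs \<subseteq> Basis \<Longrightarrow> iter_deriv bs (\<lambda>x. c) = (\<lambda>x. if bs = [] then c else 0)"
  by (induction bs) (auto simp: dir_deriv_const)

lemma dir_deriv_bounded_linear: "bounded_linear L \<Longrightarrow> dir_deriv b L = (\<lambda>x. L b)"
  using dir_deriv_eq[OF bounded_linear_imp_has_derivative] by blast

lemma slow_fun_bounded_linear:
  assumes "bounded_linear L" shows "slow_fun L"
proof (rule slow_funI)
  fix bs :: "'a list" assume bs: "set bs \<subseteq> Basis"
  show "\<exists>C M. \<forall>x. cmod (iter_deriv bs L x) \<le> C * japanese x ^ M"
  proof (cases bs rule: rev_cases)
    case Nil
    obtain K where "0 < K" and K: "\<And>x. norm (L x) \<le> norm x * K"
      using bounded_linear.pos_bounded[OF assms] by blast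
    have "cmod (iter_deriv bs L x) \<le> K * japanese x ^ 1" for x
      using order_trans[OF K mult_right_mono[OF norm_le_japanese]] \<open>0 < K\<close> Nil by (simp add: mult.commute)
    then show ?thesis by blast
  next
    case (snoc cs b)
    have "cmod (iter_deriv bs L x) \<le> cmod (L b) * japanese x ^ 0" for x
      using bs snoc by (simp add: iter_deriv_append dir_deriv_bounded_linear[OF assms] iter_deriv_const)
    then show ?thesis by blast
  qed
qed (simp add: assms smooth_fun_bounded_linear)

lemma slow_fun_cis: "slow_fun (\<lambda>x. cis (x \<bullet> \<xi>))"
  unfolding slow_fun_def
proof (intro conjI allI)
  fix N
  obtain C where "\<And>x. jet_norm N (\<lambda>x. cis (x \<bullet> \<xi>)) x \<le> C * japanese \<xi> ^ N"
    using jet_norm_cis_le by metis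
  then show "\<exists>C M. \<forall>x. jet_norm N (\<lambda>x. cis (x \<bullet> \<xi>)) x \<le> C * japanese x ^ M"
    by (intro exI[of _ "C * japanese \<xi> ^ N"] exI[of _ 0]) simp
qed simp

lemma schwartz_slow: "f \<in> schwartz \<Longrightarrow> slow_fun f"
  unfolding slow_fun_def
proof (intro conjI allI schwartz_smooth)
  fix N assume "f \<in> schwartz"
  then obtain C where C: "\<And>x. japanese x ^ 0 * jet_norm N f x \<le> C"
    using schwartz_bound[of f 0 N] by metis
  then show "\<exists>C M. \<forall>x. jet_norm N f x \<le> C * japanese x ^ M"
    by (intro exI[of _ C] exI[of _ 0]) simp
qed

lemma schwartz_mult:
  assumes "slow_fun f" "g \<in> schwartz" shows "(\<lambda>x. f x * g x) \<in> schwartz"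
  unfolding schwartz_iff
proof (intro conjI allI)
  show "smooth_fun (\<lambda>x. f x * g x)"
    using assms by (simp add: smooth_fun_mult slow_fun_smooth schwartz_smooth)
  fix N M
  obtain A K where A: "\<And>x. jet_norm N f x \<le> A * japanese x ^ K"
    using assms(1) slow_fun_def by metis
  obtain B where B: "0 \<le> B" "\<And>x. japanese x ^ (M + K) * jet_norm N g x \<le> B"
    using schwartz_bound[OF assms(2)] by metis
  obtain C where C: "0 < C" "\<And>f g (x::'a). smooth_fun f \<Longrightarrow> smooth_fun g \<Longrightarrow>
       jet_norm N (\<lambda>x. f x * g x) x \<le> C * (jet_norm N f x * jet_norm N g x)"
    using jet_norm_mult_le by blast
  have "japanese x ^ M * jet_norm N (\<lambda>x. f x * g x) x \<le> C * \<bar>A\<bar> * B" for x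
  proof -
    have "jet_norm N f x \<le> \<bar>A\<bar> * japanese x ^ K"
      by (rule order_trans[OF A mult_right_mono]) auto
    then have "jet_norm N f x * jet_norm N g x \<le> \<bar>A\<bar> * japanese x ^ K * jet_norm N g x"
      by (intro mult_right_mono) auto
    then have "C * (jet_norm N f x * jet_norm N g x) \<le> C * (\<bar>A\<bar> * japanese x ^ K * jet_norm N g x)"
      using C(1) by (intro mult_left_mono) auto
    then have "jet_norm N (\<lambda>x. f x * g x) x \<le> C * (\<bar>A\<bar> * japanese x ^ K * jet_norm N g x)"
      using C(2)[of f g x] assms slow_fun_smooth schwartz_smooth by fastforce
    then have "japanese x ^ M * jet_norm N (\<lambda>x. f x * g x) x \<le> japanese x ^ M * (C * (\<bar>A\<bar> * japanese x ^ K * jet_norm N g x))"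
      by (intro mult_left_mono) auto
    also have "\<dots> = C * \<bar>A\<bar> * (japanese x ^ (M + K) * jet_norm N g x)"
      by (simp add: power_add)
    also have "\<dots> \<le> C * \<bar>A\<bar> * B" using B C(1) by (intro mult_left_mono) auto
    finally show ?thesis .
  qed
  then show "\<exists>C. \<forall>x. japanese x ^ M * jet_norm N (\<lambda>x. f x * g x) x \<le> C" by blast
qed

lemma schwartz_zero: "(\<lambda>x. 0) \<in> schwartz"
  unfolding schwartz_iff by (auto simp: jet_norm_zero)

lemma schwartz_add:
  assumes "f \<in> schwartz" "g \<in> schwartz" shows "(\<lambda>x. f x + g x) \<in> schwartz"
  unfolding schwartz_iff
proof (intro conjI allI)
  note sm = assms[THEN schwartz_smooth]
  show "smooth_fun (\<lambda>x. f x + g x)" by (intro smooth_fun_add sm)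
  fix N M
  obtain A where A: "\<And>x. japanese x ^ M * jet_norm N f x \<le> A" using schwartz_bound[OF assms(1)] by metis
  obtain B where B: "\<And>x. japanese x ^ M * jet_norm N g x \<le> B" using schwartz_bound[OF assms(2)] by metis
  have "japanese x ^ M * jet_norm N (\<lambda>x. f x + g x) x \<le> A + B" for x
    using mult_left_mono[OF jet_norm_add_le[OF sm, of N x], of "japanese x ^ M"] A[of x] B[of x]
    by (simp add: distrib_left)
  then show "\<exists>C. \<forall>x. japanese x ^ M * jet_norm N (\<lambda>x. f x + g x) x \<le> C" by blast
qed

lemma slow_fun_const: "slow_fun (\<lambda>x. c)"
proof (rule slow_funI)
  fix bs :: "'a list" assume "set bs \<subseteq> Basis"
  then show "\<exists>C M. \<forall>x. cmod (iter_deriv bs (\<lambda>x. c) x) \<le> C * japanese x ^ M"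
    by (intro exI[of _ "cmod c"] exI[of _ 0]) (simp add: iter_deriv_const)
qed simp

lemma schwartz_cmult: "f \<in> schwartz \<Longrightarrow> (\<lambda>x. c * f x) \<in> schwartz"
  by (rule schwartz_mult[OF slow_fun_const])

lemma schwartz_diff: "f \<in> schwartz \<Longrightarrow> g \<in> schwartz \<Longrightarrow> (\<lambda>x. f x - g x) \<in> schwartz"
  using schwartz_add[OF _ schwartz_cmult[of g "-1"]] by simp

lemma schwartz_sum: "(\<And>i. i \<in> I \<Longrightarrow> f i \<in> schwartz) \<Longrightarrow> (\<lambda>x. \<Sum>i\<in>I. f i x) \<in> schwartz"
  by (induction I rule: infinite_finite_induct) (auto intro: schwartz_add schwartz_zero)

lemma schwartz_cnj: "f \<in> schwartz \<Longrightarrow> (\<lambda>x. cnj (f x)) \<in> schwartz"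
  by (auto simp: schwartz_iff smooth_fun_cnj jet_norm_cnj)

lemma schwartz_affine_arg:
  assumes f: "f \<in> schwartz" and r: "\<bar>r\<bar> = 1"
  shows "(\<lambda>x. f (r *\<^sub>R x + a)) \<in> schwartz"
  unfolding schwartz_iff
proof (intro conjI allI smooth_fun_affine_arg schwartz_smooth f)
  fix N M
  obtain A where A: "0 \<le> A" "\<And>x. japanese x ^ M * jet_norm N f x \<le> A" using schwartz_bound[OF f] by metis
  have "japanese x ^ M * jet_norm N (\<lambda>x. f (r *\<^sub>R x + a)) x \<le> 2 ^ M * japanese a ^ M * A" for x
  proof -
    have "japanese x ^ M = japanese (r *\<^sub>R x) ^ M" using r by (simp add: japanese_def)
    also have "\<dots> \<le> 2 ^ M * japanese (r *\<^sub>R x + a) ^ M * japanese (r *\<^sub>R x - (r *\<^sub>R x + a)) ^ M"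
      by (rule japanese_power_Peetre)
    finally have "japanese x ^ M * jet_norm N (\<lambda>x. f (r *\<^sub>R x + a)) x \<le>
        (2 ^ M * japanese (r *\<^sub>R x + a) ^ M * japanese a ^ M) * jet_norm N f (r *\<^sub>R x + a)"
      using jet_norm_affine_arg_le[OF schwartz_smooth[OF f], of r N a x] r by (intro mult_mono) auto
    also have "\<dots> = 2 ^ M * japanese a ^ M * (japanese (r *\<^sub>R x + a) ^ M * jet_norm N f (r *\<^sub>R x + a))"
      by (simp add: mult_ac)
    also have "\<dots> \<le> 2 ^ M * japanese a ^ M * A" using A by (intro mult_left_mono) auto
    finally show ?thesis .
  qed
  then show "\<exists>C. \<forall>x. japanese x ^ M * jet_norm N (\<lambda>x. f (r *\<^sub>R x + a)) x \<le> C" by blast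
qed

lemma schwartz_translate: "f \<in> schwartz \<Longrightarrow> translate a f \<in> schwartz"
  using schwartz_affine_arg[of f 1 "- a"] by (simp add: translate_def)

lemma schwartz_reflect: "f \<in> schwartz \<Longrightarrow> (\<lambda>x. f (- x)) \<in> schwartz"
  using schwartz_affine_arg[of f "-1" 0] by simp

lemma schwartz_modulate: "f \<in> schwartz \<Longrightarrow> modulate \<xi> f \<in> schwartz"
  unfolding modulate_def by (rule schwartz_mult[OF slow_fun_cis])

lemma schwartz_dir_deriv: "f \<in> schwartz \<Longrightarrow> b \<in> Basis \<Longrightarrow> dir_deriv b f \<in> schwartz"
proof -
  assume f: "f \<in> schwartz" and b: "b \<in> Basis"
  have "rapidly_decreasing_on UNIV (iter_deriv bs (dir_deriv b f))" if "set bs \<subseteq> Basis" for bs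
    using f that b iter_deriv_append[of bs "[b]" f] unfolding schwartz_def
    by (auto dest!: spec[of _ "bs @ [b]"])
  then show ?thesis using f b by (simp add: schwartz_def smooth_fun_dir_deriv)
qed

section \<open>Test functions\<close>

lemma test_functions_schwartz:
  assumes "f \<in> test_functions" shows "f \<in> schwartz"
proof -
  have f: "smooth_fun f" "compact (fun_support f)" using assms by (auto simp: test_functions_def)
  have "\<exists>C. \<forall>x. japanese x ^ M * jet_norm N f x \<le> C" for N M
  proof -
    have "continuous_on (fun_support f) (\<lambda>x. japanese x ^ M * jet_norm N f x)"
      unfolding jet_norm_def using f(1)
      by (intro continuous_intros smooth_fun_continuous_on smooth_fun_iter_deriv) (auto simp: multi_idx_def)
    then have "bounded ((\<lambda>x. japanese x ^ M * jet_norm N f x) ` fun_support f)"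
      using f(2) compact_continuous_image compact_imp_bounded by blast
    then obtain C where C: "\<And>x. x \<in> fun_support f \<Longrightarrow> japanese x ^ M * jet_norm N f x \<le> C"
      unfolding bounded_iff using abs_le_D1 by fastforce
    have "japanese x ^ M * jet_norm N f x \<le> \<bar>C\<bar>" for x
      using C[of x] jet_norm_not_in_support[of x f N] by (cases "x \<in> fun_support f") auto
    then show ?thesis by blast
  qed
  then show ?thesis using f by (simp add: schwartz_iff)
qed

lemma test_functionsI:
  assumes "smooth_fun f" "compact K" "\<And>x. x \<notin> K \<Longrightarrow> f x = 0"
  shows "f \<in> test_functions" "fun_support f \<subseteq> K"
proof -
  show "fun_support f \<subseteq> K"
    using assms by (intro fun_support_subsetI) (auto simp: compact_imp_closed)
  then show "f \<in> test_functions"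
    using assms(1) compact_Int_closed[OF assms(2) closed_fun_support[of f]]
    by (simp add: test_functions_def Int_absorb1)
qed

lemma test_functions_smooth: "f \<in> test_functions \<Longrightarrow> smooth_fun f"
  and test_functions_compact: "f \<in> test_functions \<Longrightarrow> compact (fun_support f)"
  by (simp_all add: test_functions_def)

lemma test_functions_mult:
  assumes "f \<in> test_functions" "smooth_fun g"
  shows "(\<lambda>x. f x * g x) \<in> test_functions" and "fun_support (\<lambda>x. f x * g x) \<subseteq> fun_support f"
  using test_functionsI[of "\<lambda>x. f x * g x" "fun_support f"]
    assms by (auto simp: test_functions_def smooth_fun_mult not_in_fun_support)

text \<open>\<open>bump_aux 0\<close> is exp(-1/t) extended by 0. The powers of 1/t are included
  because differentiation stays within the span of this family.\<close>

definition bump_aux :: "nat \<Rightarrow> real \<Rightarrow> real" where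
  "bump_aux n t = (if t > 0 then exp (- inverse t) * inverse t ^ n else 0)"

text \<open>Quadratic vanishing at 0 yields the derivative 0 there. With k = n + 2, exp(1/t) is at
  least (1 + 1/(tk))^k and so at least (1/(tk))^k: of the k powers of t gained, n cancel the
  singular factor and two remain.\<close>

lemma bump_aux_le: "\<bar>bump_aux n t\<bar> \<le> real (n + 2) ^ (n + 2) * t\<^sup>2"
proof (cases "t > 0")
  case True
  let ?k = "n + 2"
  have "(1 / (t * real ?k)) ^ ?k \<le> (1 + (1 / t) / real ?k) ^ ?k"
    using True by (intro power_mono) (auto simp: field_simps)
  also have "\<dots> \<le> exp (1 / t)"
    using True by (intro exp_ge_one_plus_x_over_n_power_n) (auto intro: order_trans[of _ 0])
  finally have "1 \<le> exp (1 / t) * (t * real ?k) ^ ?k"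
    using True by (simp add: power_divide divide_le_eq)
  then have "exp (- (1 / t)) \<le> (t * real ?k) ^ ?k"
    by (simp add: exp_minus field_simps)
  then have "exp (- (1 / t)) / t ^ n \<le> (t * real ?k) ^ ?k / t ^ n"
    using True by (intro divide_right_mono) auto
  also have "(t * real ?k) ^ ?k = t ^ n * (t ^ 2 * real ?k ^ ?k)"
    by (simp only: power_mult_distrib power_add mult_ac)
  finally show ?thesis using True by (simp add: bump_aux_def field_simps)
qed (simp add: bump_aux_def)

lemma bump_aux_deriv:
  "(bump_aux n has_real_derivative (bump_aux (n + 2) t - n * bump_aux (n + 1) t)) (at t)"
proof -
  consider "t > 0" | "t < 0" | "t = 0" by linarith
  then show ?thesis
  proof cases
    case 1
    have "((\<lambda>t. exp (- inverse t) * inverse t ^ n) has_real_derivative (bump_aux (n + 2) t - n * bump_aux (n + 1) t)) (at t)"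
    proof (rule DERIV_cong[OF DERIV_mult])
      show "((\<lambda>t. exp (- inverse t)) has_real_derivative exp (- inverse t) * inverse t ^ 2) (at t)"
        using 1 by (auto intro!: derivative_eq_intros simp: power2_eq_square)
      show "((\<lambda>t. inverse t ^ n) has_real_derivative - (n * inverse t ^ (n + 1))) (at t)"
        using DERIV_power[OF DERIV_inverse[of t], of n] 1 by (cases n; simp add: mult.assoc)
    qed (use 1 in \<open>simp add: bump_aux_def algebra_simps power2_eq_square\<close>)
    then show ?thesis
      by (rule has_field_derivative_transform_within_open[of _ _ _ "{0<..}"]) (use 1 in \<open>auto simp: bump_aux_def\<close>)
  next
    case 2
    have "((\<lambda>t. 0) has_real_derivative (bump_aux (n + 2) t - n * bump_aux (n + 1) t)) (at t)"
      using 2 by (simp add: bump_aux_def)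
    then show ?thesis
      by (rule has_field_derivative_transform_within_open[of _ _ _ "{..<0}"]) (use 2 in \<open>auto simp: bump_aux_def\<close>)
  next
    case 3
    have "((\<lambda>h. (bump_aux n h - bump_aux n 0) / h) \<longlongrightarrow> 0) (at 0)"
    proof (rule Lim_null_comparison)
      show "\<forall>\<^sub>F h in at 0. norm ((bump_aux n h - bump_aux n 0) / h) \<le> real (n + 2) ^ (n + 2) * \<bar>h\<bar>"
        unfolding eventually_at_filter
      proof (intro always_eventually allI impI)
        fix h :: real assume "h \<noteq> 0"
        then show "norm ((bump_aux n h - bump_aux n 0) / h) \<le> real (n + 2) ^ (n + 2) * \<bar>h\<bar>"
          using bump_aux_le[of n h] by (simp add: bump_aux_def[of n 0] abs_divide divide_le_eq power2_eq_square mult.assoc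
              flip: abs_mult)
      qed
      show "((\<lambda>h. real (n + 2) ^ (n + 2) * \<bar>h\<bar>) \<longlongrightarrow> 0) (at 0)"
        by (auto intro!: tendsto_eq_intros)
    qed
    then show ?thesis using 3 by (simp add: DERIV_def bump_aux_def[of _ 0])
  qed
qed

text \<open>The free coefficient \<open>s\<close> makes the same lemma serve functions that live
  inside a ball (s = -1) and outside one (s = 1).\<close>

lemma diff_upto_bump: "diff_upto k (\<lambda>x::'a::euclidean_space. complex_of_real (bump_aux n (s * (x \<bullet> x) + c)))"
proof (induction k arbitrary: n)
  case (Suc k)
  let ?q = "\<lambda>x::'a. s * (x \<bullet> x) + c"
  let ?D = "\<lambda>x. bump_aux (n + 2) (?q x) - n * bump_aux (n + 1) (?q x)"
  have der: "((\<lambda>x. complex_of_real (bump_aux n (?q x))) has_derivative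
        (\<lambda>h. complex_of_real (?D x * (2 * s * (x \<bullet> h))))) (at x)" for x
  proof -
    have q: "(?q has_derivative (\<lambda>h. 2 * s * (x \<bullet> h))) (at x)"
      by (auto intro!: derivative_eq_intros simp: inner_commute algebra_simps)
    have "((\<lambda>x. bump_aux n (?q x)) has_derivative (\<lambda>h. ?D x * (2 * s * (x \<bullet> h)))) (at x)"
      using diff_chain_at[OF q bump_aux_deriv[unfolded has_field_derivative_def]] by (simp add: o_def)
    from bounded_linear.has_derivative[OF bounded_linear_of_real this]
    show ?thesis .
  qed
  show ?case
  proof (rule diff_upto_SucI, rule der)
    fix b :: 'a
    have "bounded_linear (\<lambda>x. complex_of_real (x \<bullet> b))"
      by (intro bounded_linear_compose[OF bounded_linear_of_real] bounded_linear_inner_left)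
    then have "diff_upto k (\<lambda>x. (of_real (bump_aux (n + 2) (?q x)) + (- of_nat n) * of_real (bump_aux (n + 1) (?q x)))
        * (of_real (2 * s) * complex_of_real (x \<bullet> b)))"
      by (intro diff_upto_mult diff_upto_add diff_upto_const Suc.IH diff_upto_bounded_linear)
    then show "diff_upto k (\<lambda>x. complex_of_real (?D x * (2 * s * (x \<bullet> b))))"
      by (simp add: algebra_simps)
  qed
qed simp

lemma smooth_fun_bump: "smooth_fun (\<lambda>x::'a::euclidean_space. complex_of_real (bump_aux n (s * (x \<bullet> x) + c)))"
  by (simp add: smooth_fun_iff diff_upto_bump)

lemma bump_aux_0_nonneg [simp]: "0 \<le> bump_aux 0 t"
  and bump_aux_0_eq_0_iff [simp]: "bump_aux 0 t = 0 \<longleftrightarrow> t \<le> 0"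
  by (auto simp: bump_aux_def)

lemma bump_exists:
  fixes p :: "'a::euclidean_space"
  assumes "0 < r"
  obtains \<beta> where "(\<lambda>x. complex_of_real (\<beta> x)) \<in> test_functions"
    "fun_support (\<lambda>x. complex_of_real (\<beta> x)) \<subseteq> cball p r"
    "\<And>x. 0 \<le> \<beta> x" "\<And>x. \<beta> x \<noteq> 0 \<longleftrightarrow> dist p x < r"
proof
  define \<beta> where "\<beta> x = bump_aux 0 ((- 1) * ((x - p) \<bullet> (x - p)) + r\<^sup>2)" for x
  have sm: "smooth_fun (\<lambda>x. complex_of_real (\<beta> x))"
    using smooth_fun_affine_arg[OF smooth_fun_bump[of 0 "- 1" "r\<^sup>2"], of 1 "- p"] by (simp add: \<beta>_def)
  show iff: "\<beta> x \<noteq> 0 \<longleftrightarrow> dist p x < r" for x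
  proof -
    have "\<beta> x \<noteq> 0 \<longleftrightarrow> (norm (x - p))\<^sup>2 < r\<^sup>2"
      by (simp add: \<beta>_def dot_square_norm not_le)
    also have "\<dots> \<longleftrightarrow> norm (x - p) < r" using assms power_strict_mono[of "norm (x - p)" r 2]
        power2_less_imp_less[of "norm (x - p)" r] by auto
    finally show ?thesis by (simp add: dist_norm norm_minus_commute)
  qed
  show "0 \<le> \<beta> x" for x by (simp add: \<beta>_def)
  have z: "complex_of_real (\<beta> x) = 0" if "x \<notin> cball p r" for x using iff[of x] that by (cases "\<beta> x = 0") auto
  show "(\<lambda>x. complex_of_real (\<beta> x)) \<in> test_functions"
    "fun_support (\<lambda>x. complex_of_real (\<beta> x)) \<subseteq> cball p r"
    using test_functionsI[OF sm compact_cball z] by auto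
qed

text \<open>The quotient a / (a + b), where \<open>a\<close> is positive exactly inside radius R + 1
  and \<open>b\<close> exactly outside radius R, so that the denominator has no zero.\<close>

lemma cutoff_exists:
  assumes "0 \<le> R"
  obtains \<theta> :: "'a::euclidean_space \<Rightarrow> complex" where "\<theta> \<in> test_functions"
    "\<And>x. norm x \<le> R \<Longrightarrow> \<theta> x = 1" "\<And>x. R + 1 \<le> norm x \<Longrightarrow> \<theta> x = 0"
proof
  define a where "a x = bump_aux 0 ((- 1) * (x \<bullet> x) + (R + 1)\<^sup>2)" for x :: 'a
  define b where "b x = bump_aux 0 (1 * (x \<bullet> x) + - (R\<^sup>2))" for x :: 'a
  have a0: "a x = 0 \<longleftrightarrow> R + 1 \<le> norm x" for x
    using assms by (auto simp: a_def dot_square_norm power_mono_iff)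
  have b0: "b x = 0 \<longleftrightarrow> norm x \<le> R" for x
    using assms by (auto simp: b_def dot_square_norm power_mono_iff)
  have nn: "0 \<le> a x" "0 \<le> b x" for x by (auto simp: a_def b_def)
  have pos: "a x + b x \<noteq> 0" for x
    using nn[of x] a0[of x] b0[of x] by (auto simp: add_nonneg_eq_0_iff)
  let ?\<theta> = "\<lambda>x. complex_of_real (a x) / (complex_of_real (a x) + complex_of_real (b x))"
  have "smooth_fun ?\<theta>"
    using pos unfolding a_def b_def
    by (intro smooth_fun_quotient smooth_fun_add smooth_fun_bump) (auto simp flip: of_real_add)
  then show "?\<theta> \<in> test_functions"
    by (rule test_functionsI(1)[OF _ compact_cball[of 0 "R + 1"]]) (simp add: a0)
  show "?\<theta> x = 1" if "norm x \<le> R" for x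
    using that pos[of x] b0[of x] by simp
  show "?\<theta> x = 0" if "R + 1 \<le> norm x" for x
    using that a0[of x] by simp
qed

text \<open>A partition of unity with prescribed factors. Finitely many \<Phi> j have no common zero
  on the support of \<theta>, so S, the sum of their squared moduli, is positive there, and \<rho> j
  is the conjugate of \<Phi> j times \<theta> / S. It is used for bump functions adapted to the
  support of a distribution, and again for the windows that witness classical regularity.\<close>

lemma test_function_division:
  fixes \<Phi> :: "'a::euclidean_space \<Rightarrow> 'a \<Rightarrow> complex"
  assumes \<theta>: "\<theta> \<in> test_functions"
    and \<Phi>: "\<And>x. x \<in> fun_support \<theta> \<Longrightarrow> \<Phi> x \<in> test_functions" "\<And>x. x \<in> fun_support \<theta> \<Longrightarrow> \<Phi> x x \<noteq> 0"
  obtains J \<rho> where "finite J" "J \<subseteq> fun_support \<theta>" "\<And>j. j \<in> J \<Longrightarrow> \<rho> j \<in> test_functions"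
    "\<theta> = (\<lambda>x. \<Sum>j\<in>J. \<Phi> j x * \<rho> j x)"
proof -
  have "\<exists>J\<subseteq>fun_support \<theta>. finite J \<and> fun_support \<theta> \<subseteq> (\<Union>j\<in>J. {y. \<Phi> j y \<noteq> 0})"
  proof (rule compactE_image[OF test_functions_compact[OF \<theta>]])
    show "open {y. \<Phi> j y \<noteq> 0}" if "j \<in> fun_support \<theta>" for j
      using smooth_fun_continuous_on[OF test_functions_smooth[OF \<Phi>(1)[OF that]]]
      by (intro open_Collect_neq) auto
    show "fun_support \<theta> \<subseteq> (\<Union>j\<in>fun_support \<theta>. {y. \<Phi> j y \<noteq> 0})" using \<Phi>(2) by auto
  qed blast
  then obtain J where J: "J \<subseteq> fun_support \<theta>" "finite J"
    and cover: "fun_support \<theta> \<subseteq> (\<Union>j\<in>J. {y. \<Phi> j y \<noteq> 0})" by blast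
  define S where "S y = (\<Sum>j\<in>J. \<Phi> j y * cnj (\<Phi> j y))" for y
  have S_eq: "S y = of_real (\<Sum>j\<in>J. (cmod (\<Phi> j y))\<^sup>2)" for y
    by (simp add: S_def flip: complex_norm_square)
  have S: "S y \<noteq> 0" if y: "y \<in> fun_support \<theta>" for y
  proof -
    obtain j where "j \<in> J" "\<Phi> j y \<noteq> 0" using subsetD[OF cover y] by blast
    then have "0 < (\<Sum>j\<in>J. (cmod (\<Phi> j y))\<^sup>2)" using J by (intro sum_pos2[of _ j]) auto
    then show ?thesis unfolding S_eq of_real_eq_0_iff by linarith
  qed
  have smJ: "smooth_fun (\<Phi> j)" if "j \<in> J" for j using that J \<Phi>(1) test_functions_smooth by blast
  have smS: "smooth_fun S" unfolding S_def
    by (intro smooth_fun_sum smooth_fun_mult smooth_fun_cnj smJ)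
  have q: "smooth_fun (\<lambda>x. \<theta> x / S x)"
    using S by (intro smooth_fun_quotient smS test_functions_smooth \<theta>) auto
  define \<rho> where "\<rho> j x = cnj (\<Phi> j x) * (\<theta> x / S x)" for j x
  have "\<rho> j \<in> test_functions" if j: "j \<in> J" for j
  proof (rule test_functionsI(1)[OF _ test_functions_compact[OF \<theta>]])
    show "smooth_fun (\<rho> j)"
      unfolding \<rho>_def by (rule smooth_fun_mult[OF smooth_fun_cnj[OF smJ[OF j]] q])
    show "\<rho> j x = 0" if "x \<notin> fun_support \<theta>" for x
      using not_in_fun_support[OF that] by (simp add: \<rho>_def)
  qed
  moreover have "\<theta> x = (\<Sum>j\<in>J. \<Phi> j x * \<rho> j x)" for x
  proof -
    have "(\<Sum>j\<in>J. \<Phi> j x * \<rho> j x) = S x * (\<theta> x / S x)"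
      by (simp only: S_def \<rho>_def sum_distrib_right mult.assoc)
    also have "S x * (\<theta> x / S x) = \<theta> x"
      using S[of x] not_in_fun_support[of x \<theta>] by (cases "x \<in> fun_support \<theta>") auto
    finally show ?thesis by simp
  qed
  ultimately show ?thesis using that[of J \<rho>] J by blast
qed

section \<open>Integrals of rapidly decreasing functions\<close>

text \<open>Each factor 1 + (x \<bullet> b)^2 is at most the squared weight, so the function is
  dominated by a product of one-dimensional functions 1/(1 + t^2). The exponent 2d, larger than
  necessary, makes this comparison possible.\<close>

lemma integrable_japanese:
  "integrable lborel (\<lambda>x::'a::euclidean_space. 1 / japanese x ^ (2 * DIM('a)))"
proof -
  have one: "integrable lborel (\<lambda>t::real. inverse (1 + t\<^sup>2))"
    using integrable_inverse_1_plus_square by (simp add: einterval_def set_integrable_def)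
  have fin: "(\<integral>\<^sup>+t. ennreal (inverse (1 + t\<^sup>2)) \<partial>lborel) < \<infinity>"
    using one by (simp add: integrable_iff_bounded)
  have "(\<integral>\<^sup>+x. ennreal (\<Prod>b\<in>Basis. inverse (1 + (x \<bullet> b)\<^sup>2)) \<partial>(lborel :: 'a measure)) =
      (\<integral>\<^sup>+x. (\<Prod>b\<in>Basis. ennreal (inverse (1 + (x \<bullet> b)\<^sup>2))) \<partial>(lborel :: 'a measure))"
    by (simp add: prod_ennreal)
  also have "\<dots> = (\<Prod>b\<in>(Basis::'a set). \<integral>\<^sup>+t. ennreal (inverse (1 + t\<^sup>2)) \<partial>lborel)"
    by (rule nn_integral_lborel_prod) auto
  also have "\<dots> < \<infinity>"
    using fin by (simp add: less_top[symmetric] ennreal_prod_eq_top power_eq_top_ennreal)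
  finally have "integrable lborel (\<lambda>x::'a. \<Prod>b\<in>Basis. inverse (1 + (x \<bullet> b)\<^sup>2))"
    by (simp add: integrable_iff_bounded abs_prod prod_nonneg)
  then show ?thesis
  proof (rule Bochner_Integration.integrable_bound)
    have "norm (1 / japanese x ^ (2 * DIM('a))) \<le> norm (\<Prod>b\<in>Basis. inverse (1 + (x \<bullet> b)\<^sup>2))" for x :: 'a
    proof -
      have "(\<Prod>b\<in>(Basis::'a set). 1 + (x \<bullet> b)\<^sup>2) \<le> (\<Prod>b\<in>(Basis::'a set). (japanese x)\<^sup>2)"
      proof (rule prod_mono)
        fix b :: 'a assume "b \<in> Basis"
        then have "\<bar>x \<bullet> b\<bar> \<le> norm x" by (rule Basis_le_norm)
        then have "(x \<bullet> b)\<^sup>2 \<le> (norm x)\<^sup>2" using power_mono[of "\<bar>x \<bullet> b\<bar>" "norm x" 2] by simp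
        then show "0 \<le> 1 + (x \<bullet> b)\<^sup>2 \<and> 1 + (x \<bullet> b)\<^sup>2 \<le> (japanese x)\<^sup>2"
          by (simp add: japanese_def)
      qed
      also have "\<dots> = japanese x ^ (2 * DIM('a))" by (simp add: power_mult)
      finally have "inverse (japanese x ^ (2 * DIM('a))) \<le> inverse (\<Prod>b\<in>(Basis::'a set). 1 + (x \<bullet> b)\<^sup>2)"
        by (intro le_imp_inverse_le prod_pos) (auto intro: add_pos_nonneg)
      also have "\<dots> = (\<Prod>b\<in>(Basis::'a set). inverse (1 + (x \<bullet> b)\<^sup>2))"
        by (simp add: prod_inversef[symmetric] o_def)
      finally show ?thesis by (simp add: inverse_eq_divide abs_prod)
    qed
    then show "AE x::'a in lborel. norm (1 / japanese x ^ (2 * DIM('a))) \<le> norm (\<Prod>b\<in>Basis. inverse (1 + (x \<bullet> b)\<^sup>2))"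
      by (intro AE_I2) blast
  qed simp
qed

lemma integrable_decay:
  fixes f :: "'a::euclidean_space \<Rightarrow> 'b::{banach, second_countable_topology}"
  assumes "f \<in> borel_measurable borel" "\<And>x. japanese x ^ (2 * DIM('a)) * norm (f x) \<le> C"
  shows "integrable lborel f"
proof (rule Bochner_Integration.integrable_bound)
  show "integrable lborel (\<lambda>x::'a. C * (1 / japanese x ^ (2 * DIM('a))))"
    by (intro integrable_mult_right integrable_japanese)
  have "norm (f x) \<le> norm (C * (1 / japanese x ^ (2 * DIM('a))))" for x
  proof -
    have "norm (f x) \<le> C * (1 / japanese x ^ (2 * DIM('a)))"
      using assms(2)[of x] by (simp add: field_simps)
    then show ?thesis using abs_ge_self order_trans unfolding real_norm_def by blast
  qed
  then show "AE x in lborel. norm (f x) \<le> norm (C * (1 / japanese x ^ (2 * DIM('a))))" by simp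
qed (use assms in auto)

lemma schwartz_measurable: "f \<in> schwartz \<Longrightarrow> f \<in> borel_measurable borel"
  by (simp add: schwartz_smooth smooth_fun_measurable)

lemma integrable_mult_schwartz:
  fixes g :: "'a::euclidean_space \<Rightarrow> complex"
  assumes "g \<in> borel_measurable borel" "\<And>x. cmod (g x) \<le> A * japanese x ^ N" "f \<in> schwartz"
  shows "integrable lborel (\<lambda>x. g x * f x)"
proof -
  obtain C where C: "0 \<le> C" "\<And>x. japanese x ^ (2 * DIM('a) + N) * cmod (f x) \<le> C"
    using schwartz_bound_cmod[OF assms(3)] by metis
  show ?thesis
  proof (rule integrable_decay)
    show "(\<lambda>x. g x * f x) \<in> borel_measurable borel"
      using assms(1) schwartz_measurable[OF assms(3)] by simp
    fix x
    have "cmod (g x) \<le> \<bar>A\<bar> * japanese x ^ N"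
      by (rule order_trans[OF assms(2) mult_right_mono]) auto
    then have "japanese x ^ (2 * DIM('a)) * norm (g x * f x) \<le>
        japanese x ^ (2 * DIM('a)) * (\<bar>A\<bar> * japanese x ^ N * cmod (f x))"
      by (intro mult_left_mono) (auto simp: norm_mult intro!: mult_right_mono)
    also have "\<dots> = \<bar>A\<bar> * (japanese x ^ (2 * DIM('a) + N) * cmod (f x))"
      by (simp add: power_add)
    also have "\<dots> \<le> \<bar>A\<bar> * C" by (intro mult_left_mono C) auto
    finally show "japanese x ^ (2 * DIM('a)) * norm (g x * f x) \<le> \<bar>A\<bar> * C" .
  qed
qed

lemma integrable_schwartz: "f \<in> schwartz \<Longrightarrow> integrable lborel f"
  using integrable_mult_schwartz[of "\<lambda>x. 1" 1 0 f] by simp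

lemma integrable_weight_schwartz:
  fixes f :: "'a::euclidean_space \<Rightarrow> complex"
  assumes "f \<in> schwartz" shows "integrable lborel (\<lambda>x. japanese x ^ N * cmod (f x))"
proof -
  have "integrable lborel (\<lambda>x. norm (of_real (japanese x ^ N) * f x))"
    by (intro integrable_norm integrable_mult_schwartz[where A = 1 and N = N] assms) (auto simp: norm_power)
  then show ?thesis by (simp add: norm_mult norm_power)
qed

section \<open>Changes of variables and vanishing integrals\<close>

lemma integral_lborel_affine:
  fixes f :: "'a::euclidean_space \<Rightarrow> 'b::{banach, second_countable_topology}"
  assumes f: "f \<in> borel_measurable borel" and c: "c \<noteq> 0"
  shows "integral\<^sup>L lborel f = \<bar>c\<bar> ^ DIM('a) *\<^sub>R (\<integral>x. f (t + c *\<^sub>R x) \<partial>lborel)"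
proof -
  have "integral\<^sup>L lborel f = integral\<^sup>L (density (distr lborel borel (\<lambda>x. t + c *\<^sub>R x)) (\<lambda>_. ennreal (\<bar>c\<bar> ^ DIM('a)))) f"
    using lborel_affine[OF c, of t] by (simp flip: ennreal_power)
  also have "\<dots> = integral\<^sup>L (distr lborel borel (\<lambda>x. t + c *\<^sub>R x)) (\<lambda>x. \<bar>c\<bar> ^ DIM('a) *\<^sub>R f x)"
    using f by (subst integral_density) auto
  also have "\<dots> = (\<integral>x. \<bar>c\<bar> ^ DIM('a) *\<^sub>R f (t + c *\<^sub>R x) \<partial>lborel)"
    using f by (subst integral_distr) auto
  finally show ?thesis by simp
qed

lemma integral_lborel_translate:
  fixes f :: "'a::euclidean_space \<Rightarrow> 'b::{banach, second_countable_topology}"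
  shows "f \<in> borel_measurable borel \<Longrightarrow> (\<integral>x. f (x + t) \<partial>lborel) = integral\<^sup>L lborel f"
  using integral_lborel_affine[of f 1 t] by (simp add: add.commute)

lemma integral_lborel_reflect:
  fixes f :: "'a::euclidean_space \<Rightarrow> 'b::{banach, second_countable_topology}"
  shows "f \<in> borel_measurable borel \<Longrightarrow> (\<integral>x. f (- x) \<partial>lborel) = integral\<^sup>L lborel f"
  using integral_lborel_affine[of f "-1" 0] by simp

text \<open>The set where \<open>f\<close> does not vanish is open and null, and a nonempty open set
  is not null.\<close>

lemma integral_zero_imp_zero:
  fixes f :: "'a::euclidean_space \<Rightarrow> real"
  assumes "continuous_on UNIV f" "\<And>x. 0 \<le> f x" "integrable lborel f" "integral\<^sup>L lborel f = 0"
  shows "f x = 0"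
proof (rule ccontr)
  assume "f x \<noteq> 0"
  let ?U = "{x. f x \<noteq> 0}"
  have "open ?U" using assms(1) by (intro open_Collect_neq) auto
  moreover have "negligible ?U"
  proof -
    have "AE x in lborel. f x = 0" using integral_nonneg_eq_0_iff_AE[OF assms(3)] assms(2,4) by simp
    moreover have "?U \<in> sets lborel" using borel_open[OF \<open>open ?U\<close>] by simp
    ultimately have "?U \<in> null_sets lborel"
      by (subst (asm) AE_iff_null) (auto simp: space_lborel)
    then show ?thesis by (simp add: negligible_iff_null_sets null_sets_completionI)
  qed
  ultimately show False using open_not_negligible \<open>f x \<noteq> 0\<close> by blast
qed

text \<open>Supplies the integrable majorant for the limit in
  \<open>integral_dir_deriv_schwartz\<close>. The mean value inequality reaches an intermediate
  point x + s b, and Peetre's inequality carries the weight back to x; as t is at most 1, the cost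
  is a power of the weight of \<open>b\<close>.\<close>

lemma schwartz_difference_quotient_bound:
  assumes f: "f \<in> schwartz" and b: "b \<in> Basis"
  obtains C where "\<And>x t. 0 < t \<Longrightarrow> t \<le> 1 \<Longrightarrow>
     japanese x ^ M * cmod (of_real (1 / t) * (f (x + t *\<^sub>R b) - f x)) \<le> C"
proof -
  obtain A where A: "0 \<le> A" "\<And>x. japanese x ^ M * cmod (dir_deriv b f x) \<le> A"
    using schwartz_bound_cmod[OF schwartz_dir_deriv[OF f b]] by metis
  have "japanese x ^ M * cmod (of_real (1 / t) * (f (x + t *\<^sub>R b) - f x)) \<le> 2 ^ M * japanese b ^ M * A"
    if t: "0 < t" "t \<le> 1" for x t
  proof -
    let ?B = "2 ^ M * japanese b ^ M * A / japanese x ^ M"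
    have "norm (f (x + t *\<^sub>R b) - f (x + 0 *\<^sub>R b)) \<le> ?B * norm (t - 0)"
    proof (rule differentiable_bound[of "{0..t}" "\<lambda>s. f (x + s *\<^sub>R b)" "\<lambda>s h. h *\<^sub>R dir_deriv b f (x + s *\<^sub>R b)"])
      fix s assume s: "s \<in> {0..t}"
      have d: "f differentiable at (x + s *\<^sub>R b)"
        by (rule smooth_fun_differentiable[OF schwartz_smooth[OF f]])
      have "((\<lambda>s. x + s *\<^sub>R b) has_derivative (\<lambda>h. h *\<^sub>R b)) (at s)"
        by (auto intro!: derivative_eq_intros)
      from diff_chain_at[OF this smooth_fun_has_derivative[OF schwartz_smooth[OF f]]]
      have "((\<lambda>s. f (x + s *\<^sub>R b)) has_derivative (\<lambda>h. h *\<^sub>R dir_deriv b f (x + s *\<^sub>R b))) (at s)"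
        by (simp add: o_def linear_cmul[OF linear_dir_deriv[OF d]])
      then show "((\<lambda>s. f (x + s *\<^sub>R b)) has_derivative (\<lambda>h. h *\<^sub>R dir_deriv b f (x + s *\<^sub>R b))) (at s within {0..t})"
        by (rule has_derivative_at_withinI)
      have "norm (s *\<^sub>R b) \<le> norm b" using s t by (auto simp: mult_left_le_one_le)
      then have "japanese (s *\<^sub>R b) ^ M \<le> japanese b ^ M"
        by (intro power_mono japanese_mono) auto
      then have "japanese x ^ M \<le> 2 ^ M * japanese (x + s *\<^sub>R b) ^ M * japanese b ^ M"
        using order_trans[OF japanese_power_Peetre[of x M "x + s *\<^sub>R b"] mult_left_mono] by simp
      then have "japanese x ^ M * cmod (dir_deriv b f (x + s *\<^sub>R b)) \<le>
          2 ^ M * japanese (x + s *\<^sub>R b) ^ M * japanese b ^ M * cmod (dir_deriv b f (x + s *\<^sub>R b))"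
        by (rule mult_right_mono) simp
      also have "\<dots> = 2 ^ M * japanese b ^ M * (japanese (x + s *\<^sub>R b) ^ M * cmod (dir_deriv b f (x + s *\<^sub>R b)))"
        by (simp add: mult_ac)
      also have "\<dots> \<le> 2 ^ M * japanese b ^ M * A" by (intro mult_left_mono A) auto
      finally have "cmod (dir_deriv b f (x + s *\<^sub>R b)) \<le> ?B"
        by (simp add: pos_le_divide_eq mult.commute)
      then show "onorm (\<lambda>h. h *\<^sub>R dir_deriv b f (x + s *\<^sub>R b)) \<le> ?B"
        by (simp add: onorm_scaleR_left[OF bounded_linear_ident] onorm_id)
    qed (use t in auto)
    then have "cmod (of_real (1 / t) * (f (x + t *\<^sub>R b) - f x)) \<le> ?B"
      using t by (simp add: norm_mult norm_divide divide_le_eq mult.commute)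
    then show ?thesis by (simp add: pos_le_divide_eq mult.commute)
  qed
  then show ?thesis using that by blast
qed

text \<open>By translation invariance, the difference quotients of a Schwartz function have integral zero.\<close>

lemma integral_dir_deriv_schwartz:
  fixes f :: "'a::euclidean_space \<Rightarrow> complex"
  assumes f: "f \<in> schwartz" and b: "b \<in> Basis"
  shows "(\<integral>x. dir_deriv b f x \<partial>lborel) = 0"
proof -
  obtain C where C: "\<And>x t. 0 < t \<Longrightarrow> t \<le> 1 \<Longrightarrow>
      japanese x ^ (2 * DIM('a)) * cmod (of_real (1 / t) * (f (x + t *\<^sub>R b) - f x)) \<le> C"
    using schwartz_difference_quotient_bound[OF f b] by blast
  let ?t = "\<lambda>n. inverse (real (Suc n))"
  let ?q = "\<lambda>n x. of_real (1 / ?t n) * (f (x + ?t n *\<^sub>R b) - f x)"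
  have meas: "(\<lambda>x. f (x + a)) \<in> borel_measurable borel" for a
    using schwartz_measurable[OF schwartz_translate[OF f, of "- a"]] by (simp add: translate_def)
  note meas0 = schwartz_measurable[OF f]
  have t01: "0 < ?t n" "?t n \<le> 1" for n by (auto simp: field_simps)
  have "(\<lambda>n. \<integral>x. ?q n x \<partial>lborel) \<longlonglongrightarrow> (\<integral>x. dir_deriv b f x \<partial>lborel)"
  proof (rule integral_dominated_convergence)
    show "integrable lborel (\<lambda>x::'a. C * (1 / japanese x ^ (2 * DIM('a))))"
      by (intro integrable_mult_right integrable_japanese)
    show "AE x in lborel. norm (?q n x) \<le> C * (1 / japanese x ^ (2 * DIM('a)))" for n
    proof (rule AE_I2)
      fix x
      have "japanese x ^ (2 * DIM('a)) * cmod (?q n x) \<le> C" using C[OF t01] .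
      then show "norm (?q n x) \<le> C * (1 / japanese x ^ (2 * DIM('a)))"
        by (simp add: pos_le_divide_eq mult.commute)
    qed
    show "AE x in lborel. (\<lambda>n. ?q n x) \<longlonglongrightarrow> dir_deriv b f x"
    proof (rule AE_I2)
      fix x
      have d: "f differentiable at x"
        by (rule smooth_fun_differentiable[OF schwartz_smooth[OF f]])
      have "((\<lambda>s. x + s *\<^sub>R b) has_derivative (\<lambda>h. h *\<^sub>R b)) (at 0)"
        by (auto intro!: derivative_eq_intros)
      moreover have "(f has_derivative (\<lambda>h. dir_deriv h f x)) (at (x + 0 *\<^sub>R b))"
        using smooth_fun_has_derivative[OF schwartz_smooth[OF f]] by simp
      ultimately have "((\<lambda>s. f (x + s *\<^sub>R b)) has_vector_derivative dir_deriv b f x) (at 0)"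
        using diff_chain_at by (fastforce simp: has_vector_derivative_def o_def linear_cmul[OF linear_dir_deriv[OF d]])
      then have lim: "(\<lambda>h. norm (f (x + h *\<^sub>R b) - f x - h *\<^sub>R dir_deriv b f x) / norm h) \<midarrow>0\<rightarrow> 0"
        unfolding has_vector_derivative_def has_derivative_at by simp
      have "(\<lambda>h. norm (of_real (1 / h) * (f (x + h *\<^sub>R b) - f x) - dir_deriv b f x)) \<midarrow>0\<rightarrow> 0"
      proof (rule Lim_transform_eventually[OF lim])
        show "\<forall>\<^sub>F h in at 0. norm (f (x + h *\<^sub>R b) - f x - h *\<^sub>R dir_deriv b f x) / norm h =
            norm (of_real (1 / h) * (f (x + h *\<^sub>R b) - f x) - dir_deriv b f x)"
          unfolding eventually_at_filter
        proof (intro always_eventually allI impI)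
          fix h :: real assume h: "h \<noteq> 0"
          then have "of_real (1 / h) * (f (x + h *\<^sub>R b) - f x) - dir_deriv b f x =
              of_real (1 / h) * (f (x + h *\<^sub>R b) - f x - h *\<^sub>R dir_deriv b f x)"
            by (simp add: scaleR_conv_of_real right_diff_distrib)
          then show "norm (f (x + h *\<^sub>R b) - f x - h *\<^sub>R dir_deriv b f x) / norm h =
              norm (of_real (1 / h) * (f (x + h *\<^sub>R b) - f x) - dir_deriv b f x)"
            by (simp add: norm_mult norm_divide)
        qed
      qed
      then have "(\<lambda>h. of_real (1 / h) * (f (x + h *\<^sub>R b) - f x)) \<midarrow>0\<rightarrow> dir_deriv b f x"
        by (simp add: tendsto_norm_zero_iff LIM_zero_iff)
      moreover have "filterlim ?t (at 0) sequentially"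
        using LIMSEQ_inverse_real_of_nat t01(1) unfolding filterlim_at
        by (auto intro!: always_eventually simp: less_imp_neq)
      ultimately show "(\<lambda>n. ?q n x) \<longlonglongrightarrow> dir_deriv b f x"
        by (rule filterlim_compose)
    qed
  qed (use meas meas0 schwartz_measurable[OF schwartz_dir_deriv[OF f b]] in auto)
  moreover have "(\<integral>x. ?q n x \<partial>lborel) = 0" for n
  proof -
    have "integrable lborel (\<lambda>x. f (x + ?t n *\<^sub>R b))"
      using integrable_schwartz[OF schwartz_translate[OF f, of "- ?t n *\<^sub>R b"]] by (simp add: translate_def)
    then show ?thesis
      using integral_lborel_translate[OF meas0] integrable_schwartz[OF f] by simp
  qed
  ultimately show ?thesis by (simp only: LIMSEQ_const_iff)
qed

section \<open>The Fourier transform on the Schwartz space\<close>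

lemma integrable_cis_mult:
  fixes f :: "'a::euclidean_space \<Rightarrow> complex"
  assumes "integrable lborel f" shows "integrable lborel (\<lambda>\<xi>. f \<xi> * cis (x \<bullet> \<xi>))"
  by (rule Bochner_Integration.integrable_bound[OF assms])
     (use borel_measurable_integrable[OF assms] in \<open>auto simp: norm_mult cis_conv_exp\<close>)

lemma integral_norm_le:
  fixes f :: "'a::euclidean_space \<Rightarrow> complex"
  assumes "integrable lborel g" "\<And>x. cmod (f x) \<le> g x"
  shows "cmod (integral\<^sup>L lborel f) \<le> integral\<^sup>L lborel g"
proof (cases "integrable lborel f")
  case True
  have "cmod (integral\<^sup>L lborel f) \<le> (\<integral>x. norm (f x) \<partial>lborel)" by (rule integral_norm_bound)
  also have "\<dots> \<le> integral\<^sup>L lborel g" using True assms by (intro integral_mono) auto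
  finally show ?thesis .
next
  \<comment> \<open>A nonintegrable function has Bochner integral 0, and \<open>g\<close> is
    nonnegative.\<close>
  case False
  have "0 \<le> g x" for x using assms(2)[of x] norm_ge_zero order_trans by blast
  then show ?thesis using False by (simp add: not_integrable_integral_eq)
qed

lemma fourier_adjoint_bound:
  "integrable lborel f \<Longrightarrow> cmod (fourier_adjoint f x) \<le> (\<integral>\<xi>. cmod (f \<xi>) \<partial>lborel)"
  unfolding fourier_adjoint_def by (rule integral_norm_le) (auto simp: norm_mult)

lemma cis_approx: "cmod (cis t - 1 - \<i> * of_real t) \<le> t\<^sup>2"
proof -
  have "cmod (iexp t - (\<Sum>k\<le>1. (\<i> * t)^k / fact k)) \<le> \<bar>t\<bar> ^ Suc 1 / fact (Suc 1)"
    by (rule iexp_approx1)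
  then have "cmod (cis t - 1 - \<i> * of_real t) \<le> t\<^sup>2 / 2"
    by (simp add: cis_conv_exp algebra_simps power2_eq_square numeral_2_eq_2 abs_mult_self_eq)
  then show ?thesis using norm_ge_zero[of "cis t - 1 - \<i> * of_real t"] by linarith
qed

lemma cis_approx0: "cmod (cis t - 1) \<le> \<bar>t\<bar>"
proof -
  have "cmod (iexp t - (\<Sum>k\<le>0. (\<i> * t)^k / fact k)) \<le> \<bar>t\<bar> ^ Suc 0 / fact (Suc 0)"
    by (rule iexp_approx1)
  then show ?thesis by (simp add: cis_conv_exp)
qed

text \<open>Differentiation under an integral, and later under a distribution, is done by a
  quadratic remainder estimate instead of a limit theorem.\<close>

lemma has_derivative_quadratic_remainder:
  fixes f :: "'a::euclidean_space \<Rightarrow> complex"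
  assumes L: "bounded_linear L" and C: "\<And>h. norm h \<le> 1 \<Longrightarrow> cmod (f (x + h) - f x - L h) \<le> C * (norm h)\<^sup>2"
  shows "(f has_derivative L) (at x)"
  unfolding has_derivative_at
proof (intro conjI L)
  show "(\<lambda>h. norm (f (x + h) - f x - L h) / norm h) \<midarrow>0\<rightarrow> 0"
  proof (rule Lim_null_comparison)
    show "\<forall>\<^sub>F h in at 0. norm (norm (f (x + h) - f x - L h) / norm h) \<le> C * norm h"
      unfolding eventually_at
    proof (intro exI[of _ 1] conjI ballI impI)
      fix h :: 'a assume h: "h \<noteq> 0 \<and> dist h 0 < 1"
      then have "norm (f (x + h) - f x - L h) \<le> C * norm h * norm h"
        using C[of h] by (simp add: power2_eq_square)
      then show "norm (norm (f (x + h) - f x - L h) / norm h) \<le> C * norm h"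
        using h by (simp add: divide_le_eq)
    qed simp
    show "(\<lambda>h. C * norm h) \<midarrow>0\<rightarrow> 0" by (auto intro!: tendsto_eq_intros)
  qed
qed

lemma slow_fun_inner: "slow_fun (\<lambda>\<xi>. complex_of_real (h \<bullet> \<xi>))"
  by (intro slow_fun_bounded_linear bounded_linear_compose[OF bounded_linear_of_real] bounded_linear_inner_right)

lemma schwartz_inner_mult: "\<phi> \<in> schwartz \<Longrightarrow> (\<lambda>\<xi>. \<i> * of_real (h \<bullet> \<xi>) * \<phi> \<xi>) \<in> schwartz"
  using schwartz_cmult[OF schwartz_mult[OF slow_fun_inner], of \<phi> \<i> h] by (simp add: mult.assoc)

text \<open>The remainder of the exponential is at most |h|^2 times the squared weight of \<xi>, and
  that weight is absorbed by \<open>\<phi>\<close>.\<close>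

lemma fourier_adjoint_has_derivative:
  fixes \<phi> :: "'a::euclidean_space \<Rightarrow> complex"
  assumes \<phi>: "\<phi> \<in> schwartz"
  shows "(fourier_adjoint \<phi> has_derivative (\<lambda>h. fourier_adjoint (\<lambda>\<xi>. \<i> * of_real (h \<bullet> \<xi>) * \<phi> \<xi>) x)) (at x)"
proof (rule has_derivative_quadratic_remainder)
  let ?L = "\<lambda>h. fourier_adjoint (\<lambda>\<xi>. \<i> * of_real (h \<bullet> \<xi>) * \<phi> \<xi>) x"
  have int: "integrable lborel (\<lambda>\<xi>. \<i> * of_real (h \<bullet> \<xi>) * \<phi> \<xi> * cis (x \<bullet> \<xi>))" for h
    by (intro integrable_cis_mult integrable_schwartz schwartz_inner_mult \<phi>)
  have "linear ?L"
  proof (rule linearI)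
    show "?L (h + k) = ?L h + ?L k" for h k
      unfolding fourier_adjoint_def Bochner_Integration.integral_add[OF int int, symmetric]
      by (simp add: algebra_simps)
    show "?L (r *\<^sub>R h) = r *\<^sub>R ?L h" for r h
      unfolding fourier_adjoint_def integral_scaleR_right[symmetric]
      by (simp add: scaleR_conv_of_real mult_ac)
  qed
  then show "bounded_linear ?L" by (simp add: linear_conv_bounded_linear)
  fix h :: 'a
  have i0: "integrable lborel (\<lambda>\<xi>. \<phi> \<xi> * cis (y \<bullet> \<xi>))" for y
    by (intro integrable_cis_mult integrable_schwartz \<phi>)
  have "fourier_adjoint \<phi> (x + h) - fourier_adjoint \<phi> x - ?L h =
      (\<integral>\<xi>. \<phi> \<xi> * cis ((x + h) \<bullet> \<xi>) - \<phi> \<xi> * cis (x \<bullet> \<xi>) - \<i> * of_real (h \<bullet> \<xi>) * \<phi> \<xi> * cis (x \<bullet> \<xi>) \<partial>lborel)"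
    unfolding fourier_adjoint_def using i0 int by simp
  also have "cmod \<dots> \<le> (\<integral>\<xi>. (norm h)\<^sup>2 * (japanese \<xi> ^ 2 * cmod (\<phi> \<xi>)) \<partial>lborel)"
  proof (rule integral_norm_le)
    show "integrable lborel (\<lambda>\<xi>. (norm h)\<^sup>2 * (japanese \<xi> ^ 2 * cmod (\<phi> \<xi>)))"
      by (intro integrable_mult_right integrable_weight_schwartz \<phi>)
    fix \<xi> :: 'a
    have "\<phi> \<xi> * cis ((x + h) \<bullet> \<xi>) - \<phi> \<xi> * cis (x \<bullet> \<xi>) - \<i> * of_real (h \<bullet> \<xi>) * \<phi> \<xi> * cis (x \<bullet> \<xi>) =
        \<phi> \<xi> * cis (x \<bullet> \<xi>) * (cis (h \<bullet> \<xi>) - 1 - \<i> * of_real (h \<bullet> \<xi>))"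
      by (simp add: inner_add_left algebra_simps flip: cis_mult)
    then have "cmod (\<phi> \<xi> * cis ((x + h) \<bullet> \<xi>) - \<phi> \<xi> * cis (x \<bullet> \<xi>) - \<i> * of_real (h \<bullet> \<xi>) * \<phi> \<xi> * cis (x \<bullet> \<xi>))
        = cmod (\<phi> \<xi>) * cmod (cis (h \<bullet> \<xi>) - 1 - \<i> * of_real (h \<bullet> \<xi>))"
      by (simp add: norm_mult)
    also have "\<dots> \<le> cmod (\<phi> \<xi>) * (h \<bullet> \<xi>)\<^sup>2" by (intro mult_left_mono cis_approx) auto
    also have "\<dots> \<le> cmod (\<phi> \<xi>) * (norm h * japanese \<xi>)\<^sup>2"
    proof (rule mult_left_mono)
      have "\<bar>h \<bullet> \<xi>\<bar> \<le> norm h * norm \<xi>" by (rule Cauchy_Schwarz_ineq2)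
      also have "\<dots> \<le> norm h * japanese \<xi>" by (intro mult_left_mono norm_le_japanese) auto
      finally show "(h \<bullet> \<xi>)\<^sup>2 \<le> (norm h * japanese \<xi>)\<^sup>2"
        using abs_le_square_iff[of "h \<bullet> \<xi>" "norm h * japanese \<xi>"] by simp
    qed simp
    finally show "cmod (\<phi> \<xi> * cis ((x + h) \<bullet> \<xi>) - \<phi> \<xi> * cis (x \<bullet> \<xi>) - \<i> * of_real (h \<bullet> \<xi>) * \<phi> \<xi> * cis (x \<bullet> \<xi>))
        \<le> (norm h)\<^sup>2 * (japanese \<xi> ^ 2 * cmod (\<phi> \<xi>))"
      by (simp add: power_mult_distrib mult_ac)
  qed
  finally show "cmod (fourier_adjoint \<phi> (x + h) - fourier_adjoint \<phi> x - ?L h) \<le>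
      (\<integral>\<xi>. japanese \<xi> ^ 2 * cmod (\<phi> \<xi>) \<partial>lborel) * (norm h)\<^sup>2"
    by (simp add: mult.commute)
qed

lemma dir_deriv_fourier_adjoint: "\<phi> \<in> schwartz \<Longrightarrow>
    dir_deriv b (fourier_adjoint \<phi>) = fourier_adjoint (\<lambda>\<xi>. \<i> * of_real (b \<bullet> \<xi>) * \<phi> \<xi>)"
  using dir_deriv_eq[OF fourier_adjoint_has_derivative] by blast

lemma schwartz_prod_mult:
  "\<phi> \<in> schwartz \<Longrightarrow> (\<lambda>\<xi>. (\<Prod>b\<leftarrow>bs. \<i> * complex_of_real (b \<bullet> \<xi>)) * \<phi> \<xi>) \<in> schwartz"
  by (induction bs) (simp_all add: schwartz_inner_mult mult.assoc[of _ "prod_list _"])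

lemma iter_deriv_fourier_adjoint: "\<phi> \<in> schwartz \<Longrightarrow>
    iter_deriv bs (fourier_adjoint \<phi>) = fourier_adjoint (\<lambda>\<xi>. (\<Prod>b\<leftarrow>bs. \<i> * complex_of_real (b \<bullet> \<xi>)) * \<phi> \<xi>)"
  by (induction bs) (simp_all add: dir_deriv_fourier_adjoint schwartz_prod_mult mult.assoc)

lemma smooth_fourier_adjoint: "\<phi> \<in> schwartz \<Longrightarrow> smooth_fun (fourier_adjoint \<phi>)"
  unfolding smooth_fun_def iter_deriv_fourier_adjoint
  using fourier_adjoint_has_derivative[OF schwartz_prod_mult] by (auto simp: differentiable_def)

text \<open>Integration by parts: the derivative of the Schwartz function
  \<open>\<phi> \<xi> * cis (x \<bullet> \<xi>)\<close> has integral zero.\<close>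

lemma fourier_adjoint_dir_deriv:
  assumes \<phi>: "\<phi> \<in> schwartz" and b: "b \<in> Basis"
  shows "of_real (x \<bullet> b) * fourier_adjoint \<phi> x = \<i> * fourier_adjoint (dir_deriv b \<phi>) x"
proof -
  let ?g = "\<lambda>\<xi>. \<phi> \<xi> * cis (x \<bullet> \<xi>)"
  have g: "?g \<in> schwartz"
    using schwartz_mult[OF slow_fun_cis \<phi>, of x] by (simp add: mult.commute inner_commute)
  have i1: "integrable lborel (\<lambda>\<xi>. dir_deriv b \<phi> \<xi> * cis (x \<bullet> \<xi>))"
    by (intro integrable_cis_mult integrable_schwartz schwartz_dir_deriv assms)
  have i2: "integrable lborel (\<lambda>\<xi>. \<phi> \<xi> * cis (x \<bullet> \<xi>))"
    by (intro integrable_cis_mult integrable_schwartz assms)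
  have "dir_deriv b ?g = (\<lambda>\<xi>. dir_deriv b \<phi> \<xi> * cis (x \<bullet> \<xi>) + \<i> * of_real (x \<bullet> b) * (\<phi> \<xi> * cis (x \<bullet> \<xi>)))"
  proof -
    have "dir_deriv b (\<lambda>\<xi>. cis (x \<bullet> \<xi>)) = (\<lambda>\<xi>. \<i> * of_real (x \<bullet> b) * cis (x \<bullet> \<xi>))"
      using dir_deriv_eq[OF has_derivative_cis_inner, of b x] by (auto simp: inner_commute)
    moreover have "smooth_fun (\<lambda>\<xi>. cis (x \<bullet> \<xi>))" using smooth_fun_cis[of x] by (simp add: inner_commute)
    ultimately show ?thesis
      using dir_deriv_mult[OF schwartz_smooth[OF \<phi>], of "\<lambda>\<xi>. cis (x \<bullet> \<xi>)" b] by (auto simp only: mult_ac)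
  qed
  then have "0 = fourier_adjoint (dir_deriv b \<phi>) x + \<i> * of_real (x \<bullet> b) * fourier_adjoint \<phi> x"
    using integral_dir_deriv_schwartz[OF g b] i1 i2 by (simp add: fourier_adjoint_def)
  then have "fourier_adjoint (dir_deriv b \<phi>) x = - (\<i> * of_real (x \<bullet> b) * fourier_adjoint \<phi> x)"
    by (simp add: eq_neg_iff_add_eq_0)
  then show ?thesis by (simp add: mult.assoc[symmetric])
qed

text \<open>A weight in x is at most 1 plus the sum of the moduli of the coordinates, and each
  coordinate factor is traded for a derivative of \<open>\<phi>\<close>; hence \<open>\<phi>\<close>
  is arbitrary in the induction.\<close>

lemma fourier_adjoint_decay:
  "\<phi> \<in> schwartz \<Longrightarrow> \<exists>C. \<forall>x. japanese x ^ M * cmod (fourier_adjoint \<phi> x) \<le> C"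
proof (induction M arbitrary: \<phi>)
  case 0
  then show ?case using fourier_adjoint_bound[OF integrable_schwartz] by auto
next
  case (Suc M)
  obtain A where A: "\<And>x. japanese x ^ M * cmod (fourier_adjoint \<phi> x) \<le> A"
    using Suc by blast
  have "\<forall>b\<in>Basis. \<exists>C. \<forall>x. japanese x ^ M * cmod (fourier_adjoint (dir_deriv b \<phi>) x) \<le> C"
    using Suc schwartz_dir_deriv by blast
  then obtain B where B: "\<And>b x. b \<in> Basis \<Longrightarrow> japanese x ^ M * cmod (fourier_adjoint (dir_deriv b \<phi>) x) \<le> B b"
    by metis
  have "japanese x ^ Suc M * cmod (fourier_adjoint \<phi> x) \<le> A + (\<Sum>b\<in>Basis. B b)" for x
  proof -
    have "japanese x \<le> 1 + (\<Sum>b\<in>Basis. \<bar>x \<bullet> b\<bar>)"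
      using japanese_le[of x] norm_le_l1[of x] by linarith
    then have "japanese x * (japanese x ^ M * cmod (fourier_adjoint \<phi> x)) \<le>
        (1 + (\<Sum>b\<in>Basis. \<bar>x \<bullet> b\<bar>)) * (japanese x ^ M * cmod (fourier_adjoint \<phi> x))"
      by (rule mult_right_mono) auto
    also have "\<dots> = japanese x ^ M * cmod (fourier_adjoint \<phi> x) +
        (\<Sum>b\<in>Basis. japanese x ^ M * cmod (of_real (x \<bullet> b) * fourier_adjoint \<phi> x))"
      unfolding distrib_right sum_distrib_right by (simp add: norm_mult mult_ac)
    also have "\<dots> = japanese x ^ M * cmod (fourier_adjoint \<phi> x) +
        (\<Sum>b\<in>Basis. japanese x ^ M * cmod (fourier_adjoint (dir_deriv b \<phi>) x))"
      by (simp add: fourier_adjoint_dir_deriv[OF Suc.prems] norm_mult)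
    also have "\<dots> \<le> A + (\<Sum>b\<in>Basis. B b)"
      by (intro add_mono sum_mono A B)
    finally show ?thesis by (simp add: mult.assoc)
  qed
  then show ?case by blast
qed

lemma schwartz_fourier_adjoint:
  assumes "\<phi> \<in> schwartz" shows "fourier_adjoint \<phi> \<in> schwartz"
  unfolding schwartz_def rapidly_decreasing_on_iff
  using smooth_fourier_adjoint[OF assms] fourier_adjoint_decay[OF schwartz_prod_mult[OF assms]]
  by (simp add: iter_deriv_fourier_adjoint[OF assms])

section \<open>Fourier inversion\<close>

lemma fourier_adjoint_measurable:
  fixes f :: "'a::euclidean_space \<Rightarrow> complex"
  assumes [measurable]: "f \<in> borel_measurable borel"
  shows "fourier_adjoint f \<in> borel_measurable borel"
  unfolding fourier_adjoint_def cis_conv_exp by measurable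

text \<open>Fubini, together with the symmetry of the kernel in x and \<xi>.\<close>

lemma integral_fourier_adjoint_mult:
  fixes f g :: "'a::euclidean_space \<Rightarrow> complex"
  assumes f: "integrable lborel f" and g: "integrable lborel g"
  shows "(\<integral>x. fourier_adjoint f x * g x \<partial>lborel) = (\<integral>x. f x * fourier_adjoint g x \<partial>lborel)"
proof -
  have [measurable]: "f \<in> borel_measurable borel" "g \<in> borel_measurable borel"
    using f g by (auto dest: borel_measurable_integrable)
  have int: "integrable (lborel \<Otimes>\<^sub>M lborel) (\<lambda>(x, \<xi>). g x * (f \<xi> * cis (x \<bullet> \<xi>)))"
  proof (rule lborel_pair.Fubini_integrable)
    show "(\<lambda>(x, \<xi>). g x * (f \<xi> * cis (x \<bullet> \<xi>))) \<in> borel_measurable (lborel \<Otimes>\<^sub>M lborel)"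
      unfolding cis_conv_exp by measurable
    show "integrable lborel (\<lambda>x. \<integral>y. norm (case (x, y) of (x, \<xi>) \<Rightarrow> g x * (f \<xi> * cis (x \<bullet> \<xi>))) \<partial>lborel)"
      using integrable_norm[OF g] by (simp add: norm_mult)
    show "AE x in lborel. integrable lborel (\<lambda>y. case (x, y) of (x, \<xi>) \<Rightarrow> g x * (f \<xi> * cis (x \<bullet> \<xi>)))"
      using integrable_cis_mult[OF f] by simp
  qed
  have "(\<integral>x. fourier_adjoint f x * g x \<partial>lborel) = (\<integral>x. (\<integral>\<xi>. g x * (f \<xi> * cis (x \<bullet> \<xi>)) \<partial>lborel) \<partial>lborel)"
    by (simp add: fourier_adjoint_def mult.commute)
  also have "\<dots> = (\<integral>\<xi>. (\<integral>x. g x * (f \<xi> * cis (x \<bullet> \<xi>)) \<partial>lborel) \<partial>lborel)"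
    using lborel_pair.Fubini_integral[OF int] by simp
  also have "\<dots> = (\<integral>\<xi>. (\<integral>x. f \<xi> * (g x * cis (\<xi> \<bullet> x)) \<partial>lborel) \<partial>lborel)"
    by (simp add: mult_ac inner_commute)
  also have "\<dots> = (\<integral>\<xi>. f \<xi> * fourier_adjoint g \<xi> \<partial>lborel)"
    by (simp add: fourier_adjoint_def)
  finally show ?thesis .
qed

lemma integrable_lborel_affine:
  fixes f :: "'a::euclidean_space \<Rightarrow> 'b::{banach, second_countable_topology}"
  assumes f: "integrable lborel f" and c: "c \<noteq> 0"
  shows "integrable lborel (\<lambda>x. f (t + c *\<^sub>R x))"
proof -
  have [measurable]: "f \<in> borel_measurable borel" using f by (auto dest: borel_measurable_integrable)
  have "integrable (density (distr lborel borel (\<lambda>x. t + c *\<^sub>R x)) (\<lambda>_. ennreal (\<bar>c\<bar> ^ DIM('a)))) f"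
    using f lborel_affine[OF c, of t] by (simp flip: ennreal_power)
  then have "integrable lborel (\<lambda>x. \<bar>c\<bar> ^ DIM('a) *\<^sub>R f (t + c *\<^sub>R x))"
    by (subst (asm) integrable_density) (auto simp: integrable_distr_eq)
  from integrable_scaleR_right[OF this, of "1 / \<bar>c\<bar> ^ DIM('a)"]
  show ?thesis using c by simp
qed

text \<open>Inversion will also be applied to \<open>G\<close> times a translate of the window's
  transform. Of \<open>G\<close> only smoothness and the growth of its values are recorded, not the
  growth of its derivatives, so that product is not known to be a Schwartz function.\<close>

definition fourier_invertible :: "('a::euclidean_space \<Rightarrow> complex) \<Rightarrow> bool" where
  "fourier_invertible f \<longleftrightarrow> continuous_on UNIV f \<and> bounded (range f) \<and>
     integrable lborel f \<and> integrable lborel (fourier_adjoint f)"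

text \<open>The dilation trick: inserting \<open>\<psi>(\<epsilon>\<xi>)\<close> into the integral of \<open>F\<^sup>*f\<close> and moving the transform
  over to \<open>\<psi>\<close> yields the integral of \<open>f(\<epsilon>z) F\<^sup>*\<psi>(z)\<close>; then \<open>\<epsilon> \<rightarrow> 0\<close>.\<close>

lemma integral_fourier_adjoint_exchange:
  fixes f \<psi> :: "'a::euclidean_space \<Rightarrow> complex"
  assumes inv: "fourier_invertible f" and \<psi>: "\<psi> \<in> schwartz"
  shows "\<psi> 0 * integral\<^sup>L lborel (fourier_adjoint f) = f 0 * integral\<^sup>L lborel (fourier_adjoint \<psi>)"
proof -
  have f: "continuous_on UNIV f" "bounded (range f)" "integrable lborel f" "integrable lborel (fourier_adjoint f)"
    using inv by (auto simp: fourier_invertible_def)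
  let ?e = "\<lambda>n. inverse (real (Suc n))"
  have e: "?e n > 0" for n by simp
  have e0: "(\<lambda>n. ?e n *\<^sub>R x) \<longlonglongrightarrow> 0" for x :: 'a
    using tendsto_scaleR[OF LIMSEQ_inverse_real_of_nat tendsto_const[of x]] by simp
  have [measurable]: "f \<in> borel_measurable borel" "\<psi> \<in> borel_measurable borel"
    using f(1) \<psi> by (auto simp: borel_measurable_continuous_onI schwartz_measurable)
  note [measurable] = fourier_adjoint_measurable[of f] fourier_adjoint_measurable[of \<psi>]
  note int\<psi> = integrable_schwartz[OF schwartz_fourier_adjoint[OF \<psi>]]
  have eq: "(\<integral>\<xi>. fourier_adjoint f \<xi> * \<psi> (\<epsilon> *\<^sub>R \<xi>) \<partial>lborel) = (\<integral>z. f (\<epsilon> *\<^sub>R z) * fourier_adjoint \<psi> z \<partial>lborel)"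
    if \<epsilon>: "\<epsilon> > 0" for \<epsilon>
  proof -
    let ?fe = "\<lambda>z. f (\<epsilon> *\<^sub>R z)"
    \<comment> \<open>Dilating the function by \<epsilon> dilates its transform by 1 / \<epsilon>;
      the Jacobian cancels the one of the substitution that follows.\<close>
    have *: "fourier_adjoint f ((1 / \<epsilon>) *\<^sub>R \<eta>) = \<epsilon> ^ DIM('a) *\<^sub>R fourier_adjoint ?fe \<eta>" for \<eta>
      unfolding fourier_adjoint_def
      by (subst integral_lborel_affine[of _ \<epsilon> 0]) (use \<epsilon> in \<open>auto simp: cis_conv_exp\<close>)
    have "(\<integral>\<xi>. fourier_adjoint f \<xi> * \<psi> (\<epsilon> *\<^sub>R \<xi>) \<partial>lborel) =
        (1 / \<epsilon>) ^ DIM('a) *\<^sub>R (\<integral>\<eta>. fourier_adjoint f ((1 / \<epsilon>) *\<^sub>R \<eta>) * \<psi> \<eta> \<partial>lborel)"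
      by (subst integral_lborel_affine[of _ "1 / \<epsilon>" 0]) (use \<epsilon> in auto)
    also have "\<dots> = (\<integral>\<eta>. fourier_adjoint ?fe \<eta> * \<psi> \<eta> \<partial>lborel)"
      unfolding * using \<epsilon> by (simp add: power_one_over)
    also have "\<dots> = (\<integral>z. f (\<epsilon> *\<^sub>R z) * fourier_adjoint \<psi> z \<partial>lborel)"
      using integrable_lborel_affine[OF f(3), of \<epsilon> 0] \<epsilon> integrable_schwartz[OF \<psi>]
      by (intro integral_fourier_adjoint_mult) auto
    finally show ?thesis .
  qed
  have "(\<lambda>n. \<integral>\<xi>. fourier_adjoint f \<xi> * \<psi> (?e n *\<^sub>R \<xi>) \<partial>lborel) \<longlonglongrightarrow> (\<integral>\<xi>. fourier_adjoint f \<xi> * \<psi> 0 \<partial>lborel)"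
  proof -
    obtain B where B: "\<And>x. japanese x ^ 0 * cmod (\<psi> x) \<le> B" using schwartz_bound_cmod[OF \<psi>] by metis
    show ?thesis
    proof (rule integral_dominated_convergence)
      show "integrable lborel (\<lambda>\<xi>. norm (fourier_adjoint f \<xi>) * B)"
        using f(4) by auto
      show "AE \<xi> in lborel. norm (fourier_adjoint f \<xi> * \<psi> (?e n *\<^sub>R \<xi>)) \<le> norm (fourier_adjoint f \<xi>) * B" for n
        using B by (auto simp: norm_mult mult_left_mono)
      show "AE \<xi> in lborel. (\<lambda>n. fourier_adjoint f \<xi> * \<psi> (?e n *\<^sub>R \<xi>)) \<longlonglongrightarrow> fourier_adjoint f \<xi> * \<psi> 0"
        using smooth_fun_isCont[OF schwartz_smooth[OF \<psi>], of 0] e0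
        by (intro AE_I2 tendsto_mult tendsto_const) (auto intro: isCont_tendsto_compose)
    qed auto
  qed
  moreover have "(\<lambda>n. \<integral>z. f (?e n *\<^sub>R z) * fourier_adjoint \<psi> z \<partial>lborel) \<longlonglongrightarrow> (\<integral>z. f 0 * fourier_adjoint \<psi> z \<partial>lborel)"
  proof -
    obtain B where B: "\<And>x. cmod (f x) \<le> B" using f(2) unfolding bounded_iff by auto
    show ?thesis
    proof (rule integral_dominated_convergence)
      show "integrable lborel (\<lambda>\<xi>. B * norm (fourier_adjoint \<psi> \<xi>))"
        using int\<psi> by auto
      show "AE \<xi> in lborel. norm (f (?e n *\<^sub>R \<xi>) * fourier_adjoint \<psi> \<xi>) \<le> B * norm (fourier_adjoint \<psi> \<xi>)" for n
        using B by (auto simp: norm_mult mult_right_mono)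
      have "isCont f 0" using f(1) continuous_on_eq_continuous_at by blast
      then show "AE \<xi> in lborel. (\<lambda>n. f (?e n *\<^sub>R \<xi>) * fourier_adjoint \<psi> \<xi>) \<longlonglongrightarrow> f 0 * fourier_adjoint \<psi> \<xi>"
        using e0 by (intro AE_I2 tendsto_mult tendsto_const) (auto intro: isCont_tendsto_compose)
    qed auto
  qed
  ultimately have "(\<integral>\<xi>. fourier_adjoint f \<xi> * \<psi> 0 \<partial>lborel) = (\<integral>z. f 0 * fourier_adjoint \<psi> z \<partial>lborel)"
    unfolding eq[OF e] by (rule LIMSEQ_unique)
  then show ?thesis by (simp add: mult.commute)
qed

lemma fourier_adjoint_translate_arg:
  fixes f :: "'a::euclidean_space \<Rightarrow> complex"
  assumes [measurable]: "f \<in> borel_measurable borel"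
  shows "fourier_adjoint (\<lambda>\<xi>. f (\<xi> + t)) x = fourier_adjoint f x * cis (- (x \<bullet> t))"
proof -
  have "fourier_adjoint f x = (\<integral>\<xi>. f (\<xi> + t) * cis (x \<bullet> (\<xi> + t)) \<partial>lborel)"
    unfolding fourier_adjoint_def
    by (rule integral_lborel_translate[symmetric]) (auto simp: cis_conv_exp)
  also have "\<dots> = (\<integral>\<xi>. f (\<xi> + t) * cis (x \<bullet> \<xi>) * cis (x \<bullet> t) \<partial>lborel)"
    by (simp add: inner_add_right cis_mult mult.assoc)
  also have "\<dots> = fourier_adjoint (\<lambda>\<xi>. f (\<xi> + t)) x * cis (x \<bullet> t)"
    by (simp add: fourier_adjoint_def)
  finally show ?thesis by (simp add: mult.assoc cis_mult)
qed

text \<open>Inversion at the origin gives inversion at \<open>t\<close>, because translating the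
  function multiplies its transform by a phase.\<close>

lemma fourier_inversion_aux:
  fixes f :: "'a::euclidean_space \<Rightarrow> complex"
  assumes c: "\<And>g :: 'a \<Rightarrow> complex. fourier_invertible g \<Longrightarrow> integral\<^sup>L lborel (fourier_adjoint g) = c * g 0"
    and inv: "fourier_invertible f"
  shows "(\<integral>x. fourier_adjoint f x * cis (- (x \<bullet> t)) \<partial>lborel) = c * f t"
proof -
  have f: "continuous_on UNIV f" "bounded (range f)" "integrable lborel f" "integrable lborel (fourier_adjoint f)"
    using inv by (auto simp: fourier_invertible_def)
  have m: "f \<in> borel_measurable borel" using f(1) by (simp add: borel_measurable_continuous_onI)
  have eq: "(\<lambda>x. fourier_adjoint f x * cis (- (x \<bullet> t))) = fourier_adjoint (\<lambda>\<xi>. f (\<xi> + t))"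
    using fourier_adjoint_translate_arg[OF m] by auto
  have "integrable lborel (\<lambda>x. fourier_adjoint f x * cis (- t \<bullet> x))"
    using integrable_cis_mult[OF f(4), of "- t"] .
  then have int: "integrable lborel (fourier_adjoint (\<lambda>\<xi>. f (\<xi> + t)))"
    using eq by (simp add: inner_commute)
  have "integral\<^sup>L lborel (fourier_adjoint (\<lambda>\<xi>. f (\<xi> + t))) = c * f (0 + t)"
  proof (rule c, unfold fourier_invertible_def, intro conjI)
    show "continuous_on UNIV (\<lambda>\<xi>. f (\<xi> + t))"
      by (rule continuous_on_compose2[OF f(1)]) (auto intro: continuous_intros)
    show "bounded (range (\<lambda>\<xi>. f (\<xi> + t)))" by (rule bounded_subset[OF f(2)]) auto
    show "integrable lborel (\<lambda>\<xi>. f (\<xi> + t))"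
      using integrable_lborel_affine[OF f(3), of 1 t] by (simp add: add.commute)
  qed (rule int)
  then show ?thesis by (simp add: eq)
qed

lemma schwartz_bounded: "f \<in> schwartz \<Longrightarrow> bounded (range f)"
  using schwartz_bound_cmod[of f 0] unfolding bounded_iff by (metis mult_1 power_0 rangeE)

lemma schwartz_continuous: "f \<in> schwartz \<Longrightarrow> continuous_on A f"
  by (simp add: schwartz_smooth smooth_fun_continuous_on)

lemma schwartz_fourier_invertible: "f \<in> schwartz \<Longrightarrow> fourier_invertible f"
  by (simp add: fourier_invertible_def schwartz_continuous schwartz_bounded integrable_schwartz schwartz_fourier_adjoint)

text \<open>The constant is read off from one nonnegative bump function b. If it were 0, the
  transform of the conjugate of b's transform would vanish identically; exchanging transforms, the
  squared modulus of b's transform would then have integral zero. So the transform would vanish, and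
  its value at 0, the integral of b, would be zero, contrary to b being nonnegative and positive at
  0.\<close>

theorem fourier_inversion:
  obtains c :: complex where "c \<noteq> 0"
    "\<And>(f :: 'a::euclidean_space \<Rightarrow> complex) t. fourier_invertible f \<Longrightarrow>
      (\<integral>x. fourier_adjoint f x * cis (- (x \<bullet> t)) \<partial>lborel) = c * f t"
proof -
  obtain \<beta> :: "'a \<Rightarrow> real" where \<beta>: "(\<lambda>x. complex_of_real (\<beta> x)) \<in> test_functions"
    "\<And>x. 0 \<le> \<beta> x" "\<And>x. \<beta> x \<noteq> 0 \<longleftrightarrow> dist 0 x < 1"
    by (rule bump_exists[OF zero_less_one, of "0::'a"]) blast
  let ?b = "\<lambda>x. complex_of_real (\<beta> x)"
  note b = test_functions_schwartz[OF \<beta>(1)]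
  have b0: "\<beta> 0 \<noteq> 0" using \<beta>(3)[of 0] by simp
  define c where "c = integral\<^sup>L lborel (fourier_adjoint ?b) / ?b 0"
  have c: "integral\<^sup>L lborel (fourier_adjoint g) = c * g 0"
    if "fourier_invertible g" for g :: "'a \<Rightarrow> complex"
    using integral_fourier_adjoint_exchange[OF that b] b0 by (simp add: c_def field_simps)
  have inv: "(\<integral>x. fourier_adjoint f x * cis (- (x \<bullet> t)) \<partial>lborel) = c * f t"
    if "fourier_invertible f" for f :: "'a \<Rightarrow> complex" and t
    by (rule fourier_inversion_aux[OF _ that]) (rule c)
  have "c \<noteq> 0"
  proof
    assume c0: "c = 0"
    let ?g = "fourier_adjoint ?b"
    note g = schwartz_fourier_adjoint[OF b]
    have "fourier_adjoint (\<lambda>x. cnj (?g x)) \<xi> = 0" for \<xi>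
    proof -
      have "fourier_adjoint (\<lambda>x. cnj (?g x)) \<xi> = (\<integral>x. cnj (?g x * cis (- (x \<bullet> \<xi>))) \<partial>lborel)"
        by (simp add: fourier_adjoint_def cis_cnj inner_commute)
      also have "\<dots> = cnj (\<integral>x. ?g x * cis (- (x \<bullet> \<xi>)) \<partial>lborel)" by (rule Bochner_Integration.integral_cnj)
      also have "(\<integral>x. ?g x * cis (- (x \<bullet> \<xi>)) \<partial>lborel) = c * ?b \<xi>"
        by (rule inv[OF schwartz_fourier_invertible[OF b]])
      finally show ?thesis using c0 by simp
    qed
    then have "(\<integral>x. ?g x * cnj (?g x) \<partial>lborel) = 0"
      using integral_fourier_adjoint_mult[OF integrable_schwartz[OF b] integrable_schwartz[OF schwartz_cnj[OF g]]] by simp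
    then have "complex_of_real (\<integral>x. (cmod (?g x))\<^sup>2 \<partial>lborel) = 0"
      unfolding integral_complex_of_real[symmetric] complex_norm_square .
    then have I: "(\<integral>x. (cmod (?g x))\<^sup>2 \<partial>lborel) = 0" by simp
    have "integrable lborel (\<lambda>x. norm (?g x * cnj (?g x)))"
      by (intro integrable_norm integrable_schwartz schwartz_mult[OF schwartz_slow[OF g] schwartz_cnj[OF g]])
    then have "integrable lborel (\<lambda>x. (cmod (?g x))\<^sup>2)" by (simp add: norm_mult power2_eq_square)
    moreover have "continuous_on UNIV (\<lambda>x. (cmod (?g x))\<^sup>2)"
      by (intro continuous_intros schwartz_continuous g)
    ultimately have "?g 0 = 0" using integral_zero_imp_zero[OF _ _ _ I, of 0] by simp
    then have "integral\<^sup>L lborel \<beta> = 0"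
      by (simp add: fourier_adjoint_def)
    moreover have "integrable lborel \<beta>" "continuous_on UNIV \<beta>"
      using integrable_Re[OF integrable_schwartz[OF b]] continuous_on_Re[OF schwartz_continuous[OF b]] by simp_all
    ultimately show False using integral_zero_imp_zero[of \<beta> 0] \<beta>(2) b0 by blast
  qed
  then show ?thesis using inv that by blast
qed

text \<open>Every Schwartz function is in the range of \<open>fourier_adjoint\<close> on Schwartz
  functions. Knowing \<open>u\<close> on that range is therefore enough to compute its short-time
  transform.\<close>

lemma schwartz_eq_fourier_adjoint:
  obtains c :: complex where "c \<noteq> 0"
    "\<And>\<phi> :: 'a::euclidean_space \<Rightarrow> complex. \<phi> \<in> schwartz \<Longrightarrow> \<phi> = fourier_adjoint (\<lambda>\<xi>. c * fourier_adjoint \<phi> (- \<xi>))"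
proof -
  obtain c :: complex where c: "c \<noteq> 0"
    "\<And>(f :: 'a \<Rightarrow> complex) t. fourier_invertible f \<Longrightarrow>
      (\<integral>x. fourier_adjoint f x * cis (- (x \<bullet> t)) \<partial>lborel) = c * f t"
    using fourier_inversion by blast
  show ?thesis
  proof (rule that[of "1 / c"])
    fix \<phi> :: "'a \<Rightarrow> complex" assume \<phi>: "\<phi> \<in> schwartz"
    note g = schwartz_fourier_adjoint[OF \<phi>]
    have "\<phi> x = fourier_adjoint (\<lambda>\<xi>. 1 / c * fourier_adjoint \<phi> (- \<xi>)) x" for x
    proof -
      have "fourier_adjoint (\<lambda>\<xi>. 1 / c * fourier_adjoint \<phi> (- \<xi>)) x =
          1 / c * (\<integral>\<xi>. fourier_adjoint \<phi> (- \<xi>) * cis (x \<bullet> \<xi>) \<partial>lborel)"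
        by (simp add: fourier_adjoint_def)
      also have "(\<integral>\<xi>. fourier_adjoint \<phi> (- \<xi>) * cis (x \<bullet> \<xi>) \<partial>lborel) =
          (\<integral>\<xi>. fourier_adjoint \<phi> \<xi> * cis (x \<bullet> (- \<xi>)) \<partial>lborel)"
        using integral_lborel_reflect[of "\<lambda>\<xi>. fourier_adjoint \<phi> \<xi> * cis (x \<bullet> (- \<xi>))"] schwartz_measurable[OF g]
        by (simp add: cis_conv_exp)
      also have "\<dots> = c * \<phi> x"
        using c(2)[OF schwartz_fourier_invertible[OF \<phi>], of x]
        by (simp add: inner_commute)
      finally show ?thesis using c(1) by simp
    qed
    then show "\<phi> = fourier_adjoint (\<lambda>\<xi>. 1 / c * fourier_adjoint \<phi> (- \<xi>))" by blast
  qed (use c in simp)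
qed

section \<open>Tempered distributions\<close>

lemma schwartz_seminorm_le:
  assumes "\<And>x. japanese x ^ N * jet_norm N \<phi> x \<le> B"
  shows "schwartz_seminorm N \<phi> \<le> B"
  unfolding schwartz_seminorm_def
proof (rule cSUP_least)
  show "{bs::'a list. set bs \<subseteq> Basis \<and> length bs \<le> N} \<times> (UNIV::'a set) \<noteq> {}"
    by (auto intro: exI[of _ "[]"])
  fix p :: "'a list \<times> 'a"
  assume "p \<in> {bs. set bs \<subseteq> Basis \<and> length bs \<le> N} \<times> UNIV"
  then obtain bs x where p: "p = (bs, x)" "bs \<in> multi_idx N" by (auto simp: multi_idx_def)
  have "japanese x ^ N * cmod (iter_deriv bs \<phi> x) \<le> japanese x ^ N * jet_norm N \<phi> x"
    by (intro mult_left_mono iter_deriv_le_jet_norm p) auto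
  also have "\<dots> \<le> B" by (rule assms)
  finally show "(case p of (bs, x) \<Rightarrow> japanese x ^ N * cmod (iter_deriv bs \<phi> x)) \<le> B" by (simp add: p)
qed

text \<open>A real supremum can be compared with a member of the set once the set is bounded above,
  which membership in \<open>schwartz\<close> provides.\<close>

lemma schwartz_seminorm_nonneg:
  fixes \<phi> :: "'a::euclidean_space \<Rightarrow> complex"
  assumes "\<phi> \<in> schwartz" shows "0 \<le> schwartz_seminorm N \<phi>"
proof -
  obtain C where C: "\<And>x. japanese x ^ N * jet_norm N \<phi> x \<le> C" using schwartz_bound[OF assms] by metis
  let ?F = "\<lambda>(bs, x). japanese x ^ N * cmod (iter_deriv bs \<phi> x)"
  have "bdd_above (?F ` ({bs. set bs \<subseteq> Basis \<and> length bs \<le> N} \<times> UNIV))"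
  proof (rule bdd_aboveI2)
    fix p :: "'a list \<times> 'a"
    assume "p \<in> {bs. set bs \<subseteq> Basis \<and> length bs \<le> N} \<times> UNIV"
    then obtain bs x where p: "p = (bs, x)" "bs \<in> multi_idx N" by (auto simp: multi_idx_def)
    have "japanese x ^ N * cmod (iter_deriv bs \<phi> x) \<le> japanese x ^ N * jet_norm N \<phi> x"
      by (intro mult_left_mono iter_deriv_le_jet_norm p) auto
    then show "?F p \<le> C" using order_trans[OF _ C[of x]] p by simp
  qed
  from cSUP_upper[OF _ this, of "([], 0)"]
  have "?F ([], 0) \<le> schwartz_seminorm N \<phi>" by (simp add: schwartz_seminorm_def)
  moreover have "0 \<le> ?F ([], 0)" by simp
  ultimately show ?thesis by linarith
qed

text \<open>The continuity estimate in a usable form: any bound \<open>B\<close> of the weighted jet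
  takes the place of the supremum.\<close>

lemma tempered_bound:
  assumes "v \<in> tempered"
  obtains C N where "0 \<le> C" "\<And>\<phi> B. \<phi> \<in> schwartz \<Longrightarrow> (\<And>x. japanese x ^ N * jet_norm N \<phi> x \<le> B) \<Longrightarrow> cmod (v \<phi>) \<le> C * B"
proof -
  obtain C N where CN: "\<And>\<phi>. \<phi> \<in> schwartz \<Longrightarrow> cmod (v \<phi>) \<le> C * schwartz_seminorm N \<phi>"
    using assms unfolding tempered_def by blast
  have "cmod (v \<phi>) \<le> \<bar>C\<bar> * B"
    if "\<phi> \<in> schwartz" "\<And>x. japanese x ^ N * jet_norm N \<phi> x \<le> B" for \<phi> B
  proof -
    have "cmod (v \<phi>) \<le> C * schwartz_seminorm N \<phi>" by (rule CN[OF that(1)])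
    also have "\<dots> \<le> \<bar>C\<bar> * schwartz_seminorm N \<phi>"
      by (intro mult_right_mono schwartz_seminorm_nonneg that(1)) auto
    also have "\<dots> \<le> \<bar>C\<bar> * B" by (intro mult_left_mono schwartz_seminorm_le that(2)) auto
    finally show ?thesis .
  qed
  then show ?thesis using that[of "\<bar>C\<bar>" N] by simp
qed

lemma tempered_add: "v \<in> tempered \<Longrightarrow> \<phi> \<in> schwartz \<Longrightarrow> \<psi> \<in> schwartz \<Longrightarrow> v (\<lambda>x. \<phi> x + \<psi> x) = v \<phi> + v \<psi>"
  and tempered_cmult: "v \<in> tempered \<Longrightarrow> \<phi> \<in> schwartz \<Longrightarrow> v (\<lambda>x. c * \<phi> x) = cnj c * v \<phi>"
  by (auto simp: tempered_def)

lemma tempered_zero: "v \<in> tempered \<Longrightarrow> v (\<lambda>x. 0) = 0"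
  using tempered_cmult[of v "\<lambda>x. 0" 0] schwartz_zero by simp

lemma tempered_diff: "v \<in> tempered \<Longrightarrow> \<phi> \<in> schwartz \<Longrightarrow> \<psi> \<in> schwartz \<Longrightarrow> v (\<lambda>x. \<phi> x - \<psi> x) = v \<phi> - v \<psi>"
  using tempered_add[of v \<phi> "\<lambda>x. - 1 * \<psi> x"] tempered_cmult[of v \<psi> "- 1"] schwartz_cmult[of \<psi> "- 1"] by simp

lemma tempered_sum:
  assumes "v \<in> tempered" "\<And>i. i \<in> I \<Longrightarrow> \<psi> i \<in> schwartz"
  shows "v (\<lambda>x. \<Sum>i\<in>I. c i * \<psi> i x) = (\<Sum>i\<in>I. cnj (c i) * v (\<psi> i))"
  using assms(2)
proof (induction I rule: infinite_finite_induct)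
  case (insert i I)
  then have "(\<lambda>x. \<Sum>i\<in>I. c i * \<psi> i x) \<in> schwartz"
    by (intro schwartz_sum schwartz_cmult) auto
  then show ?case
    using insert tempered_add[OF assms(1) schwartz_cmult[of "\<psi> i" "c i"]] tempered_cmult[OF assms(1)] by simp
qed (simp_all add: tempered_zero assms(1))

lemma tempered_sum1:
  assumes "v \<in> tempered" "\<And>i. i \<in> I \<Longrightarrow> \<psi> i \<in> schwartz"
  shows "v (\<lambda>x. \<Sum>i\<in>I. \<psi> i x) = (\<Sum>i\<in>I. v (\<psi> i))"
  using tempered_sum[OF assms(1), where I = I and \<psi> = \<psi> and c = "\<lambda>i. 1"] assms(2) by simp

text \<open>The definition of the support makes \<open>v\<close> vanish only near each single point.
  Division by bump functions splits \<phi> into finitely many test functions, each supported in one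
  such neighbourhood.\<close>

lemma vanishes_off_dist_support:
  fixes v :: "('a::euclidean_space \<Rightarrow> complex) \<Rightarrow> complex"
  assumes v: "v \<in> tempered" and \<phi>: "\<phi> \<in> test_functions" and disj: "fun_support \<phi> \<inter> dist_support v = {}"
  shows "v \<phi> = 0"
proof -
  have "\<exists>\<Phi>. \<Phi> \<in> test_functions \<and> \<Phi> x \<noteq> 0 \<and> (\<forall>\<psi>\<in>test_functions. fun_support \<psi> \<subseteq> fun_support \<Phi> \<longrightarrow> v \<psi> = 0)"
    if "x \<in> fun_support \<phi>" for x
  proof -
    have "x \<notin> dist_support v" using that disj by auto
    then obtain U where U: "open U" "x \<in> U" "\<forall>\<psi>\<in>test_functions. fun_support \<psi> \<subseteq> U \<longrightarrow> v \<psi> = 0"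
      unfolding dist_support_def by auto
    then obtain r where r: "r > 0" "cball x r \<subseteq> U" using open_contains_cball by blast
    obtain \<beta> where \<beta>: "(\<lambda>y. complex_of_real (\<beta> y)) \<in> test_functions"
      "fun_support (\<lambda>y. complex_of_real (\<beta> y)) \<subseteq> cball x r" "\<And>y. \<beta> y \<noteq> 0 \<longleftrightarrow> dist x y < r"
      by (rule bump_exists[OF r(1), of x]) blast
    show ?thesis
      by (rule exI[of _ "\<lambda>y. complex_of_real (\<beta> y)"]) (use \<beta> r U(3) in auto)
  qed
  then obtain \<Phi> where \<Phi>: "\<And>x. x \<in> fun_support \<phi> \<Longrightarrow> \<Phi> x \<in> test_functions"
    "\<And>x. x \<in> fun_support \<phi> \<Longrightarrow> \<Phi> x x \<noteq> 0"
    "\<And>x \<psi>. x \<in> fun_support \<phi> \<Longrightarrow> \<psi> \<in> test_functions \<Longrightarrow> fun_support \<psi> \<subseteq> fun_support (\<Phi> x) \<Longrightarrow> v \<psi> = 0"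
    by metis
  obtain J \<rho> where J: "finite J" "J \<subseteq> fun_support \<phi>" "\<And>j. j \<in> J \<Longrightarrow> \<rho> j \<in> test_functions"
    and eq: "\<phi> = (\<lambda>x. \<Sum>j\<in>J. \<Phi> j x * \<rho> j x)"
    by (rule test_function_division[OF \<phi> \<Phi>(1,2)]) auto
  have t: "(\<lambda>x. \<Phi> j x * \<rho> j x) \<in> test_functions" "fun_support (\<lambda>x. \<Phi> j x * \<rho> j x) \<subseteq> fun_support (\<Phi> j)"
    if "j \<in> J" for j
    using test_functions_mult[OF \<Phi>(1) test_functions_smooth[OF J(3)], of j j] that J(2) by auto
  have "v \<phi> = (\<Sum>j\<in>J. v (\<lambda>x. \<Phi> j x * \<rho> j x))"
    by (subst eq, rule tempered_sum1[OF v]) (simp add: t test_functions_schwartz)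
  also have "\<dots> = 0" using t J(2) \<Phi>(3) by (intro sum.neutral) blast
  finally show ?thesis .
qed

lemma jet_norm_const:
  fixes x :: "'a::euclidean_space"
  shows "jet_norm N (\<lambda>x. c) x = jet_norm N (\<lambda>x. c) (0::'a)"
  by (simp add: jet_norm_def iter_deriv_const multi_idx_def)

text \<open>Truncation: a Schwartz function is the limit of its products with dilated cutoffs.\<close>

lemma tempered_eq_zero_by_truncation:
  fixes v :: "('a::euclidean_space \<Rightarrow> complex) \<Rightarrow> complex"
  assumes v: "v \<in> tempered" and g: "g \<in> schwartz"
    and z: "\<And>\<theta>. \<theta> \<in> test_functions \<Longrightarrow> v (\<lambda>x. \<theta> x * g x) = 0"
  shows "v g = 0"
proof -
  obtain C N where CN: "0 \<le> C" "\<And>\<phi> B. \<phi> \<in> schwartz \<Longrightarrow> (\<And>x. japanese x ^ N * jet_norm N \<phi> x \<le> B) \<Longrightarrow> cmod (v \<phi>) \<le> C * B"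
    using tempered_bound[OF v] by metis
  obtain \<theta> :: "'a \<Rightarrow> complex" where \<theta>: "\<theta> \<in> test_functions" "\<And>x. norm x \<le> 1 \<Longrightarrow> \<theta> x = 1"
    "\<And>x. 1 + 1 \<le> norm x \<Longrightarrow> \<theta> x = 0"
    using cutoff_exists[of 1] by auto
  note sm\<theta> = test_functions_smooth[OF \<theta>(1)]
  let ?\<kappa> = "\<lambda>x. 1 - \<theta> x"
  have smk: "smooth_fun ?\<kappa>" by (intro smooth_fun_diff smooth_fun_const sm\<theta>)
  obtain K where K: "0 \<le> K" "\<And>x. jet_norm N ?\<kappa> x \<le> K"
  proof -
    obtain K where K: "\<And>x. japanese x ^ 0 * jet_norm N \<theta> x \<le> K"
      using schwartz_bound[OF test_functions_schwartz[OF \<theta>(1)]] by metis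
    have le: "jet_norm N ?\<kappa> x \<le> jet_norm N (\<lambda>x::'a. 1) 0 + K" for x
    proof -
      have "jet_norm N ?\<kappa> x \<le> jet_norm N (\<lambda>x. 1) x + jet_norm N (\<lambda>x. - 1 * \<theta> x) x"
        using jet_norm_add_le[of "\<lambda>x. 1" "\<lambda>x. - 1 * \<theta> x" N x] smooth_fun_cmult[OF sm\<theta>, of "- 1"] by simp
      also have "jet_norm N (\<lambda>x. - 1 * \<theta> x) x = jet_norm N \<theta> x"
        using jet_norm_cmult[OF sm\<theta>, of N "- 1" x] by simp
      finally show ?thesis using K[of x] jet_norm_const[of N 1 x] by simp
    qed
    then show ?thesis using that[of "jet_norm N (\<lambda>x::'a. 1) 0 + K"] order_trans[OF jet_norm_nonneg le] by blast
  qed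
  obtain L where L: "0 < L" "\<And>f g (x::'a). smooth_fun f \<Longrightarrow> smooth_fun g \<Longrightarrow>
       jet_norm N (\<lambda>x. f x * g x) x \<le> L * (jet_norm N f x * jet_norm N g x)"
    using jet_norm_mult_le by blast
  \<comment> \<open>One weight more than \<open>v\<close> asks for. The truncation error vanishes
    where |x| < n + 1, so the surplus weight gains the factor 1 / (n + 1).\<close>
  obtain A where A: "0 \<le> A" "\<And>x. japanese x ^ (N + 1) * jet_norm N g x \<le> A"
    using schwartz_bound[OF g] by metis
  have bound: "cmod (v g) \<le> C * (L * K * A / real (Suc n))" for n
  proof -
    let ?r = "1 / real (Suc n)"
    \<comment> \<open>The summand 0 gives the argument the affine shape of the dilation
      lemmas.\<close>
    let ?\<theta>n = "\<lambda>x. \<theta> (?r *\<^sub>R x + 0)"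
    have \<theta>n: "?\<theta>n \<in> test_functions"
    proof (rule test_functionsI(1)[OF smooth_fun_affine_arg[OF sm\<theta>] compact_cball[of 0 "2 * real (Suc n)"]])
      fix x :: 'a assume "x \<notin> cball 0 (2 * real (Suc n))"
      then show "\<theta> (?r *\<^sub>R x + 0) = 0" by (intro \<theta>(3)) (simp add: field_simps)
    qed
    have S: "(\<lambda>x. ?\<theta>n x * g x) \<in> schwartz"
      by (rule schwartz_mult[OF schwartz_slow[OF test_functions_schwartz[OF \<theta>n]] g])
    have "v g = v (\<lambda>x. g x - ?\<theta>n x * g x)"
      using tempered_diff[OF v g S] z[OF \<theta>n] by simp
    also have "cmod \<dots> \<le> C * (L * K * A / real (Suc n))"
    proof (rule CN(2)[OF schwartz_diff[OF g S]])
      fix x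
      let ?\<kappa>n = "\<lambda>x. ?\<kappa> (?r *\<^sub>R x + 0)"
      have smkn: "smooth_fun ?\<kappa>n" by (rule smooth_fun_affine_arg[OF smk])
      have eq: "(\<lambda>x. g x - ?\<theta>n x * g x) = (\<lambda>x. ?\<kappa>n x * g x)" by (simp add: left_diff_distrib)
      show "japanese x ^ N * jet_norm N (\<lambda>x. g x - ?\<theta>n x * g x) x \<le> L * K * A / real (Suc n)"
      proof (cases "norm x < real (Suc n)")
        case True
        have "jet_norm N (\<lambda>x. g x - ?\<theta>n x * g x) x = jet_norm N (\<lambda>x. 0) x"
        proof (rule jet_norm_cong_open[of "ball 0 (real (Suc n))"])
          fix y :: 'a assume "y \<in> ball 0 (real (Suc n))"
          then have "\<theta> (?r *\<^sub>R y + 0) = 1" by (intro \<theta>(2)) (simp add: field_simps)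
          then show "g y - \<theta> (?r *\<^sub>R y + 0) * g y = 0" by simp
        qed (use True in auto)
        then show ?thesis using K(1) L(1) A(1) by (simp add: jet_norm_zero)
      next
        case False
        have "jet_norm N ?\<kappa>n x \<le> K"
          using jet_norm_affine_arg_le[OF smk, of ?r N 0 x] K(2)[of "?r *\<^sub>R x + 0"] by (simp add: field_simps)
        then have "jet_norm N ?\<kappa>n x * jet_norm N g x \<le> K * jet_norm N g x" by (rule mult_right_mono) simp
        then have "L * (jet_norm N ?\<kappa>n x * jet_norm N g x) \<le> L * (K * jet_norm N g x)"
          using L(1) by (intro mult_left_mono) auto
        then have 1: "jet_norm N (\<lambda>x. ?\<kappa>n x * g x) x \<le> L * (K * jet_norm N g x)"
          using L(2)[OF smkn schwartz_smooth[OF g], of x] by linarith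
        have "real (Suc n) * (japanese x ^ N * jet_norm N g x) \<le> japanese x * (japanese x ^ N * jet_norm N g x)"
          using False norm_le_japanese[of x] by (intro mult_right_mono) auto
        also have "\<dots> \<le> A" using A(2)[of x] by (simp add: mult.assoc)
        finally have 2: "japanese x ^ N * jet_norm N g x \<le> A / real (Suc n)"
          by (simp add: pos_le_divide_eq mult.commute)
        have "japanese x ^ N * jet_norm N (\<lambda>x. ?\<kappa>n x * g x) x \<le> japanese x ^ N * (L * (K * jet_norm N g x))"
          by (intro mult_left_mono 1) auto
        also have "\<dots> = L * K * (japanese x ^ N * jet_norm N g x)" by simp
        also have "\<dots> \<le> L * K * (A / real (Suc n))" using L(1) K(1) by (intro mult_left_mono 2) auto
        finally show ?thesis unfolding eq by simp
      qed
    qed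
    finally show ?thesis .
  qed
  have "(\<lambda>n. C * (L * K * A / real (Suc n))) \<longlonglongrightarrow> C * 0"
    by (intro tendsto_mult tendsto_const LIMSEQ_Suc[OF lim_const_over_n])
  then have "cmod (v g) \<le> 0" using bound by (intro LIMSEQ_le_const) auto
  then show ?thesis by simp
qed

text \<open>The cutoff is 1 on a ball containing the support of \<open>v\<close>, so the rest of
  \<psi> lives away from that support. As the rest need not be compactly supported, it is truncated
  before the support is used.\<close>

lemma compact_dists_cutoff:
  fixes v :: "('a::euclidean_space \<Rightarrow> complex) \<Rightarrow> complex"
  assumes "v \<in> compact_dists"
  obtains \<theta> where "\<theta> \<in> test_functions" "\<And>\<psi>. \<psi> \<in> schwartz \<Longrightarrow> v \<psi> = v (\<lambda>x. \<theta> x * \<psi> x)"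
proof -
  have v: "v \<in> tempered" "compact (dist_support v)" using assms by (auto simp: compact_dists_def)
  obtain R where R: "0 < R" "dist_support v \<subseteq> ball 0 R"
    using bounded_subset_ballD[OF compact_imp_bounded[OF v(2)], of 0] by blast
  obtain \<theta> :: "'a \<Rightarrow> complex" where \<theta>: "\<theta> \<in> test_functions" "\<And>x. norm x \<le> R \<Longrightarrow> \<theta> x = 1"
    using cutoff_exists[of R] R(1) by (metis less_imp_le)
  have "v \<psi> = v (\<lambda>x. \<theta> x * \<psi> x)" if \<psi>: "\<psi> \<in> schwartz" for \<psi>
  proof -
    have S: "(\<lambda>x. \<theta> x * \<psi> x) \<in> schwartz"
      by (rule schwartz_mult[OF schwartz_slow[OF test_functions_schwartz[OF \<theta>(1)]] \<psi>])
    note g = schwartz_diff[OF \<psi> S]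
    have "v (\<lambda>x. \<psi> x - \<theta> x * \<psi> x) = 0"
    proof (rule tempered_eq_zero_by_truncation[OF v(1) g])
      fix \<kappa> :: "'a \<Rightarrow> complex" assume \<kappa>: "\<kappa> \<in> test_functions"
      \<comment> \<open>The complement of the open ball is closed, so passing to the closure in
        \<open>fun_support\<close> adds no point of the support of \<open>v\<close>.\<close>
      have "fun_support (\<lambda>x. \<kappa> x * (\<psi> x - \<theta> x * \<psi> x)) \<subseteq> - ball 0 R"
        using \<theta>(2) by (intro fun_support_subsetI) (auto simp: closed_def intro: less_imp_le)
      then have "fun_support (\<lambda>x. \<kappa> x * (\<psi> x - \<theta> x * \<psi> x)) \<inter> dist_support v = {}"
        using R(2) by blast
      then show "v (\<lambda>x. \<kappa> x * (\<psi> x - \<theta> x * \<psi> x)) = 0"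
        by (rule vanishes_off_dist_support[OF v(1) test_functions_mult(1)[OF \<kappa> schwartz_smooth[OF g]]])
    qed
    then show ?thesis using tempered_diff[OF v(1) \<psi> S] by simp
  qed
  then show ?thesis using that \<theta>(1) by blast
qed

section \<open>Fourier transforms of localized distributions\<close>

text \<open>\<open>dist_fourier v a\<close> is the Fourier transform of the product of \<open>v\<close> with the conjugate of \<open>a\<close>.\<close>

definition dist_fourier :: "(('a::euclidean_space \<Rightarrow> complex) \<Rightarrow> complex) \<Rightarrow> ('a \<Rightarrow> complex) \<Rightarrow> 'a \<Rightarrow> complex" where
  "dist_fourier v a \<xi> = v (\<lambda>x. a x * cis (x \<bullet> \<xi>))"

lemma schwartz_mult_cis: "a \<in> schwartz \<Longrightarrow> (\<lambda>x. a x * cis (x \<bullet> \<xi>)) \<in> schwartz"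
  using schwartz_mult[OF slow_fun_cis, of a \<xi>] by (simp add: mult.commute)

lemma dist_fourier_bound:
  fixes v :: "('a::euclidean_space \<Rightarrow> complex) \<Rightarrow> complex"
  assumes v: "v \<in> tempered" and a: "a \<in> schwartz"
  obtains C N where "0 \<le> C" "\<And>\<xi>. cmod (dist_fourier v a \<xi>) \<le> C * japanese \<xi> ^ N"
proof -
  obtain C N where CN: "0 \<le> C" "\<And>\<phi> B. \<phi> \<in> schwartz \<Longrightarrow> (\<And>x. japanese x ^ N * jet_norm N \<phi> x \<le> B) \<Longrightarrow> cmod (v \<phi>) \<le> C * B"
    using tempered_bound[OF v] by metis
  obtain L where L: "0 < L" "\<And>f g (x::'a). smooth_fun f \<Longrightarrow> smooth_fun g \<Longrightarrow>
       jet_norm N (\<lambda>x. f x * g x) x \<le> L * (jet_norm N f x * jet_norm N g x)"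
    using jet_norm_mult_le by blast
  obtain K where K: "0 < K" "\<And>x \<xi>::'a. jet_norm N (\<lambda>x. cis (x \<bullet> \<xi>)) x \<le> K * japanese \<xi> ^ N"
    using jet_norm_cis_le by blast
  obtain A where A: "0 \<le> A" "\<And>x. japanese x ^ N * jet_norm N a x \<le> A"
    using schwartz_bound[OF a] by metis
  have "cmod (dist_fourier v a \<xi>) \<le> C * (L * A * K) * japanese \<xi> ^ N" for \<xi>
  proof -
    have "cmod (dist_fourier v a \<xi>) \<le> C * (L * (A * (K * japanese \<xi> ^ N)))"
      unfolding dist_fourier_def
    proof (rule CN(2)[OF schwartz_mult_cis[OF a]])
      fix x
      have "japanese x ^ N * jet_norm N (\<lambda>x. a x * cis (x \<bullet> \<xi>)) x \<le>
          japanese x ^ N * (L * (jet_norm N a x * jet_norm N (\<lambda>x. cis (x \<bullet> \<xi>)) x))"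
        by (intro mult_left_mono L(2) schwartz_smooth a smooth_fun_cis) auto
      also have "\<dots> = L * ((japanese x ^ N * jet_norm N a x) * jet_norm N (\<lambda>x. cis (x \<bullet> \<xi>)) x)"
        by (simp add: mult_ac)
      also have "\<dots> \<le> L * (A * (K * japanese \<xi> ^ N))"
        using A(1) L(1) by (intro mult_left_mono mult_mono A(2) K(2)) auto
      finally show "japanese x ^ N * jet_norm N (\<lambda>x. a x * cis (x \<bullet> \<xi>)) x \<le> L * (A * (K * japanese \<xi> ^ N))" .
    qed
    then show ?thesis by (simp add: mult_ac)
  qed
  then show ?thesis using that[of "C * (L * A * K)" N] CN(1) L(1) K(1) A(1) by simp
qed

text \<open>Every derivative in x stays quadratic in h. Order 0 is Taylor's estimate. Order 1 leaves
  (b \<bullet> h)(cis - 1), a product of two factors linear in h. From order 2 on the linear part is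
  gone and at least two factors b \<bullet> h have come out, the surplus ones being at most 1
  because |h| is.\<close>

lemma jet_norm_cis_remainder:
  obtains K where "0 < K"
    "\<And>x h::'a::euclidean_space. norm h \<le> 1 \<Longrightarrow>
       jet_norm N (\<lambda>x. cis (x \<bullet> h) - 1 - \<i> * of_real (x \<bullet> h)) x \<le> K * (japanese x ^ 2 * (norm h)\<^sup>2)"
proof
  let ?K = "real (card (multi_idx N :: 'a list set))"
  show "0 < ?K" by (simp add: card_multi_idx_pos)
  fix x h :: 'a assume h: "norm h \<le> 1"
  let ?R = "\<lambda>x. cis (x \<bullet> h) - 1 - \<i> * of_real (x \<bullet> h)"
  let ?L = "\<lambda>x. \<i> * complex_of_real (x \<bullet> h)"
  have blin: "bounded_linear ?L"
    by (intro bounded_linear_compose[OF bounded_linear_mult_right] bounded_linear_compose[OF bounded_linear_of_real] bounded_linear_inner_left)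
  note smL = smooth_fun_bounded_linear[OF blin]
  have inner_le: "\<bar>x \<bullet> h\<bar> \<le> japanese x * norm h"
    using order_trans[OF Cauchy_Schwarz_ineq2 mult_right_mono[OF norm_le_japanese]] by simp
  have b_le: "\<bar>b \<bullet> h\<bar> \<le> norm h" if "b \<in> Basis" for b
    using Basis_le_norm[OF that, of h] by (simp add: inner_commute)
  have j1: "1 \<le> japanese x" by (rule japanese_ge_1)
  have prod_le: "cmod (\<Prod>b\<leftarrow>bs. \<i> * complex_of_real (b \<bullet> h)) \<le> norm h ^ length bs" if "set bs \<subseteq> Basis" for bs
    using that by (induction bs) (auto simp: norm_mult b_le intro!: mult_mono)
  have "cmod (iter_deriv bs ?R x) \<le> japanese x ^ 2 * (norm h)\<^sup>2" if bs: "bs \<in> multi_idx N" for bs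
  proof -
    have B: "set bs \<subseteq> Basis" using bs by (simp add: multi_idx_def)
    have eq: "iter_deriv bs ?R x = (\<Prod>b\<leftarrow>bs. \<i> * complex_of_real (b \<bullet> h)) * cis (x \<bullet> h)
        - (if bs = [] then 1 else 0) - iter_deriv bs ?L x"
      using B smL by (simp add: iter_deriv_diff smooth_fun_diff iter_deriv_cis iter_deriv_const)
    consider "bs = []" | b where "bs = [b]" | cs b where "bs = cs @ [b]" "cs \<noteq> []"
      by (metis append_Nil rev_exhaust)
    then show ?thesis
    proof cases
      case 1
      have "cmod (?R x) \<le> (x \<bullet> h)\<^sup>2" by (rule cis_approx)
      also have "\<dots> \<le> (japanese x * norm h)\<^sup>2"
        using inner_le abs_le_square_iff[of "x \<bullet> h" "japanese x * norm h"] by simp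
      finally show ?thesis using 1 by (simp add: power_mult_distrib)
    next
      case 2
      have "iter_deriv bs ?R x = \<i> * complex_of_real (b \<bullet> h) * (cis (x \<bullet> h) - 1)"
        unfolding eq using 2 by (simp add: dir_deriv_bounded_linear[OF blin] algebra_simps)
      then have "cmod (iter_deriv bs ?R x) = \<bar>b \<bullet> h\<bar> * cmod (cis (x \<bullet> h) - 1)"
        by (simp add: norm_mult)
      also have "\<dots> \<le> norm h * (japanese x * norm h)"
        using 2 B order_trans[OF cis_approx0 inner_le] by (intro mult_mono b_le) auto
      also have "\<dots> \<le> norm h * (japanese x ^ 2 * norm h)"
        using j1 by (intro mult_left_mono mult_right_mono) (auto simp: power2_eq_square)
      finally show ?thesis by (simp add: power2_eq_square mult_ac)
    next
      case 3
      then have "iter_deriv bs ?L x = 0"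
        using B by (simp add: iter_deriv_append dir_deriv_bounded_linear[OF blin] iter_deriv_const)
      then have "cmod (iter_deriv bs ?R x) = cmod (\<Prod>b\<leftarrow>bs. \<i> * complex_of_real (b \<bullet> h))"
        unfolding eq using 3 by (simp add: norm_mult)
      also have "\<dots> \<le> norm h ^ length bs" by (rule prod_le[OF B])
      also have "\<dots> \<le> norm h ^ 2"
        using 3 h by (intro power_decreasing) (auto simp: Suc_le_eq length_greater_0_conv[symmetric] simp del: length_greater_0_conv)
      also have "\<dots> \<le> japanese x ^ 2 * (norm h)\<^sup>2"
        using mult_right_mono[OF japanese_power_ge_1[of x 2], of "(norm h)\<^sup>2"] by simp
      finally show ?thesis .
    qed
  qed
  from sum_bounded_above[of "multi_idx N", OF this]
  show "jet_norm N ?R x \<le> ?K * (japanese x ^ 2 * (norm h)\<^sup>2)" by (simp add: jet_norm_def)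
qed

lemma schwartz_inner_left_mult: "a \<in> schwartz \<Longrightarrow> (\<lambda>x. \<i> * of_real (x \<bullet> h) * a x) \<in> schwartz"
  using schwartz_inner_mult[of a h] by (simp add: inner_commute)

lemma dist_fourier_has_derivative:
  fixes v :: "('a::euclidean_space \<Rightarrow> complex) \<Rightarrow> complex"
  assumes v: "v \<in> tempered" and a: "a \<in> schwartz"
  shows "(dist_fourier v a has_derivative (\<lambda>h. dist_fourier v (\<lambda>x. \<i> * of_real (x \<bullet> h) * a x) \<xi>)) (at \<xi>)"
proof -
  let ?L = "\<lambda>h. dist_fourier v (\<lambda>x. \<i> * of_real (x \<bullet> h) * a x) \<xi>"
  have S: "(\<lambda>x. \<i> * of_real (x \<bullet> h) * a x * cis (x \<bullet> \<xi>)) \<in> schwartz" for h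
    by (intro schwartz_mult_cis schwartz_inner_left_mult a)
  have "linear ?L"
  proof (rule linearI)
    show "?L (h + k) = ?L h + ?L k" for h k
      unfolding dist_fourier_def tempered_add[OF v S S, symmetric] by (simp add: algebra_simps)
    show "?L (r *\<^sub>R h) = r *\<^sub>R ?L h" for r h
      using tempered_cmult[OF v S[of h], of "of_real r"]
      by (simp add: dist_fourier_def scaleR_conv_of_real mult_ac)
  qed
  then have blin: "bounded_linear ?L" by (simp add: linear_conv_bounded_linear)
  obtain C N where CN: "0 \<le> C" "\<And>\<phi> B. \<phi> \<in> schwartz \<Longrightarrow> (\<And>x. japanese x ^ N * jet_norm N \<phi> x \<le> B) \<Longrightarrow> cmod (v \<phi>) \<le> C * B"
    using tempered_bound[OF v] by metis
  obtain L where L: "0 < L" "\<And>f g (x::'a). smooth_fun f \<Longrightarrow> smooth_fun g \<Longrightarrow>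
       jet_norm N (\<lambda>x. f x * g x) x \<le> L * (jet_norm N f x * jet_norm N g x)"
    using jet_norm_mult_le by blast
  obtain K where K: "0 < K" "\<And>x h::'a. norm h \<le> 1 \<Longrightarrow>
       jet_norm N (\<lambda>x. cis (x \<bullet> h) - 1 - \<i> * of_real (x \<bullet> h)) x \<le> K * (japanese x ^ 2 * (norm h)\<^sup>2)"
    using jet_norm_cis_remainder by blast
  let ?b = "\<lambda>x. a x * cis (x \<bullet> \<xi>)"
  note b = schwartz_mult_cis[OF a, of \<xi>]
  \<comment> \<open>Two weights more than \<open>v\<close> asks for, to absorb the squared weight in
    the remainder estimate.\<close>
  obtain A where A: "0 \<le> A" "\<And>x. japanese x ^ (N + 2) * jet_norm N ?b x \<le> A"
    using schwartz_bound[OF b] by metis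
  show ?thesis
  proof (rule has_derivative_quadratic_remainder[OF blin])
    fix h :: 'a assume h: "norm h \<le> 1"
    let ?R = "\<lambda>x. cis (x \<bullet> h) - 1 - \<i> * of_real (x \<bullet> h)"
    have blinL: "bounded_linear (\<lambda>x. \<i> * complex_of_real (x \<bullet> h))"
      by (intro bounded_linear_compose[OF bounded_linear_mult_right] bounded_linear_compose[OF bounded_linear_of_real] bounded_linear_inner_left)
    have smR: "smooth_fun ?R"
      by (intro smooth_fun_diff smooth_fun_cis smooth_fun_const smooth_fun_bounded_linear blinL)
    note S1 = schwartz_mult_cis[OF a, of "\<xi> + h"]
    have "dist_fourier v a (\<xi> + h) - dist_fourier v a \<xi> - ?L h =
        v (\<lambda>x. a x * cis (x \<bullet> (\<xi> + h)) - a x * cis (x \<bullet> \<xi>) - \<i> * of_real (x \<bullet> h) * a x * cis (x \<bullet> \<xi>))"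
      unfolding dist_fourier_def tempered_diff[OF v schwartz_diff[OF S1 b] S] tempered_diff[OF v S1 b] ..
    also have "(\<lambda>x. a x * cis (x \<bullet> (\<xi> + h)) - a x * cis (x \<bullet> \<xi>) - \<i> * of_real (x \<bullet> h) * a x * cis (x \<bullet> \<xi>)) =
        (\<lambda>x. ?b x * ?R x)"
      by (simp add: inner_add_right algebra_simps flip: cis_mult)
    also have "cmod (v (\<lambda>x. ?b x * ?R x)) \<le> C * (L * (K * A * (norm h)\<^sup>2))"
    proof (rule CN(2))
      have "(\<lambda>x. ?b x * ?R x) = (\<lambda>x. a x * cis (x \<bullet> (\<xi> + h)) - a x * cis (x \<bullet> \<xi>) - \<i> * of_real (x \<bullet> h) * a x * cis (x \<bullet> \<xi>))"
        by (simp add: inner_add_right algebra_simps flip: cis_mult)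
      then show "(\<lambda>x. ?b x * ?R x) \<in> schwartz"
        using schwartz_diff[OF schwartz_diff[OF S1 b] S] by simp
      fix x
      have "japanese x ^ N * jet_norm N (\<lambda>x. ?b x * ?R x) x \<le>
          japanese x ^ N * (L * (jet_norm N ?b x * jet_norm N ?R x))"
        by (intro mult_left_mono L(2) schwartz_smooth b smR) auto
      also have "\<dots> \<le> japanese x ^ N * (L * (jet_norm N ?b x * (K * (japanese x ^ 2 * (norm h)\<^sup>2))))"
        using L(1) by (intro mult_left_mono K(2) h) auto
      also have "\<dots> = L * (K * (japanese x ^ (N + 2) * jet_norm N ?b x) * (norm h)\<^sup>2)"
        by (simp add: power_add power2_eq_square mult_ac)
      also have "\<dots> \<le> L * (K * A * (norm h)\<^sup>2)"
        using L(1) K(1) by (intro mult_left_mono mult_right_mono A(2)) auto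
      finally show "japanese x ^ N * jet_norm N (\<lambda>x. ?b x * ?R x) x \<le> L * (K * A * (norm h)\<^sup>2)" .
    qed
    finally show "cmod (dist_fourier v a (\<xi> + h) - dist_fourier v a \<xi> - ?L h) \<le> C * (L * (K * A)) * (norm h)\<^sup>2"
      by (simp add: mult_ac)
  qed
qed

text \<open>Differentiation in \<xi> merely multiplies \<open>a\<close> by a linear function, which
  leaves it a Schwartz function; hence \<open>a\<close> is arbitrary in the induction.\<close>

lemma smooth_dist_fourier:
  assumes v: "v \<in> tempered" and a: "a \<in> schwartz"
  shows "smooth_fun (dist_fourier v a)"
proof -
  have "diff_upto k (dist_fourier v a)" for k
    using a
  proof (induction k arbitrary: a)
    case (Suc k)
    show ?case
    proof (rule diff_upto_SucI)
      show "(dist_fourier v a has_derivative (\<lambda>h. dist_fourier v (\<lambda>x. \<i> * of_real (x \<bullet> h) * a x) \<xi>)) (at \<xi>)" for \<xi>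
        by (rule dist_fourier_has_derivative[OF v Suc.prems])
      show "diff_upto k (\<lambda>\<xi>. dist_fourier v (\<lambda>x. \<i> * of_real (x \<bullet> b) * a x) \<xi>)" for b
        by (rule Suc.IH[OF schwartz_inner_left_mult[OF Suc.prems]])
    qed
  qed simp
  then show ?thesis by (simp add: smooth_fun_iff)
qed

text \<open>Used in both directions: to recognize the finite sum obtained from \<open>v\<close> as
  an integral, and to write derivatives of the discretized transform as integrals.\<close>

lemma integral_simple_compose:
  fixes F :: "'a::euclidean_space \<Rightarrow> 'a" and \<psi> h :: "'a \<Rightarrow> complex"
  assumes F: "simple_function lborel F" and \<psi>: "integrable lborel \<psi>"
  shows "(\<integral>\<xi>. \<psi> \<xi> * h (F \<xi>) \<partial>lborel) = (\<Sum>y\<in>range F. (\<integral>\<xi>. \<psi> \<xi> * indicator (F -` {y}) \<xi> \<partial>lborel) * h y)"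
    and "integrable lborel (\<lambda>\<xi>. \<psi> \<xi> * h (F \<xi>))"
proof -
  have fin: "finite (range F)" using simple_functionD(1)[OF F] by simp
  have meas: "F -` {y} \<in> sets lborel" for y using simple_functionD(2)[OF F, of "{y}"] by simp
  have eq: "\<psi> \<xi> * h (F \<xi>) = (\<Sum>y\<in>range F. \<psi> \<xi> * indicator (F -` {y}) \<xi> * h y)" for \<xi>
  proof -
    have "(\<Sum>y\<in>range F. \<psi> \<xi> * indicator (F -` {y}) \<xi> * h y) = (\<Sum>y\<in>range F. if y = F \<xi> then \<psi> \<xi> * h y else 0)"
      by (intro sum.cong) (auto simp: indicator_def)
    also have "\<dots> = \<psi> \<xi> * h (F \<xi>)" using fin by simp
    finally show ?thesis by simp
  qed
  have int: "integrable lborel (\<lambda>\<xi>. \<psi> \<xi> * indicator (F -` {y}) \<xi>)" for y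
  proof (rule Bochner_Integration.integrable_bound[OF \<psi>])
    show "(\<lambda>\<xi>. \<psi> \<xi> * indicator (F -` {y}) \<xi>) \<in> borel_measurable lborel"
      using meas[of y] borel_measurable_integrable[OF \<psi>] by measurable
  qed (auto simp: indicator_def)
  show "integrable lborel (\<lambda>\<xi>. \<psi> \<xi> * h (F \<xi>))"
    unfolding eq using int by (intro Bochner_Integration.integrable_sum integrable_mult_left) auto
  show "(\<integral>\<xi>. \<psi> \<xi> * h (F \<xi>) \<partial>lborel) = (\<Sum>y\<in>range F. (\<integral>\<xi>. \<psi> \<xi> * indicator (F -` {y}) \<xi> \<partial>lborel) * h y)"
    unfolding eq using int by (subst Bochner_Integration.integral_sum) auto
qed

text \<open>The error made in a differentiated Fourier integrand when \<xi> is replaced by a nearby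
  \<eta>. In the frequency variable the phase is Lipschitz with constant |x|, so a single weight in
  x suffices for all orders.\<close>

lemma cmod_prod_cis_diff_le:
  fixes \<xi> \<eta> x :: "'a::euclidean_space"
  assumes bs: "bs \<in> multi_idx N"
  defines "m \<equiv> \<lambda>\<xi>. \<Prod>b\<leftarrow>bs. \<i> * complex_of_real (b \<bullet> \<xi>)"
  shows "cmod (m \<xi> * cis (x \<bullet> \<xi>) - m \<eta> * cis (x \<bullet> \<eta>)) \<le>
    japanese x * (cmod (m \<xi> - m \<eta>) + japanese \<eta> ^ N * norm (\<xi> - \<eta>))"
proof -
  have j: "1 \<le> japanese x" by (rule japanese_ge_1)
  have "m \<xi> * cis (x \<bullet> \<xi>) - m \<eta> * cis (x \<bullet> \<eta>) =
      (m \<xi> - m \<eta>) * cis (x \<bullet> \<xi>) + m \<eta> * (cis (x \<bullet> \<eta>) * (cis (x \<bullet> (\<xi> - \<eta>)) - 1))"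
    by (simp add: algebra_simps cis_mult)
  also have "cmod \<dots> \<le> cmod (m \<xi> - m \<eta>) + cmod (m \<eta>) * cmod (cis (x \<bullet> (\<xi> - \<eta>)) - 1)"
    by (rule order_trans[OF norm_triangle_ineq]) (simp add: norm_mult)
  also have "\<dots> \<le> japanese x * cmod (m \<xi> - m \<eta>) + japanese \<eta> ^ N * (japanese x * norm (\<xi> - \<eta>))"
  proof (intro add_mono mult_mono)
    show "cmod (m \<xi> - m \<eta>) \<le> japanese x * cmod (m \<xi> - m \<eta>)"
      using mult_right_mono[OF j, of "cmod (m \<xi> - m \<eta>)"] by simp
    have "cmod (m \<eta>) \<le> japanese \<eta> ^ length bs"
      unfolding m_def using bs by (intro cmod_prod_list_le) (simp add: multi_idx_def)
    also have "\<dots> \<le> japanese \<eta> ^ N"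
      using bs by (intro japanese_power_mono) (simp add: multi_idx_def)
    finally show "cmod (m \<eta>) \<le> japanese \<eta> ^ N" .
    have "cmod (cis (x \<bullet> (\<xi> - \<eta>)) - 1) \<le> \<bar>x \<bullet> (\<xi> - \<eta>)\<bar>" by (rule cis_approx0)
    also have "\<dots> \<le> japanese x * norm (\<xi> - \<eta>)"
      by (rule order_trans[OF Cauchy_Schwarz_ineq2 mult_right_mono[OF norm_le_japanese]]) simp
    finally show "cmod (cis (x \<bullet> (\<xi> - \<eta>)) - 1) \<le> japanese x * norm (\<xi> - \<eta>)" .
  qed auto
  finally show ?thesis by (simp add: distrib_left mult_ac)
qed

lemma japanese_scaled_le: "norm y \<le> 2 * norm x \<Longrightarrow> japanese y \<le> 2 * japanese x"
proof -
  assume "norm y \<le> 2 * norm x"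
  then have "(norm y)\<^sup>2 \<le> (2 * norm x)\<^sup>2" by (intro power_mono) auto
  then have "japanese y \<le> sqrt (2\<^sup>2 * (1 + (norm x)\<^sup>2))"
    unfolding japanese_def by (intro real_sqrt_le_mono) (simp add: power_mult_distrib)
  also have "\<dots> = 2 * japanese x" unfolding japanese_def real_sqrt_mult by simp
  finally show ?thesis .
qed

text \<open>Approximate the identity of the frequency space by simple functions \<open>F\<^sub>i\<close>; the integral over
  \<open>\<xi>\<close> then becomes a finite sum, with which \<open>v\<close> commutes, and the error tends to zero in the
  Schwartz topology.\<close>

lemma tempered_fourier_adjoint:
  fixes v :: "('a::euclidean_space \<Rightarrow> complex) \<Rightarrow> complex"
  assumes v: "v \<in> tempered" and a: "a \<in> schwartz" and \<psi>: "\<psi> \<in> schwartz"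
  shows "v (\<lambda>x. a x * fourier_adjoint \<psi> x) = (\<integral>\<xi>. dist_fourier v a \<xi> * cnj (\<psi> \<xi>) \<partial>lborel)"
proof -
  \<comment> \<open>The approximation theorem for measurable functions is applied to the identity;
    the bound 2 |x| keeps all weights at \<open>F i x\<close> comparable to those at x and so
    provides majorants.\<close>
  obtain F :: "nat \<Rightarrow> 'a \<Rightarrow> 'a" where F: "\<And>i. simple_function lborel (F i)"
    "\<And>x. (\<lambda>i. F i x) \<longlonglongrightarrow> x" "\<And>i x. norm (F i x) \<le> 2 * norm x"
    using borel_measurable_implies_sequence_metric[of "\<lambda>x::'a. x" lborel 0] by auto
  have F_meas [measurable]: "F i \<in> borel_measurable borel" for i
    using borel_measurable_simple_function[OF F(1)] by simp
  have jF: "japanese (F i \<xi>) ^ n \<le> 2 ^ n * japanese \<xi> ^ n" for i \<xi> n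
    unfolding power_mult_distrib[symmetric] by (intro power_mono japanese_scaled_le F(3)) simp
  note int\<psi> = integrable_schwartz[OF \<psi>]
  have [measurable]: "\<psi> \<in> borel_measurable borel" by (rule schwartz_measurable[OF \<psi>])
  have [measurable]: "(\<lambda>\<xi>. cnj (\<psi> \<xi>)) \<in> borel_measurable borel"
    by (rule schwartz_measurable[OF schwartz_cnj[OF \<psi>]])
  let ?G = "dist_fourier v a"
  have G_cont: "isCont ?G \<xi>" for \<xi> by (rule smooth_fun_isCont[OF smooth_dist_fourier[OF v a]])
  have [measurable]: "?G \<in> borel_measurable borel" by (rule smooth_fun_measurable[OF smooth_dist_fourier[OF v a]])
  \<comment> \<open>\<open>P i\<close> is \<open>fourier_adjoint \<psi>\<close> with the frequency
    in the exponential replaced by \<open>F i \<xi>\<close>; \<open>c i y\<close> is the mass of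
    \<psi> on the level set of y.\<close>
  define c where "c i y = (\<integral>\<xi>. \<psi> \<xi> * indicator (F i -` {y}) \<xi> \<partial>lborel)" for i y
  define P where "P i x = (\<Sum>y\<in>range (F i). c i y * cis (x \<bullet> y))" for i x
  have smP: "smooth_fun (P i)" for i
    unfolding P_def by (intro smooth_fun_sum smooth_fun_cmult smooth_fun_cis)
  have aP: "(\<lambda>x. a x * P i x) = (\<lambda>x. \<Sum>y\<in>range (F i). c i y * (a x * cis (x \<bullet> y)))" for i
    by (simp add: P_def sum_distrib_left mult_ac)
  have aP_S: "(\<lambda>x. a x * P i x) \<in> schwartz" for i
    unfolding aP by (intro schwartz_sum schwartz_cmult schwartz_mult_cis a)
  have aF_S: "(\<lambda>x. a x * fourier_adjoint \<psi> x) \<in> schwartz"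
    by (intro schwartz_mult schwartz_slow a schwartz_fourier_adjoint \<psi>)
  have smF: "smooth_fun (fourier_adjoint \<psi>)" by (rule smooth_fourier_adjoint[OF \<psi>])

  have vP: "v (\<lambda>x. a x * P i x) = (\<integral>\<xi>. cnj (\<psi> \<xi>) * ?G (F i \<xi>) \<partial>lborel)" for i
  proof -
    have "v (\<lambda>x. a x * P i x) = (\<Sum>y\<in>range (F i). cnj (c i y) * ?G y)"
      unfolding aP dist_fourier_def by (rule tempered_sum[OF v]) (rule schwartz_mult_cis[OF a])
    also have "\<dots> = (\<Sum>y\<in>range (F i). (\<integral>\<xi>. cnj (\<psi> \<xi>) * indicator (F i -` {y}) \<xi> \<partial>lborel) * ?G y)"
      unfolding c_def Bochner_Integration.integral_cnj[symmetric]
      by (intro sum.cong refl arg_cong2[where f = "(*)"] Bochner_Integration.integral_cong) (auto simp: indicator_def)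
    also have "\<dots> = (\<integral>\<xi>. cnj (\<psi> \<xi>) * ?G (F i \<xi>) \<partial>lborel)"
      using integral_simple_compose(1)[OF F(1), of "\<lambda>\<xi>. cnj (\<psi> \<xi>)"] int\<psi> by simp
    finally show ?thesis .
  qed
  have lim1: "(\<lambda>i. v (\<lambda>x. a x * P i x)) \<longlonglongrightarrow> (\<integral>\<xi>. cnj (\<psi> \<xi>) * ?G \<xi> \<partial>lborel)"
  proof -
    obtain C N where C: "0 \<le> C" "\<And>\<xi>. cmod (?G \<xi>) \<le> C * japanese \<xi> ^ N"
      using dist_fourier_bound[OF v a] by blast
    show ?thesis unfolding vP
    proof (rule integral_dominated_convergence)
      show "integrable lborel (\<lambda>\<xi>. C * 2 ^ N * (japanese \<xi> ^ N * cmod (\<psi> \<xi>)))"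
        by (intro integrable_mult_right integrable_weight_schwartz \<psi>)
      show "AE \<xi> in lborel. (\<lambda>i. cnj (\<psi> \<xi>) * ?G (F i \<xi>)) \<longlonglongrightarrow> cnj (\<psi> \<xi>) * ?G \<xi>"
        by (intro AE_I2 tendsto_mult tendsto_const isCont_tendsto_compose[OF G_cont F(2)])
      show "AE \<xi> in lborel. norm (cnj (\<psi> \<xi>) * ?G (F i \<xi>)) \<le> C * 2 ^ N * (japanese \<xi> ^ N * cmod (\<psi> \<xi>))" for i
      proof (rule AE_I2)
        fix \<xi>
        have "cmod (?G (F i \<xi>)) \<le> C * (2 ^ N * japanese \<xi> ^ N)"
          by (rule order_trans[OF C(2) mult_left_mono[OF jF C(1)]])
        then have "cmod (\<psi> \<xi>) * cmod (?G (F i \<xi>)) \<le> cmod (\<psi> \<xi>) * (C * (2 ^ N * japanese \<xi> ^ N))"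
          by (rule mult_left_mono) simp
        then show "norm (cnj (\<psi> \<xi>) * ?G (F i \<xi>)) \<le> C * 2 ^ N * (japanese \<xi> ^ N * cmod (\<psi> \<xi>))"
          by (simp add: norm_mult mult_ac)
      qed
    qed simp_all
  qed

  have lim2: "(\<lambda>i. v (\<lambda>x. a x * P i x)) \<longlonglongrightarrow> v (\<lambda>x. a x * fourier_adjoint \<psi> x)"
  proof -
    obtain C N where CN: "0 \<le> C" "\<And>\<phi> B. \<phi> \<in> schwartz \<Longrightarrow> (\<And>x. japanese x ^ N * jet_norm N \<phi> x \<le> B) \<Longrightarrow> cmod (v \<phi>) \<le> C * B"
      using tempered_bound[OF v] by metis
    obtain L where L: "0 < L" "\<And>f g (x::'a). smooth_fun f \<Longrightarrow> smooth_fun g \<Longrightarrow>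
         jet_norm N (\<lambda>x. f x * g x) x \<le> L * (jet_norm N f x * jet_norm N g x)"
      using jet_norm_mult_le by blast
    \<comment> \<open>The additional weight pays for the factor \<open>japanese x\<close> in
      \<open>jet_le\<close>.\<close>
    obtain A where A: "0 \<le> A" "\<And>x. japanese x ^ (N + 1) * jet_norm N a x \<le> A"
      using schwartz_bound[OF a] by metis
    define m where "m bs \<xi> = (\<Prod>b\<leftarrow>bs. \<i> * complex_of_real (b \<bullet> \<xi>))" for bs and \<xi> :: 'a
    \<comment> \<open>\<open>g\<close> is the error bound of \<open>cmod_prod_cis_diff_le\<close>
      without its weight in x. Its integral \<delta> against |\<psi>| is thus independent of x and
      tends to zero by dominated convergence.\<close>
    define g where "g i bs \<xi> = cmod (m bs \<xi> - m bs (F i \<xi>)) + japanese (F i \<xi>) ^ N * norm (\<xi> - F i \<xi>)" for i bs \<xi>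
    define \<delta> where "\<delta> i bs = (\<integral>\<xi>. cmod (\<psi> \<xi>) * g i bs \<xi> \<partial>lborel)" for i bs
    have m_cont: "isCont (m bs) \<xi>" for bs \<xi>
      unfolding m_def by (induction bs) (auto intro!: continuous_intros)
    have m_meas [measurable]: "m bs \<in> borel_measurable borel" for bs
      using m_cont by (intro borel_measurable_continuous_onI) (simp add: continuous_at_imp_continuous_on)
    have g_meas [measurable]: "g i bs \<in> borel_measurable borel" for i bs
      unfolding g_def by measurable
    have m_le: "cmod (m bs \<xi>) \<le> japanese \<xi> ^ N" if "bs \<in> multi_idx N" for bs \<xi>
    proof -
      have "cmod (m bs \<xi>) \<le> japanese \<xi> ^ length bs"
        unfolding m_def using that by (intro cmod_prod_list_le) (simp add: multi_idx_def)
      also have "\<dots> \<le> japanese \<xi> ^ N" using that by (intro japanese_power_mono) (simp add: multi_idx_def)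
      finally show ?thesis .
    qed
    have g_nonneg: "0 \<le> g i bs \<xi>" for i bs \<xi> by (simp add: g_def)
    \<comment> \<open>The terms 1 and 2 ^ N come from the two monomials; 2 ^ N * 3 comes from the
      weight at \<open>F i \<xi>\<close> and from |\<xi> - F i \<xi>| being at most 3
      |\<xi>|.\<close>
    have g_le: "g i bs \<xi> \<le> (1 + 2 ^ N + 2 ^ N * 3) * japanese \<xi> ^ (N + 1)" if bs: "bs \<in> multi_idx N" for i bs \<xi>
    proof -
      have "cmod (m bs \<xi> - m bs (F i \<xi>)) \<le> cmod (m bs \<xi>) + cmod (m bs (F i \<xi>))" by (rule norm_triangle_ineq4)
      also have "\<dots> \<le> japanese \<xi> ^ N + 2 ^ N * japanese \<xi> ^ N"
        using m_le[OF bs, of \<xi>] order_trans[OF m_le[OF bs] jF, of i \<xi>] by linarith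
      also have "\<dots> \<le> japanese \<xi> ^ (N + 1) + 2 ^ N * japanese \<xi> ^ (N + 1)"
        by (intro add_mono mult_left_mono japanese_power_mono) auto
      finally have 1: "cmod (m bs \<xi> - m bs (F i \<xi>)) \<le> japanese \<xi> ^ (N + 1) + 2 ^ N * japanese \<xi> ^ (N + 1)" .
      have "norm (\<xi> - F i \<xi>) \<le> norm \<xi> + norm (F i \<xi>)" by (rule norm_triangle_ineq4)
      then have "norm (\<xi> - F i \<xi>) \<le> 3 * japanese \<xi>" using F(3)[of i \<xi>] norm_le_japanese[of \<xi>] by linarith
      then have "japanese (F i \<xi>) ^ N * norm (\<xi> - F i \<xi>) \<le> (2 ^ N * japanese \<xi> ^ N) * (3 * japanese \<xi>)"
        by (intro mult_mono jF) auto
      then show ?thesis using 1 by (simp add: g_def algebra_simps)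
    qed
    have int_dom: "integrable lborel (\<lambda>\<xi>. (1 + 2 ^ N + 2 ^ N * 3) * (japanese \<xi> ^ (N + 1) * cmod (\<psi> \<xi>)))"
      by (intro integrable_mult_right integrable_weight_schwartz \<psi>)
    have dom: "norm (cmod (\<psi> \<xi>) * g i bs \<xi>) \<le> (1 + 2 ^ N + 2 ^ N * 3) * (japanese \<xi> ^ (N + 1) * cmod (\<psi> \<xi>))"
      if "bs \<in> multi_idx N" for i bs \<xi>
      using mult_left_mono[OF g_le[OF that], of "cmod (\<psi> \<xi>)" i \<xi>] g_nonneg[of i bs \<xi>] by (simp add: mult_ac)
    have int_g: "integrable lborel (\<lambda>\<xi>. cmod (\<psi> \<xi>) * g i bs \<xi>)" if "bs \<in> multi_idx N" for i bs
      by (rule Bochner_Integration.integrable_bound[OF int_dom])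
         (use order_trans[OF dom[OF that] abs_ge_self] in \<open>auto simp flip: real_norm_def\<close>)
    have \<delta>_lim: "(\<lambda>i. \<delta> i bs) \<longlonglongrightarrow> 0" if bs: "bs \<in> multi_idx N" for bs
    proof -
      have "(\<lambda>i. \<delta> i bs) \<longlonglongrightarrow> (\<integral>\<xi>. 0 \<partial>(lborel :: 'a measure))"
        unfolding \<delta>_def
      proof (rule integral_dominated_convergence[OF _ _ int_dom])
        show "AE \<xi> in lborel. (\<lambda>i. cmod (\<psi> \<xi>) * g i bs \<xi>) \<longlonglongrightarrow> 0"
        proof (rule AE_I2)
          fix \<xi>
          have "(\<lambda>i. cmod (\<psi> \<xi>) * (cmod (m bs \<xi> - m bs (F i \<xi>)) + japanese (F i \<xi>) ^ N * norm (\<xi> - F i \<xi>))) \<longlonglongrightarrow>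
              cmod (\<psi> \<xi>) * (cmod (m bs \<xi> - m bs \<xi>) + japanese \<xi> ^ N * norm (\<xi> - \<xi>))"
            unfolding japanese_def
            by (intro tendsto_intros isCont_tendsto_compose[OF m_cont] F(2))
          then show "(\<lambda>i. cmod (\<psi> \<xi>) * g i bs \<xi>) \<longlonglongrightarrow> 0" by (simp add: g_def)
        qed
        show "AE \<xi> in lborel. norm (cmod (\<psi> \<xi>) * g i bs \<xi>) \<le> (1 + 2 ^ N + 2 ^ N * 3) * (japanese \<xi> ^ (N + 1) * cmod (\<psi> \<xi>))" for i
          using dom[OF bs] by (intro AE_I2)
      qed simp_all
      then show ?thesis by simp
    qed
    have jet_le: "jet_norm N (\<lambda>x. fourier_adjoint \<psi> x - P i x) x \<le> japanese x * (\<Sum>bs\<in>multi_idx N. \<delta> i bs)" for i x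
    proof -
      have "cmod (iter_deriv bs (\<lambda>x. fourier_adjoint \<psi> x - P i x) x) \<le> japanese x * \<delta> i bs"
        if bs: "bs \<in> multi_idx N" for bs
      proof -
        have B: "set bs \<subseteq> Basis" using bs by (simp add: multi_idx_def)
        have "iter_deriv bs (P i) x = (\<Sum>y\<in>range (F i). c i y * (m bs y * cis (x \<bullet> y)))"
          unfolding P_def using B by (simp add: iter_deriv_sum iter_deriv_cmult smooth_fun_cmult iter_deriv_cis m_def)
        also have "\<dots> = (\<integral>\<xi>. \<psi> \<xi> * (m bs (F i \<xi>) * cis (x \<bullet> F i \<xi>)) \<partial>lborel)"
          unfolding c_def
          by (rule integral_simple_compose(1)[OF F(1) int\<psi>, of "\<lambda>y. m bs y * cis (x \<bullet> y)", symmetric])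
        finally have iP: "iter_deriv bs (P i) x = (\<integral>\<xi>. \<psi> \<xi> * (m bs (F i \<xi>) * cis (x \<bullet> F i \<xi>)) \<partial>lborel)" .
        have iF: "iter_deriv bs (fourier_adjoint \<psi>) x = (\<integral>\<xi>. \<psi> \<xi> * (m bs \<xi> * cis (x \<bullet> \<xi>)) \<partial>lborel)"
          by (simp add: iter_deriv_fourier_adjoint[OF \<psi>] fourier_adjoint_def m_def mult_ac)
        have i1: "integrable lborel (\<lambda>\<xi>. \<psi> \<xi> * (m bs \<xi> * cis (x \<bullet> \<xi>)))"
          using integrable_cis_mult[OF integrable_schwartz[OF schwartz_prod_mult[OF \<psi>, of bs]], of x]
          by (simp add: m_def mult_ac)
        have i2: "integrable lborel (\<lambda>\<xi>. \<psi> \<xi> * (m bs (F i \<xi>) * cis (x \<bullet> F i \<xi>)))"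
          by (rule integral_simple_compose(2)[OF F(1) int\<psi>])
        have "iter_deriv bs (\<lambda>x. fourier_adjoint \<psi> x - P i x) x =
            (\<integral>\<xi>. \<psi> \<xi> * (m bs \<xi> * cis (x \<bullet> \<xi>)) - \<psi> \<xi> * (m bs (F i \<xi>) * cis (x \<bullet> F i \<xi>)) \<partial>lborel)"
          using B i1 i2 by (simp add: iter_deriv_diff smF smP iP iF)
        also have "cmod \<dots> \<le> (\<integral>\<xi>. japanese x * (cmod (\<psi> \<xi>) * g i bs \<xi>) \<partial>lborel)"
        proof (rule integral_norm_le)
          show "integrable lborel (\<lambda>\<xi>. japanese x * (cmod (\<psi> \<xi>) * g i bs \<xi>))"
            by (intro integrable_mult_right int_g bs)
          fix \<xi>
          have "cmod (m bs \<xi> * cis (x \<bullet> \<xi>) - m bs (F i \<xi>) * cis (x \<bullet> F i \<xi>)) \<le> japanese x * g i bs \<xi>"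
            unfolding g_def m_def by (rule cmod_prod_cis_diff_le[OF bs])
          then have "cmod (\<psi> \<xi>) * cmod (m bs \<xi> * cis (x \<bullet> \<xi>) - m bs (F i \<xi>) * cis (x \<bullet> F i \<xi>)) \<le> cmod (\<psi> \<xi>) * (japanese x * g i bs \<xi>)"
            by (rule mult_left_mono) simp
          then show "cmod (\<psi> \<xi> * (m bs \<xi> * cis (x \<bullet> \<xi>)) - \<psi> \<xi> * (m bs (F i \<xi>) * cis (x \<bullet> F i \<xi>))) \<le> japanese x * (cmod (\<psi> \<xi>) * g i bs \<xi>)"
            unfolding right_diff_distrib[symmetric] norm_mult by (simp add: mult_ac)
        qed
        also have "\<dots> = japanese x * \<delta> i bs" by (simp add: \<delta>_def)
        finally show ?thesis .
      qed
      then show ?thesis unfolding jet_norm_def sum_distrib_left by (intro sum_mono)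
    qed
    have diff: "cmod (v (\<lambda>x. a x * P i x) - v (\<lambda>x. a x * fourier_adjoint \<psi> x)) \<le> C * (L * (A * (\<Sum>bs\<in>multi_idx N. \<delta> i bs)))" for i
    proof -
      let ?\<Delta> = "\<Sum>bs\<in>multi_idx N. \<delta> i bs"
      have \<Delta>: "0 \<le> ?\<Delta>" unfolding \<delta>_def by (intro sum_nonneg integral_nonneg_AE AE_I2) (simp add: g_nonneg)
      have "v (\<lambda>x. a x * fourier_adjoint \<psi> x) - v (\<lambda>x. a x * P i x) = v (\<lambda>x. a x * (fourier_adjoint \<psi> x - P i x))"
        using tempered_diff[OF v aF_S aP_S] by (simp add: right_diff_distrib)
      also have "cmod \<dots> \<le> C * (L * (A * ?\<Delta>))"
      proof (rule CN(2))
        show "(\<lambda>x. a x * (fourier_adjoint \<psi> x - P i x)) \<in> schwartz"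
          using schwartz_diff[OF aF_S aP_S] by (simp add: right_diff_distrib)
        fix x
        have "japanese x ^ N * jet_norm N (\<lambda>x. a x * (fourier_adjoint \<psi> x - P i x)) x \<le>
            japanese x ^ N * (L * (jet_norm N a x * jet_norm N (\<lambda>x. fourier_adjoint \<psi> x - P i x) x))"
          by (intro mult_left_mono L(2) schwartz_smooth a smooth_fun_diff smF smP) auto
        also have "\<dots> \<le> japanese x ^ N * (L * (jet_norm N a x * (japanese x * ?\<Delta>)))"
          using L(1) by (intro mult_left_mono jet_le) auto
        also have "\<dots> = L * (japanese x ^ (N + 1) * jet_norm N a x * ?\<Delta>)"
          by (simp add: mult_ac)
        also have "\<dots> \<le> L * (A * ?\<Delta>)" using L(1) \<Delta> by (intro mult_left_mono mult_right_mono A(2)) auto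
        finally show "japanese x ^ N * jet_norm N (\<lambda>x. a x * (fourier_adjoint \<psi> x - P i x)) x \<le> L * (A * ?\<Delta>)" .
      qed
      finally show ?thesis by (simp add: norm_minus_commute)
    qed
    have "(\<lambda>i. C * (L * (A * (\<Sum>bs\<in>multi_idx N. \<delta> i bs)))) \<longlonglongrightarrow> C * (L * (A * (\<Sum>bs\<in>(multi_idx N :: 'a list set). 0)))"
      by (intro tendsto_intros \<delta>_lim)
    then have "(\<lambda>i. C * (L * (A * (\<Sum>bs\<in>multi_idx N. \<delta> i bs)))) \<longlonglongrightarrow> 0" by simp
    from Lim_null_comparison[OF always_eventually[OF allI[OF diff]] this]
    show ?thesis by (simp add: LIM_zero_iff)
  qed
  show ?thesis using LIMSEQ_unique[OF lim2 lim1] by (simp add: mult.commute)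
qed

text \<open>Growth of \<open>G\<close> is recorded in addition to the defining property of
  \<open>fourier_fun\<close>: it makes the pairings with Schwartz functions integrable and enters
  the convolution estimate.\<close>

definition fourier_rep :: "(('a::euclidean_space \<Rightarrow> complex) \<Rightarrow> complex) \<Rightarrow> ('a \<Rightarrow> complex) \<Rightarrow> bool" where
  "fourier_rep u G \<longleftrightarrow> smooth_fun G \<and> (\<exists>C N. \<forall>\<xi>. cmod (G \<xi>) \<le> C * japanese \<xi> ^ N) \<and>
     (\<forall>\<psi>\<in>schwartz. u (fourier_adjoint \<psi>) = fun_dist G \<psi>)"

lemma fourier_rep_bound:
  assumes "fourier_rep u G"
  obtains C N where "0 \<le> C" "\<And>\<xi>. cmod (G \<xi>) \<le> C * japanese \<xi> ^ N"
proof -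
  obtain C N where C: "\<And>\<xi>. cmod (G \<xi>) \<le> C * japanese \<xi> ^ N" using assms by (auto simp: fourier_rep_def)
  have "0 \<le> C" using order_trans[OF norm_ge_zero C[of 0]] by (simp add: japanese_def)
  then show ?thesis using that C by blast
qed

lemma fourier_rep_smooth: "fourier_rep u G \<Longrightarrow> smooth_fun G"
  and fourier_rep_eq: "fourier_rep u G \<Longrightarrow> \<psi> \<in> schwartz \<Longrightarrow> u (fourier_adjoint \<psi>) = fun_dist G \<psi>"
  by (auto simp: fourier_rep_def)

lemma fourier_rep_measurable: "fourier_rep u G \<Longrightarrow> G \<in> borel_measurable borel"
  by (simp add: fourier_rep_smooth smooth_fun_measurable)

lemma fourier_rep_integrable:
  "fourier_rep u G \<Longrightarrow> \<psi> \<in> schwartz \<Longrightarrow> integrable lborel (\<lambda>\<xi>. G \<xi> * \<psi> \<xi>)"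
  by (metis fourier_rep_bound fourier_rep_measurable integrable_mult_schwartz)

lemma fourier_rep_localized:
  assumes "v \<in> tempered" "a \<in> schwartz"
  shows "fourier_rep (\<lambda>\<psi>. v (\<lambda>x. a x * \<psi> x)) (dist_fourier v a)"
  unfolding fourier_rep_def fun_dist_def
  using smooth_dist_fourier[OF assms] dist_fourier_bound[OF assms] tempered_fourier_adjoint[OF assms] by metis

lemma fourier_rep_add:
  assumes "fourier_rep v G" "fourier_rep w H" "\<And>\<psi>. \<psi> \<in> schwartz \<Longrightarrow> u \<psi> = v \<psi> + w \<psi>"
  shows "fourier_rep u (\<lambda>\<xi>. G \<xi> + H \<xi>)"
  unfolding fourier_rep_def
proof (intro conjI ballI)
  show "smooth_fun (\<lambda>\<xi>. G \<xi> + H \<xi>)" by (intro smooth_fun_add fourier_rep_smooth[OF assms(1)] fourier_rep_smooth[OF assms(2)])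
  obtain A M where A: "0 \<le> A" "\<And>\<xi>. cmod (G \<xi>) \<le> A * japanese \<xi> ^ M" using fourier_rep_bound[OF assms(1)] by metis
  obtain B N where B: "0 \<le> B" "\<And>\<xi>. cmod (H \<xi>) \<le> B * japanese \<xi> ^ N" using fourier_rep_bound[OF assms(2)] by metis
  have "cmod (G \<xi> + H \<xi>) \<le> (A + B) * japanese \<xi> ^ (M + N)" for \<xi>
  proof -
    have "cmod (G \<xi> + H \<xi>) \<le> A * japanese \<xi> ^ M + B * japanese \<xi> ^ N"
      using norm_triangle_ineq[of "G \<xi>" "H \<xi>"] A(2)[of \<xi>] B(2)[of \<xi>] by linarith
    also have "\<dots> \<le> A * japanese \<xi> ^ (M + N) + B * japanese \<xi> ^ (M + N)"
      using A(1) B(1) by (intro add_mono mult_left_mono japanese_power_mono) auto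
    finally show ?thesis by (simp add: distrib_right)
  qed
  then show "\<exists>C N. \<forall>\<xi>. cmod (G \<xi> + H \<xi>) \<le> C * japanese \<xi> ^ N" by blast
  fix \<psi> :: "'a \<Rightarrow> complex" assume \<psi>: "\<psi> \<in> schwartz"
  have "u (fourier_adjoint \<psi>) = fun_dist G \<psi> + fun_dist H \<psi>"
    using assms(3)[OF schwartz_fourier_adjoint[OF \<psi>]] fourier_rep_eq[OF assms(1) \<psi>] fourier_rep_eq[OF assms(2) \<psi>] by simp
  also have "\<dots> = fun_dist (\<lambda>\<xi>. G \<xi> + H \<xi>) \<psi>"
    using fourier_rep_integrable[OF assms(1) schwartz_cnj[OF \<psi>]] fourier_rep_integrable[OF assms(2) schwartz_cnj[OF \<psi>]]
    by (simp add: fun_dist_def distrib_right)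
  finally show "u (fourier_adjoint \<psi>) = fun_dist (\<lambda>\<xi>. G \<xi> + H \<xi>) \<psi>" .
qed

lemma fourier_adjoint_cnj: "fourier_adjoint (\<lambda>x. cnj (f x)) \<xi> = cnj (fourier_adjoint f (- \<xi>))"
proof -
  have "fourier_adjoint (\<lambda>x. cnj (f x)) \<xi> = (\<integral>x. cnj (f x * cis (- \<xi> \<bullet> x)) \<partial>lborel)"
    by (simp add: fourier_adjoint_def cis_cnj)
  also have "\<dots> = cnj (fourier_adjoint f (- \<xi>))"
    unfolding fourier_adjoint_def by (rule Bochner_Integration.integral_cnj)
  finally show ?thesis .
qed

text \<open>\<open>fourier_adjoint f (- \<xi>)\<close> is the Fourier integral of \<open>f\<close>;
  after conjugation the pairing identity is the exchange of transforms by Fubini.\<close>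

lemma fourier_rep_schwartz:
  assumes f: "f \<in> schwartz"
  shows "fourier_rep (fun_dist f) (\<lambda>\<xi>. fourier_adjoint f (- \<xi>))"
  unfolding fourier_rep_def
proof (intro conjI ballI)
  note S = schwartz_reflect[OF schwartz_fourier_adjoint[OF f]]
  show "smooth_fun (\<lambda>\<xi>. fourier_adjoint f (- \<xi>))" by (rule schwartz_smooth[OF S])
  obtain C where "\<And>x. japanese x ^ 0 * cmod (fourier_adjoint f (- x)) \<le> C"
    using schwartz_bound_cmod[OF S] by metis
  then show "\<exists>C N. \<forall>\<xi>. cmod (fourier_adjoint f (- \<xi>)) \<le> C * japanese \<xi> ^ N"
    by (intro exI[of _ C] exI[of _ 0]) simp
  fix \<psi> :: "'a \<Rightarrow> complex" assume \<psi>: "\<psi> \<in> schwartz"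
  have "fun_dist f (fourier_adjoint \<psi>) = (\<integral>x. cnj (fourier_adjoint \<psi> x * cnj (f x)) \<partial>lborel)"
    by (simp add: fun_dist_def mult.commute)
  also have "\<dots> = cnj (\<integral>x. fourier_adjoint \<psi> x * cnj (f x) \<partial>lborel)"
    by (rule Bochner_Integration.integral_cnj)
  also have "\<dots> = cnj (\<integral>\<xi>. \<psi> \<xi> * cnj (fourier_adjoint f (- \<xi>)) \<partial>lborel)"
    by (simp add: integral_fourier_adjoint_mult integrable_schwartz \<psi> schwartz_cnj f fourier_adjoint_cnj)
  also have "\<dots> = (\<integral>\<xi>. cnj (\<psi> \<xi> * cnj (fourier_adjoint f (- \<xi>))) \<partial>lborel)"
    by (rule Bochner_Integration.integral_cnj[symmetric])
  finally show "fun_dist f (fourier_adjoint \<psi>) = fun_dist (\<lambda>\<xi>. fourier_adjoint f (- \<xi>)) \<psi>"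
    by (simp add: fun_dist_def mult.commute)
qed

text \<open>Uniqueness: test the difference against itself times a bump function.\<close>

lemma fun_dist_eq_imp_eq:
  fixes g h :: "'a::euclidean_space \<Rightarrow> complex"
  assumes g: "smooth_fun g" and h: "smooth_fun h"
    and int: "\<And>\<phi>. \<phi> \<in> schwartz \<Longrightarrow> integrable lborel (\<lambda>\<xi>. g \<xi> * cnj (\<phi> \<xi>))"
      "\<And>\<phi>. \<phi> \<in> schwartz \<Longrightarrow> integrable lborel (\<lambda>\<xi>. h \<xi> * cnj (\<phi> \<xi>))"
    and eq: "\<And>\<phi>. \<phi> \<in> schwartz \<Longrightarrow> fun_dist g \<phi> = fun_dist h \<phi>"
  shows "g = h"
proof
  fix p :: 'a
  obtain \<beta> where \<beta>: "(\<lambda>y. complex_of_real (\<beta> y)) \<in> test_functions" "\<And>y. 0 \<le> \<beta> y" "\<And>y. \<beta> y \<noteq> 0 \<longleftrightarrow> dist p y < 1"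
    by (rule bump_exists[OF zero_less_one, of p]) blast
  let ?d = "\<lambda>x. g x - h x"
  have smd: "smooth_fun ?d" by (rule smooth_fun_diff[OF g h])
  let ?\<phi> = "\<lambda>x. complex_of_real (\<beta> x) * ?d x"
  have \<phi>: "?\<phi> \<in> schwartz" by (rule test_functions_schwartz[OF test_functions_mult(1)[OF \<beta>(1) smd]])
  have e: "?d x * cnj (?\<phi> x) = complex_of_real (\<beta> x * (cmod (?d x))\<^sup>2)" for x
  proof -
    have "?d x * cnj (?\<phi> x) = complex_of_real (\<beta> x) * (?d x * cnj (?d x))" by (simp add: algebra_simps)
    also have "\<dots> = complex_of_real (\<beta> x * (cmod (?d x))\<^sup>2)" by (simp only: complex_norm_square[symmetric] of_real_mult)
    finally show ?thesis .
  qed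
  have i: "integrable lborel (\<lambda>x. ?d x * cnj (?\<phi> x))"
    unfolding left_diff_distrib by (rule Bochner_Integration.integrable_diff[OF int[OF \<phi>, unfolded left_diff_distrib]])
  have "(\<integral>x. ?d x * cnj (?\<phi> x) \<partial>lborel) = (\<integral>x. g x * cnj (?\<phi> x) - h x * cnj (?\<phi> x) \<partial>lborel)"
    by (simp add: left_diff_distrib)
  also have "\<dots> = fun_dist g ?\<phi> - fun_dist h ?\<phi>"
    unfolding fun_dist_def by (rule Bochner_Integration.integral_diff[OF int[OF \<phi>]])
  finally have "complex_of_real (\<integral>x. \<beta> x * (cmod (?d x))\<^sup>2 \<partial>lborel) = 0"
    unfolding e integral_complex_of_real using eq[OF \<phi>] by simp
  then have I: "(\<integral>x. \<beta> x * (cmod (?d x))\<^sup>2 \<partial>lborel) = 0" by simp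
  have i': "integrable lborel (\<lambda>x. \<beta> x * (cmod (?d x))\<^sup>2)"
    using integrable_Re[OF i] unfolding e by simp
  have "continuous_on UNIV (\<lambda>x. Re (?d x * cnj (?\<phi> x)))"
    using \<phi> smd by (intro continuous_intros schwartz_continuous smooth_fun_continuous_on)
  then have "continuous_on UNIV (\<lambda>x. \<beta> x * (cmod (?d x))\<^sup>2)" unfolding e by simp
  from integral_zero_imp_zero[OF this _ i' I, of p] \<beta>(2)
  have "\<beta> p * (cmod (?d p))\<^sup>2 = 0" by simp
  then show "g p = h p" using \<beta>(3)[of p] by simp
qed

lemma fourier_fun_eq:
  assumes "fourier_rep u G" shows "fourier_fun u = G"
  unfolding fourier_fun_def fourier_dist_def
proof (rule the_equality)
  show *: "smooth_fun G \<and> (\<forall>\<phi>\<in>schwartz. integrable lborel (\<lambda>\<xi>. G \<xi> * cnj (\<phi> \<xi>)) \<and> u (fourier_adjoint \<phi>) = fun_dist G \<phi>)"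
    using assms fourier_rep_smooth fourier_rep_eq fourier_rep_integrable schwartz_cnj by blast
  fix g assume "smooth_fun g \<and> (\<forall>\<phi>\<in>schwartz. integrable lborel (\<lambda>\<xi>. g \<xi> * cnj (\<phi> \<xi>)) \<and> u (fourier_adjoint \<phi>) = fun_dist g \<phi>)"
  then show "g = G" using * by (intro fun_dist_eq_imp_eq) auto
qed

lemma fourier_adjoint_modulate_translate:
  assumes "\<phi> \<in> schwartz"
  shows "fourier_adjoint (modulate \<xi> (translate x \<phi>)) (- \<tau>) = cis (x \<bullet> (\<xi> - \<tau>)) * fourier_adjoint \<phi> (\<xi> - \<tau>)"
proof -
  let ?f = "\<lambda>y. modulate \<xi> (translate x \<phi>) y * cis (- \<tau> \<bullet> y)"
  have "?f \<in> borel_measurable borel"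
    using schwartz_measurable[OF schwartz_modulate[OF schwartz_translate[OF assms]], of \<xi> x] by (simp add: cis_conv_exp)
  then have "fourier_adjoint (modulate \<xi> (translate x \<phi>)) (- \<tau>) = (\<integral>z. ?f (z + x) \<partial>lborel)"
    unfolding fourier_adjoint_def by (rule integral_lborel_translate[symmetric])
  also have "?f = (\<lambda>y. \<phi> (y - x) * cis ((\<xi> - \<tau>) \<bullet> y))"
    by (simp add: modulate_def translate_def cis_mult inner_diff_left inner_diff_right inner_commute mult_ac fun_eq_iff)
  also have "(\<integral>z. \<phi> (z + x - x) * cis ((\<xi> - \<tau>) \<bullet> (z + x)) \<partial>lborel) =
      (\<integral>z. cis (x \<bullet> (\<xi> - \<tau>)) * (\<phi> z * cis ((\<xi> - \<tau>) \<bullet> z)) \<partial>lborel)"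
    by (simp add: inner_add_right inner_commute mult_ac flip: cis_mult)
  finally show ?thesis by (simp add: fourier_adjoint_def)
qed

text \<open>Comparing moduli removes the phase depending on x and \<xi>. The remaining constant,
  from Fourier inversion, is the same for all distributions and windows.\<close>

lemma stft_fourier_rep:
  obtains c :: complex where "c \<noteq> 0"
    "\<And>u G (\<phi> :: 'a::euclidean_space \<Rightarrow> complex) x \<xi>. fourier_rep u G \<Longrightarrow> \<phi> \<in> schwartz \<Longrightarrow>
       cmod (stft \<phi> u (x, \<xi>)) = cmod c * cmod (fourier_adjoint (\<lambda>\<tau>. G \<tau> * cnj (fourier_adjoint \<phi> (\<xi> - \<tau>))) x)"
proof -
  obtain c :: complex where c: "c \<noteq> 0"
    "\<And>\<phi> :: 'a::euclidean_space \<Rightarrow> complex. \<phi> \<in> schwartz \<Longrightarrow> \<phi> = fourier_adjoint (\<lambda>\<xi>. c * fourier_adjoint \<phi> (- \<xi>))"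
    using schwartz_eq_fourier_adjoint by blast
  show ?thesis
  proof (rule that[of "cnj c"])
    fix u :: "('a \<Rightarrow> complex) \<Rightarrow> complex" and G \<phi> :: "'a \<Rightarrow> complex" and x \<xi> :: 'a
    assume G: "fourier_rep u G" and \<phi>: "\<phi> \<in> schwartz"
    let ?\<theta> = "modulate \<xi> (translate x \<phi>)"
    have \<theta>: "?\<theta> \<in> schwartz" by (intro schwartz_modulate schwartz_translate \<phi>)
    have "stft \<phi> u (x, \<xi>) = u (fourier_adjoint (\<lambda>\<tau>. c * fourier_adjoint ?\<theta> (- \<tau>)))"
      unfolding stft_def by (simp flip: c(2)[OF \<theta>])
    also have "\<dots> = fun_dist G (\<lambda>\<tau>. c * fourier_adjoint ?\<theta> (- \<tau>))"
      by (rule fourier_rep_eq[OF G schwartz_cmult[OF schwartz_reflect[OF schwartz_fourier_adjoint[OF \<theta>]]]])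
    also have "\<dots> = (\<integral>\<tau>. cnj c * cis (- (x \<bullet> \<xi>)) * (G \<tau> * cnj (fourier_adjoint \<phi> (\<xi> - \<tau>)) * cis (x \<bullet> \<tau>)) \<partial>lborel)"
      unfolding fun_dist_def fourier_adjoint_modulate_translate[OF \<phi>]
      by (intro Bochner_Integration.integral_cong refl) (simp add: cis_cnj inner_diff_right cis_mult mult_ac)
    finally show "cmod (stft \<phi> u (x, \<xi>)) =
        cmod (cnj c) * cmod (fourier_adjoint (\<lambda>\<tau>. G \<tau> * cnj (fourier_adjoint \<phi> (\<xi> - \<tau>))) x)"
      by (simp add: fourier_adjoint_def norm_mult)
  qed (use c in simp)
qed

section \<open>Cones\<close>

text \<open>The condition that the unit vectors of \<xi> and \<eta> are less than \<delta> apart,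
  cleared of denominators. In this form openness is immediate, and the strict inequality excludes
  \<xi> = 0.\<close>

definition cone_nbhd :: "'b::real_normed_vector \<Rightarrow> real \<Rightarrow> 'b set" where
  "cone_nbhd \<eta> \<delta> = {\<xi>. norm (norm \<eta> *\<^sub>R \<xi> - norm \<xi> *\<^sub>R \<eta>) < \<delta> * norm \<xi> * norm \<eta>}"

lemma open_cone_nbhd: "open (cone_nbhd \<eta> \<delta>)"
  unfolding cone_nbhd_def by (intro open_Collect_less continuous_intros)

lemma pos_conic_cone_nbhd: "pos_conic (cone_nbhd \<eta> \<delta>)"
  unfolding pos_conic_def
proof (intro ballI allI impI)
  fix \<xi> and t :: real assume \<xi>: "\<xi> \<in> cone_nbhd \<eta> \<delta>" and t: "0 < t"
  have "norm \<eta> *\<^sub>R t *\<^sub>R \<xi> - norm (t *\<^sub>R \<xi>) *\<^sub>R \<eta> = t *\<^sub>R (norm \<eta> *\<^sub>R \<xi> - norm \<xi> *\<^sub>R \<eta>)"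
    using t by (simp add: scaleR_diff_right mult.commute)
  then have "norm (norm \<eta> *\<^sub>R t *\<^sub>R \<xi> - norm (t *\<^sub>R \<xi>) *\<^sub>R \<eta>) = t * norm (norm \<eta> *\<^sub>R \<xi> - norm \<xi> *\<^sub>R \<eta>)"
    using t by simp
  also have "\<dots> < t * (\<delta> * norm \<xi> * norm \<eta>)" using \<xi> t by (simp add: cone_nbhd_def)
  finally show "t *\<^sub>R \<xi> \<in> cone_nbhd \<eta> \<delta>" using t by (simp add: cone_nbhd_def mult_ac)
qed

lemma zero_notin_cone_nbhd: "0 \<notin> cone_nbhd \<eta> \<delta>"
  by (simp add: cone_nbhd_def)

lemma self_in_cone_nbhd: "\<eta> \<noteq> 0 \<Longrightarrow> 0 < \<delta> \<Longrightarrow> \<eta> \<in> cone_nbhd \<eta> \<delta>"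
  by (simp add: cone_nbhd_def)

lemma cone_nbhd_scaled:
  assumes "\<xi> \<in> cone_nbhd \<eta> \<delta>"
  shows "norm ((norm \<eta> / norm \<xi>) *\<^sub>R \<xi> - \<eta>) < \<delta> * norm \<eta>"
proof -
  have \<xi>: "0 < norm \<xi>" using assms zero_notin_cone_nbhd by fastforce
  have "(norm \<eta> / norm \<xi>) *\<^sub>R \<xi> - \<eta> = (1 / norm \<xi>) *\<^sub>R (norm \<eta> *\<^sub>R \<xi> - norm \<xi> *\<^sub>R \<eta>)"
    using \<xi> by (simp add: scaleR_diff_right)
  then have "norm ((norm \<eta> / norm \<xi>) *\<^sub>R \<xi> - \<eta>) = norm (norm \<eta> *\<^sub>R \<xi> - norm \<xi> *\<^sub>R \<eta>) / norm \<xi>"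
    using \<xi> by simp
  also have "\<dots> < \<delta> * norm \<eta>" using assms \<xi> by (simp add: cone_nbhd_def pos_divide_less_eq mult_ac)
  finally show ?thesis .
qed

text \<open>Rescale \<xi> to the length of \<eta>. The angular deviation and the perturbation each
  contribute at most \<delta> |\<eta>|, together less than the radius r of a ball in \<Gamma>,
  whence r / (2 |\<eta>|) in the choice of \<delta>. Perturbations are allowed in proportion to
  |\<xi>|, so a point outside \<Gamma> has a distance from \<xi> comparable to |\<xi>|.\<close>

lemma cone_nbhd_subset:
  fixes \<Gamma> :: "'b::real_normed_vector set"
  assumes \<Gamma>: "open \<Gamma>" "pos_conic \<Gamma>" "\<eta> \<in> \<Gamma>" and \<eta>: "\<eta> \<noteq> 0"
  obtains \<delta> where "0 < \<delta>" "\<delta> \<le> 1"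
    "\<And>\<xi> \<tau>. \<xi> \<in> cone_nbhd \<eta> \<delta> \<Longrightarrow> norm (\<tau> - \<xi>) \<le> \<delta> * norm \<xi> \<Longrightarrow> \<tau> \<in> \<Gamma>"
proof -
  obtain r where r: "0 < r" "ball \<eta> r \<subseteq> \<Gamma>" using \<Gamma>(1,3) open_contains_ball by blast
  define \<delta> where "\<delta> = min 1 (r / (2 * norm \<eta>))"
  have \<delta>: "0 < \<delta>" "\<delta> \<le> 1" using r \<eta> by (auto simp: \<delta>_def)
  have "\<delta> \<le> r / (2 * norm \<eta>)" by (simp add: \<delta>_def)
  then have \<delta>r: "2 * \<delta> * norm \<eta> \<le> r" using \<eta> by (simp add: pos_le_divide_eq mult_ac)
  have "\<tau> \<in> \<Gamma>" if \<xi>: "\<xi> \<in> cone_nbhd \<eta> \<delta>" and \<tau>: "norm (\<tau> - \<xi>) \<le> \<delta> * norm \<xi>" for \<xi> \<tau>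
  proof -
    have \<xi>0: "0 < norm \<xi>" using \<xi> zero_notin_cone_nbhd by fastforce
    let ?s = "norm \<eta> / norm \<xi>"
    have s: "0 < ?s" using \<xi>0 \<eta> by simp
    have "norm (?s *\<^sub>R (\<tau> - \<xi>)) \<le> \<delta> * norm \<eta>"
      using mult_left_mono[OF \<tau>, of ?s] \<xi>0 by (simp add: mult_ac)
    moreover have eq: "?s *\<^sub>R (\<tau> - \<xi>) + (?s *\<^sub>R \<xi> - \<eta>) = ?s *\<^sub>R \<tau> - \<eta>"
      unfolding scaleR_diff_right by simp
    ultimately have "norm (?s *\<^sub>R \<tau> - \<eta>) < r"
      using norm_triangle_ineq[of "?s *\<^sub>R (\<tau> - \<xi>)" "?s *\<^sub>R \<xi> - \<eta>"] cone_nbhd_scaled[OF \<xi>] \<delta>r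
      unfolding eq by linarith
    then have "?s *\<^sub>R \<tau> \<in> \<Gamma>" using r(2) by (auto simp: dist_norm norm_minus_commute)
    then have "(1 / ?s) *\<^sub>R ?s *\<^sub>R \<tau> \<in> \<Gamma>" using \<Gamma>(2) s unfolding pos_conic_def by (metis zero_less_divide_1_iff)
    moreover have "(1 / ?s) *\<^sub>R ?s *\<^sub>R \<tau> = \<tau>" unfolding scaleR_scaleR using \<xi>0 \<eta> by simp
    ultimately show ?thesis by simp
  qed
  then show ?thesis using that \<delta> by blast
qed

text \<open>In phase space a small component x is a perturbation of (0, \<xi>) relative to its
  length.\<close>

lemma cone_nbhd_subset_prod:
  fixes \<Gamma> :: "('b::real_normed_vector \<times> 'b) set"
  assumes \<Gamma>: "open \<Gamma>" "pos_conic \<Gamma>" "(0, \<eta>) \<in> \<Gamma>" and \<eta>: "\<eta> \<noteq> 0"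
  obtains \<delta> where "0 < \<delta>" "\<delta> \<le> 1"
    "\<And>x \<xi>. \<xi> \<in> cone_nbhd \<eta> \<delta> \<Longrightarrow> norm x \<le> \<delta> * norm \<xi> \<Longrightarrow> (x, \<xi>) \<in> \<Gamma>"
proof -
  have "(0, \<eta>) \<noteq> (0 :: 'b \<times> 'b)" using \<eta> by (simp add: zero_prod_def)
  from cone_nbhd_subset[OF \<Gamma> this] obtain \<delta> where \<delta>: "0 < \<delta>" "\<delta> \<le> 1"
    "\<And>\<xi> \<tau>. \<xi> \<in> cone_nbhd (0, \<eta>) \<delta> \<Longrightarrow> norm (\<tau> - \<xi>) \<le> \<delta> * norm \<xi> \<Longrightarrow> \<tau> \<in> \<Gamma>"
    by blast
  have "(x, \<xi>) \<in> \<Gamma>" if "\<xi> \<in> cone_nbhd \<eta> \<delta>" "norm x \<le> \<delta> * norm \<xi>" for x \<xi>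
    by (rule \<delta>(3)[of "(0, \<xi>)"]) (use that in \<open>auto simp: cone_nbhd_def norm_Pair\<close>)
  then show ?thesis using that \<delta> by blast
qed

lemma rapidly_decreasing_on_subset:
  "rapidly_decreasing_on \<Gamma> F \<Longrightarrow> \<Gamma>' \<subseteq> \<Gamma> \<Longrightarrow> rapidly_decreasing_on \<Gamma>' F"
  unfolding rapidly_decreasing_on_iff by (meson subsetD)

lemma rapidly_decreasing_on_add:
  assumes "rapidly_decreasing_on \<Gamma> F" "rapidly_decreasing_on \<Gamma> H"
  shows "rapidly_decreasing_on \<Gamma> (\<lambda>z. F z + H z)"
  unfolding rapidly_decreasing_on_iff
proof
  fix N
  obtain A where A: "\<forall>z\<in>\<Gamma>. japanese z ^ N * cmod (F z) \<le> A" using assms(1) rapidly_decreasing_on_iff by blast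
  obtain B where B: "\<forall>z\<in>\<Gamma>. japanese z ^ N * cmod (H z) \<le> B" using assms(2) rapidly_decreasing_on_iff by blast
  have "japanese z ^ N * cmod (F z + H z) \<le> A + B" if "z \<in> \<Gamma>" for z
    using mult_left_mono[OF norm_triangle_ineq[of "F z" "H z"], of "japanese z ^ N"] A B that
    by (simp add: distrib_left) (metis add_mono order_trans)
  then show "\<exists>C. \<forall>z\<in>\<Gamma>. japanese z ^ N * cmod (F z + H z) \<le> C" by blast
qed

lemma rapidly_decreasing_on_zero: "rapidly_decreasing_on \<Gamma> (\<lambda>z. 0)"
  unfolding rapidly_decreasing_on_iff by auto

lemma rapidly_decreasing_on_sum:
  "(\<And>i. i \<in> I \<Longrightarrow> rapidly_decreasing_on \<Gamma> (F i)) \<Longrightarrow> rapidly_decreasing_on \<Gamma> (\<lambda>z. \<Sum>i\<in>I. F i z)"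
  by (induction I rule: infinite_finite_induct) (auto intro: rapidly_decreasing_on_add rapidly_decreasing_on_zero)

lemma rapidly_decreasing_on_uminus: "rapidly_decreasing_on \<Gamma> F \<Longrightarrow> rapidly_decreasing_on \<Gamma> (\<lambda>z. - F z)"
  by (simp add: rapidly_decreasing_on_iff)

lemma rapidly_decreasing_on_schwartz: "f \<in> schwartz \<Longrightarrow> rapidly_decreasing_on \<Gamma> f"
  unfolding rapidly_decreasing_on_iff by (metis schwartz_bound_cmod)

lemma rapidly_decreasing_on_cone_nbhd_imp:
  assumes "\<eta> \<noteq> 0" "0 < \<delta>" "rapidly_decreasing_on (cone_nbhd \<eta> \<delta>) F"
  shows "\<exists>\<Gamma>. open \<Gamma> \<and> pos_conic \<Gamma> \<and> 0 \<notin> \<Gamma> \<and> \<eta> \<in> \<Gamma> \<and> rapidly_decreasing_on \<Gamma> F"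
  using assms
  by (intro exI[of _ "cone_nbhd \<eta> \<delta>"] conjI open_cone_nbhd pos_conic_cone_nbhd zero_notin_cone_nbhd self_in_cone_nbhd)

lemma japanese_le_divide: "0 < \<delta> \<Longrightarrow> \<delta> \<le> 1 \<Longrightarrow> \<delta> * norm x \<le> norm y \<Longrightarrow> \<delta> * japanese x \<le> japanese y"
proof -
  assume \<delta>: "0 < \<delta>" "\<delta> \<le> 1" and le: "\<delta> * norm x \<le> norm y"
  have "\<delta>\<^sup>2 \<le> 1" using \<delta> by (simp add: power_le_one)
  moreover have "(\<delta> * norm x)\<^sup>2 \<le> (norm y)\<^sup>2" using le \<delta> by (intro power_mono) auto
  ultimately have "\<delta>\<^sup>2 * (1 + (norm x)\<^sup>2) \<le> 1 + (norm y)\<^sup>2" by (simp add: power_mult_distrib distrib_left)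
  then have "sqrt (\<delta>\<^sup>2 * (1 + (norm x)\<^sup>2)) \<le> japanese y" unfolding japanese_def by (rule real_sqrt_le_mono)
  then show ?thesis using \<delta> unfolding japanese_def real_sqrt_mult by simp
qed

section \<open>Decay of the short-time Fourier transform\<close>

lemma integral_japanese_shift:
  fixes \<xi> :: "'a::euclidean_space"
  shows "integrable lborel (\<lambda>\<tau>. 1 / japanese (\<xi> - \<tau>) ^ (2 * DIM('a)))"
    and "(\<integral>\<tau>. 1 / japanese (\<xi> - \<tau>) ^ (2 * DIM('a)) \<partial>lborel) = (\<integral>\<tau>. 1 / japanese (\<tau>::'a) ^ (2 * DIM('a)) \<partial>lborel)"
proof -
  let ?f = "\<lambda>\<tau>::'a. 1 / japanese \<tau> ^ (2 * DIM('a))"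
  show "integrable lborel (\<lambda>\<tau>. ?f (\<xi> - \<tau>))"
    using integrable_lborel_affine[OF integrable_japanese, of "- 1" \<xi>] by simp
  show "(\<integral>\<tau>. ?f (\<xi> - \<tau>) \<partial>lborel) = integral\<^sup>L lborel ?f"
    using integral_lborel_affine[of ?f "- 1" \<xi>] by simp
qed

text \<open>Directions of rapid decay survive convolution with a Schwartz function: if \<open>\<tau>\<close> leaves \<open>\<Gamma>\<close> then
  \<open>\<xi> - \<tau>\<close> is comparable to \<open>\<xi>\<close>.\<close>

lemma convolution_decay:
  fixes G h :: "'a::euclidean_space \<Rightarrow> complex"
  assumes G: "G \<in> borel_measurable borel" "0 \<le> A0" "\<And>\<xi>. cmod (G \<xi>) \<le> A0 * japanese \<xi> ^ N"
    and \<Gamma>: "open \<Gamma>" "pos_conic \<Gamma>" "\<eta> \<in> \<Gamma>" "\<eta> \<noteq> 0" "rapidly_decreasing_on \<Gamma> G"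
    and h: "h \<in> schwartz"
  obtains \<delta> where "0 < \<delta>"
    "\<And>M. \<exists>C. \<forall>\<xi>\<in>cone_nbhd \<eta> \<delta>. japanese \<xi> ^ M * (\<integral>\<tau>. cmod (G \<tau>) * cmod (h (\<xi> - \<tau>)) \<partial>lborel) \<le> C"
proof -
  obtain \<delta> where \<delta>: "0 < \<delta>" "\<delta> \<le> 1"
    "\<And>\<xi> \<tau>. \<xi> \<in> cone_nbhd \<eta> \<delta> \<Longrightarrow> norm (\<tau> - \<xi>) \<le> \<delta> * norm \<xi> \<Longrightarrow> \<tau> \<in> \<Gamma>"
    using cone_nbhd_subset[OF \<Gamma>(1-4)] by blast
  let ?K = "2 * DIM('a)"
  have "\<exists>C. \<forall>\<xi>\<in>cone_nbhd \<eta> \<delta>. japanese \<xi> ^ M * (\<integral>\<tau>. cmod (G \<tau>) * cmod (h (\<xi> - \<tau>)) \<partial>lborel) \<le> C" for M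
  proof -
    obtain A where A: "\<forall>\<tau>\<in>\<Gamma>. japanese \<tau> ^ M * cmod (G \<tau>) \<le> A" using \<Gamma>(5) rapidly_decreasing_on_iff by blast
    obtain B where B: "0 \<le> B" "\<And>\<tau>. japanese \<tau> ^ (M + ?K) * cmod (h \<tau>) \<le> B" using schwartz_bound_cmod[OF h] by metis
    \<comment> \<open>Weights needed when \<tau> is far from \<xi>: M + N to dominate the powers of
      \<xi> (M wanted, N from the growth of \<open>G\<close>), N from Peetre's inequality, and 2d
      for integrability.\<close>
    obtain D where D: "0 \<le> D" "\<And>\<tau>. japanese \<tau> ^ (M + N + N + ?K) * cmod (h \<tau>) \<le> D" using schwartz_bound_cmod[OF h] by metis
    define C where "C = max (2 ^ M * \<bar>A\<bar> * B) (A0 * 2 ^ N * (1 / \<delta> ^ (M + N)) * D)"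
    have point: "japanese \<xi> ^ M * (cmod (G \<tau>) * cmod (h (\<xi> - \<tau>))) \<le> C * (1 / japanese (\<xi> - \<tau>) ^ ?K)"
      if \<xi>: "\<xi> \<in> cone_nbhd \<eta> \<delta>" for \<xi> \<tau>
    proof -
      let ?j = "japanese (\<xi> - \<tau>)"
      have "japanese \<xi> ^ M * (cmod (G \<tau>) * cmod (h (\<xi> - \<tau>))) * ?j ^ ?K \<le> C"
      proof (cases "norm (\<tau> - \<xi>) \<le> \<delta> * norm \<xi>")
        case True
        then have \<tau>: "\<tau> \<in> \<Gamma>" using \<delta>(3)[OF \<xi>] by blast
        have "japanese \<xi> ^ M * (cmod (G \<tau>) * cmod (h (\<xi> - \<tau>))) * ?j ^ ?K \<le>
            (2 ^ M * japanese \<tau> ^ M * ?j ^ M) * (cmod (G \<tau>) * cmod (h (\<xi> - \<tau>))) * ?j ^ ?K"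
          by (intro mult_right_mono japanese_power_Peetre) auto
        also have "\<dots> = 2 ^ M * (japanese \<tau> ^ M * cmod (G \<tau>)) * (?j ^ (M + ?K) * cmod (h (\<xi> - \<tau>)))"
          by (simp add: power_add mult_ac)
        also have "\<dots> \<le> 2 ^ M * \<bar>A\<bar> * B"
          using A[rule_format, OF \<tau>] B by (intro mult_mono) auto
        finally show ?thesis by (simp add: C_def)
      next
        case False
        then have "\<delta> * norm \<xi> \<le> norm (\<xi> - \<tau>)" by (simp add: norm_minus_commute)
        then have "\<delta> * japanese \<xi> \<le> ?j" by (rule japanese_le_divide[OF \<delta>(1,2)])
        then have "(\<delta> * japanese \<xi>) ^ (M + N) \<le> ?j ^ (M + N)" using \<delta>(1) by (intro power_mono) auto
        then have j\<xi>: "japanese \<xi> ^ (M + N) \<le> 1 / \<delta> ^ (M + N) * ?j ^ (M + N)"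
          using \<delta>(1) by (simp add: power_mult_distrib pos_le_divide_eq mult.commute)
        have "cmod (G \<tau>) \<le> A0 * (2 ^ N * japanese \<xi> ^ N * ?j ^ N)"
        proof -
          have "japanese \<tau> ^ N \<le> 2 ^ N * japanese \<xi> ^ N * japanese (\<tau> - \<xi>) ^ N" by (rule japanese_power_Peetre)
          also have "japanese (\<tau> - \<xi>) = ?j" by (simp add: japanese_def norm_minus_commute)
          finally show ?thesis by (rule order_trans[OF G(3) mult_left_mono[OF _ G(2)]])
        qed
        then have "japanese \<xi> ^ M * (cmod (G \<tau>) * cmod (h (\<xi> - \<tau>))) * ?j ^ ?K \<le>
            japanese \<xi> ^ M * (A0 * (2 ^ N * japanese \<xi> ^ N * ?j ^ N) * cmod (h (\<xi> - \<tau>))) * ?j ^ ?K"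
          by (intro mult_left_mono mult_right_mono) auto
        also have "\<dots> = japanese \<xi> ^ (M + N) * (A0 * 2 ^ N * (?j ^ (N + ?K) * cmod (h (\<xi> - \<tau>))))"
          by (simp add: power_add mult_ac)
        also have "\<dots> \<le> (1 / \<delta> ^ (M + N) * ?j ^ (M + N)) * (A0 * 2 ^ N * (?j ^ (N + ?K) * cmod (h (\<xi> - \<tau>))))"
          using G(2) by (intro mult_right_mono j\<xi>) auto
        also have "\<dots> = A0 * 2 ^ N * (1 / \<delta> ^ (M + N)) * (?j ^ (M + N + N + ?K) * cmod (h (\<xi> - \<tau>)))"
          by (simp only: power_add mult_ac)
        also have "\<dots> \<le> A0 * 2 ^ N * (1 / \<delta> ^ (M + N)) * D"
          using G(2) \<delta>(1) by (intro mult_left_mono D(2)) auto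
        finally show ?thesis by (simp add: C_def)
      qed
      then show ?thesis by (simp add: pos_le_divide_eq)
    qed
    have "japanese \<xi> ^ M * (\<integral>\<tau>. cmod (G \<tau>) * cmod (h (\<xi> - \<tau>)) \<partial>lborel) \<le> C * (\<integral>\<tau>. 1 / japanese (\<tau>::'a) ^ ?K \<partial>lborel)"
      if \<xi>: "\<xi> \<in> cone_nbhd \<eta> \<delta>" for \<xi>
    proof -
      have "h \<in> borel_measurable borel" by (rule schwartz_measurable[OF h])
      then have m: "(\<lambda>\<tau>. japanese \<xi> ^ M * (cmod (G \<tau>) * cmod (h (\<xi> - \<tau>)))) \<in> borel_measurable lborel"
        using G(1) by measurable
      have i: "integrable lborel (\<lambda>\<tau>. C * (1 / japanese (\<xi> - \<tau>) ^ ?K))"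
        by (intro integrable_mult_right integral_japanese_shift(1))
      have "(\<integral>\<tau>. japanese \<xi> ^ M * (cmod (G \<tau>) * cmod (h (\<xi> - \<tau>))) \<partial>lborel) \<le> (\<integral>\<tau>. C * (1 / japanese (\<xi> - \<tau>) ^ ?K) \<partial>lborel)"
      proof (rule integral_mono[OF _ i point[OF \<xi>]])
        show "integrable lborel (\<lambda>\<tau>. japanese \<xi> ^ M * (cmod (G \<tau>) * cmod (h (\<xi> - \<tau>))))"
          by (rule Bochner_Integration.integrable_bound[OF i m])
             (intro AE_I2, use order_trans[OF point[OF \<xi>] abs_ge_self] in \<open>auto simp: abs_mult\<close>)
      qed
      then show ?thesis by (simp only: integral_mult_right_zero integral_japanese_shift(2))
    qed
    then show ?thesis by blast
  qed
  then show ?thesis using that \<delta>(1) by blast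
qed

text \<open>\<open>fourier_adjoint\<close> is bounded by an integral of moduli in which x no longer
  occurs; this is where uniformity in x comes from.\<close>

lemma stft_decay_of_fourier_decay:
  fixes u :: "('a::euclidean_space \<Rightarrow> complex) \<Rightarrow> complex"
  assumes G: "fourier_rep u G"
    and \<Gamma>: "open \<Gamma>" "pos_conic \<Gamma>" "\<eta> \<in> \<Gamma>" "\<eta> \<noteq> 0" "rapidly_decreasing_on \<Gamma> G"
    and \<phi>: "\<phi> \<in> schwartz"
  obtains \<delta> where "0 < \<delta>"
    "\<And>M. \<exists>C. \<forall>\<xi>\<in>cone_nbhd \<eta> \<delta>. \<forall>x. japanese \<xi> ^ M * cmod (stft \<phi> u (x, \<xi>)) \<le> C"
proof -
  obtain c :: complex where c: "c \<noteq> 0"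
    "\<And>u G (\<phi> :: 'a \<Rightarrow> complex) x \<xi>. fourier_rep u G \<Longrightarrow> \<phi> \<in> schwartz \<Longrightarrow>
       cmod (stft \<phi> u (x, \<xi>)) = cmod c * cmod (fourier_adjoint (\<lambda>\<tau>. G \<tau> * cnj (fourier_adjoint \<phi> (\<xi> - \<tau>))) x)"
    by (rule stft_fourier_rep) blast
  note h = schwartz_fourier_adjoint[OF \<phi>]
  obtain A0 N where A0: "0 \<le> A0" "\<And>\<xi>. cmod (G \<xi>) \<le> A0 * japanese \<xi> ^ N" using fourier_rep_bound[OF G] by metis
  obtain \<delta> where \<delta>: "0 < \<delta>"
    "\<And>M. \<exists>C. \<forall>\<xi>\<in>cone_nbhd \<eta> \<delta>. japanese \<xi> ^ M * (\<integral>\<tau>. cmod (G \<tau>) * cmod (fourier_adjoint \<phi> (\<xi> - \<tau>)) \<partial>lborel) \<le> C"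
    by (rule convolution_decay[OF fourier_rep_measurable[OF G] A0 \<Gamma> h]) blast
  have le: "cmod (stft \<phi> u (x, \<xi>)) \<le> cmod c * (\<integral>\<tau>. cmod (G \<tau>) * cmod (fourier_adjoint \<phi> (\<xi> - \<tau>)) \<partial>lborel)" for x \<xi>
  proof -
    have "(\<lambda>\<tau>. fourier_adjoint \<phi> (\<xi> - \<tau>)) \<in> schwartz"
      using schwartz_affine_arg[OF h, of "- 1" \<xi>] by simp
    from fourier_adjoint_bound[OF fourier_rep_integrable[OF G schwartz_cnj[OF this]], of x]
    show ?thesis unfolding c(2)[OF G \<phi>] by (intro mult_left_mono) (auto simp: norm_mult)
  qed
  have "\<exists>C. \<forall>\<xi>\<in>cone_nbhd \<eta> \<delta>. \<forall>x. japanese \<xi> ^ M * cmod (stft \<phi> u (x, \<xi>)) \<le> C" for M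
  proof -
    obtain C where C: "\<forall>\<xi>\<in>cone_nbhd \<eta> \<delta>. japanese \<xi> ^ M * (\<integral>\<tau>. cmod (G \<tau>) * cmod (fourier_adjoint \<phi> (\<xi> - \<tau>)) \<partial>lborel) \<le> C"
      using \<delta>(2) by blast
    have "japanese \<xi> ^ M * cmod (stft \<phi> u (x, \<xi>)) \<le> cmod c * C" if "\<xi> \<in> cone_nbhd \<eta> \<delta>" for \<xi> x
    proof -
      have "japanese \<xi> ^ M * cmod (stft \<phi> u (x, \<xi>)) \<le>
          cmod c * (japanese \<xi> ^ M * (\<integral>\<tau>. cmod (G \<tau>) * cmod (fourier_adjoint \<phi> (\<xi> - \<tau>)) \<partial>lborel))"
        using mult_left_mono[OF le[of x \<xi>], of "japanese \<xi> ^ M"] by (simp add: mult_ac)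
      also have "\<dots> \<le> cmod c * C" using C that by (intro mult_left_mono) auto
      finally show ?thesis .
    qed
    then show ?thesis by blast
  qed
  then show ?thesis using that \<delta>(1) by blast
qed

text \<open>The exponent \<open>N\<close> is an order of \<open>v\<close> and is fixed before
  \<open>M\<close>. For the decay in x, Peetre's inequality splits the weight of x between y and y -
  x; near y it is absorbed by the cutoff or by \<open>f\<close>, near y - x by the window. Only the
  modulation brings in powers of \<xi>.\<close>

lemma stft_bound:
  fixes u :: "('a::euclidean_space \<Rightarrow> complex) \<Rightarrow> complex"
  assumes v: "v \<in> tempered" and \<theta>: "\<theta> \<in> schwartz" "\<And>\<psi>. \<psi> \<in> schwartz \<Longrightarrow> v \<psi> = v (\<lambda>x. \<theta> x * \<psi> x)"
    and f: "f \<in> schwartz" and u: "\<And>\<psi>. \<psi> \<in> schwartz \<Longrightarrow> u \<psi> = v \<psi> + fun_dist f \<psi>"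
    and \<phi>: "\<phi> \<in> schwartz"
  obtains N where "\<And>M. \<exists>C. \<forall>x \<xi>. japanese x ^ M * cmod (stft \<phi> u (x, \<xi>)) \<le> C * japanese \<xi> ^ N"
proof -
  obtain C0 N where CN: "0 \<le> C0" "\<And>\<phi> B. \<phi> \<in> schwartz \<Longrightarrow> (\<And>x. japanese x ^ N * jet_norm N \<phi> x \<le> B) \<Longrightarrow> cmod (v \<phi>) \<le> C0 * B"
    using tempered_bound[OF v] by metis
  obtain L where L: "0 < L" "\<And>f g (x::'a). smooth_fun f \<Longrightarrow> smooth_fun g \<Longrightarrow>
       jet_norm N (\<lambda>x. f x * g x) x \<le> L * (jet_norm N f x * jet_norm N g x)"
    using jet_norm_mult_le by blast
  obtain K where K: "0 < K" "\<And>x \<xi>::'a. jet_norm N (\<lambda>x. cis (x \<bullet> \<xi>)) x \<le> K * japanese \<xi> ^ N"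
    using jet_norm_cis_le by blast
  have "\<exists>C. \<forall>x \<xi>. japanese x ^ M * cmod (stft \<phi> u (x, \<xi>)) \<le> C * japanese \<xi> ^ N" for M
  proof -
    \<comment> \<open>N weights for the seminorm of \<open>v\<close>, and M that result from moving
      the weight in x.\<close>
    obtain A where A: "0 \<le> A" "\<And>y. japanese y ^ (N + M) * jet_norm N \<theta> y \<le> A" using schwartz_bound[OF \<theta>(1)] by metis
    obtain B where B: "0 \<le> B" "\<And>y. japanese y ^ M * jet_norm N \<phi> y \<le> B" using schwartz_bound[OF \<phi>] by metis
    obtain B' where B': "0 \<le> B'" "\<And>y. japanese y ^ M * cmod (\<phi> y) \<le> B'" using schwartz_bound_cmod[OF \<phi>] by metis
    let ?I = "\<integral>y. japanese y ^ M * cmod (f y) \<partial>lborel"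
    have Pt: "japanese x ^ M \<le> 2 ^ M * japanese y ^ M * japanese (y - x) ^ M" for x y :: 'a
      using japanese_power_Peetre[of x M y] japanese_minus[of "x - y"] by simp
    have v_part: "japanese x ^ M * cmod (v (modulate \<xi> (translate x \<phi>))) \<le> C0 * (L * L * K * 2 ^ M * A * B) * japanese \<xi> ^ N" for x \<xi>
    proof -
      let ?e = "\<lambda>y. cis (y \<bullet> \<xi>)" and ?t = "translate x \<phi>"
      have S: "modulate \<xi> ?t \<in> schwartz" by (intro schwartz_modulate schwartz_translate \<phi>)
      have smt: "smooth_fun ?t" by (intro schwartz_smooth schwartz_translate \<phi>)
      let ?Q = "L * L * K * 2 ^ M * A * B * japanese \<xi> ^ N"
      have "cmod (v (modulate \<xi> ?t)) \<le> C0 * (?Q / japanese x ^ M)"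
        unfolding \<theta>(2)[OF S]
      proof (rule CN(2)[OF schwartz_mult[OF schwartz_slow[OF \<theta>(1)] S]])
        fix y
        have jt: "jet_norm N ?t y \<le> jet_norm N \<phi> (y - x)"
          using jet_norm_affine_arg_le[OF schwartz_smooth[OF \<phi>], of 1 N "- x" y] by (simp add: translate_def)
        have "jet_norm N (modulate \<xi> ?t) y \<le> L * (jet_norm N ?e y * jet_norm N ?t y)"
          unfolding modulate_def by (intro L(2) smt smooth_fun_cis)
        also have "\<dots> \<le> L * (K * japanese \<xi> ^ N * jet_norm N \<phi> (y - x))"
          using L(1) K(1) by (intro mult_left_mono mult_mono K(2) jt) auto
        finally have jm: "jet_norm N (modulate \<xi> ?t) y \<le> L * (K * japanese \<xi> ^ N * jet_norm N \<phi> (y - x))" .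
        have "jet_norm N (\<lambda>x'. \<theta> x' * modulate \<xi> ?t x') y \<le> L * (jet_norm N \<theta> y * jet_norm N (modulate \<xi> ?t) y)"
          by (intro L(2) schwartz_smooth \<theta>(1) S)
        also have "\<dots> \<le> L * (jet_norm N \<theta> y * (L * (K * japanese \<xi> ^ N * jet_norm N \<phi> (y - x))))"
          using L(1) by (intro mult_left_mono jm) auto
        finally have jp: "jet_norm N (\<lambda>x'. \<theta> x' * modulate \<xi> ?t x') y \<le> L * (jet_norm N \<theta> y * (L * (K * japanese \<xi> ^ N * jet_norm N \<phi> (y - x))))" .
        have "japanese x ^ M * (japanese y ^ N * jet_norm N (\<lambda>x'. \<theta> x' * modulate \<xi> ?t x') y) \<le>
            (2 ^ M * japanese y ^ M * japanese (y - x) ^ M) * (japanese y ^ N * (L * (jet_norm N \<theta> y * (L * (K * japanese \<xi> ^ N * jet_norm N \<phi> (y - x))))))"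
          by (intro mult_mono Pt mult_left_mono jp) auto
        also have "\<dots> = L * L * K * 2 ^ M * (japanese y ^ (N + M) * jet_norm N \<theta> y) * (japanese (y - x) ^ M * jet_norm N \<phi> (y - x)) * japanese \<xi> ^ N"
          by (simp add: power_add mult_ac)
        also have "\<dots> \<le> ?Q"
          using L(1) K(1) A(1) B(1) by (intro mult_right_mono mult_mono A(2) B(2) mult_left_mono) auto
        finally show "japanese y ^ N * jet_norm N (\<lambda>x'. \<theta> x' * modulate \<xi> ?t x') y \<le> ?Q / japanese x ^ M"
          by (simp add: pos_le_divide_eq mult_ac)
      qed
      then have "cmod (v (modulate \<xi> ?t)) \<le> C0 * ?Q / japanese x ^ M" by simp
      then have "cmod (v (modulate \<xi> ?t)) * japanese x ^ M \<le> C0 * ?Q" by (subst (asm) pos_le_divide_eq) auto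
      then show ?thesis by (simp add: mult_ac)
    qed
    have f_part: "japanese x ^ M * cmod (fun_dist f (modulate \<xi> (translate x \<phi>))) \<le> 2 ^ M * B' * ?I" for x \<xi>
    proof -
      have "cmod (of_real (japanese x ^ M) * fun_dist f (modulate \<xi> (translate x \<phi>))) =
          cmod (\<integral>y. of_real (japanese x ^ M) * (f y * cnj (modulate \<xi> (translate x \<phi>) y)) \<partial>lborel)"
        unfolding fun_dist_def by simp
      also have "\<dots> \<le> (\<integral>y. 2 ^ M * B' * (japanese y ^ M * cmod (f y)) \<partial>lborel)"
      proof (rule integral_norm_le)
        show "integrable lborel (\<lambda>y. 2 ^ M * B' * (japanese y ^ M * cmod (f y)))"
          by (intro integrable_mult_right integrable_weight_schwartz f)
        fix y
        have "cmod (of_real (japanese x ^ M) * (f y * cnj (modulate \<xi> (translate x \<phi>) y))) = japanese x ^ M * (cmod (f y) * cmod (\<phi> (y - x)))"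
          by (simp add: norm_mult norm_power modulate_def translate_def)
        also have "\<dots> \<le> (2 ^ M * japanese y ^ M * japanese (y - x) ^ M) * (cmod (f y) * cmod (\<phi> (y - x)))"
          by (intro mult_right_mono Pt) auto
        also have "\<dots> = 2 ^ M * (japanese y ^ M * cmod (f y)) * (japanese (y - x) ^ M * cmod (\<phi> (y - x)))"
          by (simp add: mult_ac)
        also have "\<dots> \<le> 2 ^ M * (japanese y ^ M * cmod (f y)) * B'"
          by (intro mult_left_mono B'(2)) auto
        finally show "cmod (of_real (japanese x ^ M) * (f y * cnj (modulate \<xi> (translate x \<phi>) y))) \<le> 2 ^ M * B' * (japanese y ^ M * cmod (f y))"
          by (simp add: mult_ac)
      qed
      finally show ?thesis by (simp add: norm_mult norm_power)
    qed
    have I: "0 \<le> ?I" by (intro integral_nonneg_AE AE_I2) simp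
    have "japanese x ^ M * cmod (stft \<phi> u (x, \<xi>)) \<le> (C0 * (L * L * K * 2 ^ M * A * B) + 2 ^ M * B' * ?I) * japanese \<xi> ^ N" for x \<xi>
    proof -
      have "stft \<phi> u (x, \<xi>) = v (modulate \<xi> (translate x \<phi>)) + fun_dist f (modulate \<xi> (translate x \<phi>))"
        using u[OF schwartz_modulate[OF schwartz_translate[OF \<phi>]]] by (simp add: stft_def)
      then have "japanese x ^ M * cmod (stft \<phi> u (x, \<xi>)) \<le> japanese x ^ M * cmod (v (modulate \<xi> (translate x \<phi>)))
          + japanese x ^ M * cmod (fun_dist f (modulate \<xi> (translate x \<phi>)))"
        unfolding distrib_left[symmetric] by (simp add: norm_triangle_ineq mult_left_mono)
      also have "\<dots> \<le> C0 * (L * L * K * 2 ^ M * A * B) * japanese \<xi> ^ N + 2 ^ M * B' * ?I * japanese \<xi> ^ N"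
      proof (intro add_mono v_part order_trans[OF f_part])
        have "0 \<le> 2 ^ M * B' * ?I" using B'(1) I by simp
        from mult_left_mono[OF japanese_power_ge_1[of \<xi> N] this]
        show "2 ^ M * B' * ?I \<le> 2 ^ M * B' * ?I * japanese \<xi> ^ N" by (simp only: mult_1_right)
      qed
      finally show ?thesis by (simp add: distrib_right)
    qed
    then show ?thesis by blast
  qed
  then show ?thesis using that by blast
qed

text \<open>For fixed \<open>\<xi>\<close>, \<open>x \<mapsto> V\<^sub>\<phi> u(x, \<xi>)\<close> is up to a phase the inverse Fourier transform of
  \<open>\<tau> \<mapsto> G(\<tau>)\<close> times a translate of the transform of \<open>\<phi>\<close>, so inversion bounds \<open>G(\<xi> - \<zeta>)\<close> by the
  \<open>L\<^sup>1\<close> norm in \<open>x\<close>; \<open>\<zeta>\<close> is any point where the transform of the window does not vanish.\<close>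

lemma fourier_decay_of_stft_decay:
  fixes u :: "('a::euclidean_space \<Rightarrow> complex) \<Rightarrow> complex"
  assumes G: "fourier_rep u G" and \<phi>: "\<phi> \<in> schwartz" "\<phi> \<noteq> (\<lambda>x. 0)"
    and bound: "\<And>M. \<exists>C. \<forall>x \<xi>. japanese x ^ M * cmod (stft \<phi> u (x, \<xi>)) \<le> C * japanese \<xi> ^ N"
    and \<Gamma>: "open \<Gamma>" "pos_conic \<Gamma>" "(0, \<eta>) \<in> \<Gamma>" "\<eta> \<noteq> 0" "rapidly_decreasing_on \<Gamma> (stft \<phi> u)"
  obtains \<delta> where "0 < \<delta>" "rapidly_decreasing_on (cone_nbhd \<eta> \<delta>) G"
proof -
  let ?K = "2 * DIM('a)"
  obtain c :: complex where c: "c \<noteq> 0"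
    "\<And>u G (\<phi> :: 'a \<Rightarrow> complex) x \<xi>. fourier_rep u G \<Longrightarrow> \<phi> \<in> schwartz \<Longrightarrow>
       cmod (stft \<phi> u (x, \<xi>)) = cmod c * cmod (fourier_adjoint (\<lambda>\<tau>. G \<tau> * cnj (fourier_adjoint \<phi> (\<xi> - \<tau>))) x)"
    by (rule stft_fourier_rep) blast
  obtain c' :: complex where c': "c' \<noteq> 0"
    "\<And>(f :: 'a \<Rightarrow> complex) t. fourier_invertible f \<Longrightarrow>
      (\<integral>x. fourier_adjoint f x * cis (- (x \<bullet> t)) \<partial>lborel) = c' * f t"
    by (rule fourier_inversion) blast
  obtain c'' :: complex where c'': "\<phi> = fourier_adjoint (\<lambda>\<xi>. c'' * fourier_adjoint \<phi> (- \<xi>))"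
    using schwartz_eq_fourier_adjoint \<phi>(1) by metis
  \<comment> \<open>If the transform of the window vanished identically, inversion would make the
    window zero.\<close>
  obtain \<zeta> where \<zeta>: "fourier_adjoint \<phi> \<zeta> \<noteq> 0"
  proof (rule ccontr)
    assume "\<not> thesis"
    then have "fourier_adjoint \<phi> \<xi> = 0" for \<xi> using that by blast
    then have "(\<lambda>\<xi>. c'' * fourier_adjoint \<phi> (- \<xi>)) = (\<lambda>\<xi>. 0)" by simp
    from trans[OF c'' arg_cong[OF this, of fourier_adjoint]]
    show False using \<phi>(2) by (simp add: fourier_adjoint_def fun_eq_iff)
  qed
  define h where "h = fourier_adjoint \<phi>"
  have h: "h \<in> schwartz" unfolding h_def by (rule schwartz_fourier_adjoint[OF \<phi>(1)])
  obtain A0 N0 where A0: "0 \<le> A0" "\<And>\<xi>. cmod (G \<xi>) \<le> A0 * japanese \<xi> ^ N0" using fourier_rep_bound[OF G] by metis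
  define f where "f \<xi> \<tau> = G \<tau> * cnj (h (\<xi> - \<tau>))" for \<xi> \<tau>
  have hS: "(\<lambda>\<tau>. cnj (h (\<xi> - \<tau>))) \<in> schwartz" for \<xi>
    using schwartz_affine_arg[OF h, of "- 1" \<xi>] schwartz_cnj by simp
  have f_cont: "continuous_on UNIV (f \<xi>)" for \<xi>
    unfolding f_def by (intro continuous_on_mult smooth_fun_continuous_on fourier_rep_smooth[OF G] schwartz_smooth hS)
  have f_int: "integrable lborel (f \<xi>)" for \<xi>
    unfolding f_def by (rule fourier_rep_integrable[OF G hS])
  have f_bdd: "bounded (range (f \<xi>))" for \<xi>
  proof -
    obtain B where B: "\<And>\<tau>. japanese \<tau> ^ N0 * cmod (cnj (h (\<xi> - \<tau>))) \<le> B" using schwartz_bound_cmod[OF hS] by metis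
    have "cmod (f \<xi> \<tau>) \<le> A0 * B" for \<tau>
    proof -
      have "cmod (f \<xi> \<tau>) \<le> A0 * japanese \<tau> ^ N0 * cmod (cnj (h (\<xi> - \<tau>)))"
        unfolding f_def norm_mult by (intro mult_right_mono A0(2)) auto
      also have "\<dots> \<le> A0 * B" using mult_left_mono[OF B A0(1)] by (simp add: mult.assoc)
      finally show ?thesis .
    qed
    then show ?thesis unfolding bounded_iff by blast
  qed
  have V: "cmod (stft \<phi> u (x, \<xi>)) = cmod c * cmod (fourier_adjoint (f \<xi>) x)" for x \<xi>
    unfolding f_def h_def by (rule c(2)[OF G \<phi>(1)])
  obtain \<delta> where \<delta>: "0 < \<delta>" "\<delta> \<le> 1"
    "\<And>x \<xi>. \<xi> \<in> cone_nbhd \<eta> \<delta> \<Longrightarrow> norm x \<le> \<delta> * norm \<xi> \<Longrightarrow> (x, \<xi>) \<in> \<Gamma>"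
    using cone_nbhd_subset_prod[OF \<Gamma>(1-4)] by blast
  \<comment> \<open>Where |x| is at most \<delta> |\<xi>| the point lies in \<Gamma>; elsewhere the
    weight of x dominates \<delta> times that of \<xi>. The weights \<open>?K\<close> are reserved
    for integration over x.\<close>
  have stft_dec: "\<exists>C. \<forall>\<xi>\<in>cone_nbhd \<eta> \<delta>. \<forall>x. japanese \<xi> ^ M * (japanese x ^ ?K * cmod (stft \<phi> u (x, \<xi>))) \<le> C" for M
  proof -
    obtain A where A: "\<forall>z\<in>\<Gamma>. japanese z ^ (M + ?K) * cmod (stft \<phi> u z) \<le> A" using \<Gamma>(5) rapidly_decreasing_on_iff by blast
    \<comment> \<open>Of the weights in x, N compensate the growth in \<xi> and M are turned into
      decay in \<xi>.\<close>
    obtain B where B: "\<And>x \<xi>. japanese x ^ (M + N + ?K) * cmod (stft \<phi> u (x, \<xi>)) \<le> B * japanese \<xi> ^ N" using bound by blast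
    have "japanese \<xi> ^ M * (japanese x ^ ?K * cmod (stft \<phi> u (x, \<xi>))) \<le> max A (B / \<delta> ^ (M + N))"
      if \<xi>: "\<xi> \<in> cone_nbhd \<eta> \<delta>" for \<xi> x
    proof (cases "norm x \<le> \<delta> * norm \<xi>")
      case True
      then have z: "(x, \<xi>) \<in> \<Gamma>" using \<delta>(3)[OF \<xi>] by blast
      have "japanese \<xi> \<le> japanese (x, \<xi>)" "japanese x \<le> japanese (x, \<xi>)"
        by (auto intro!: japanese_mono simp: norm_Pair real_le_rsqrt)
      then have "japanese \<xi> ^ M * japanese x ^ ?K \<le> japanese (x, \<xi>) ^ M * japanese (x, \<xi>) ^ ?K"
        by (intro mult_mono power_mono) auto
      then have "japanese \<xi> ^ M * japanese x ^ ?K * cmod (stft \<phi> u (x, \<xi>)) \<le> japanese (x, \<xi>) ^ (M + ?K) * cmod (stft \<phi> u (x, \<xi>))"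
        unfolding power_add by (rule mult_right_mono) simp
      also have "\<dots> \<le> A" using A z by blast
      finally show ?thesis by (simp add: mult.assoc)
    next
      case False
      then have "\<delta> * japanese \<xi> \<le> japanese x" by (intro japanese_le_divide \<delta>) auto
      then have p: "(\<delta> * japanese \<xi>) ^ (M + N) \<le> japanese x ^ (M + N)" using \<delta>(1) by (intro power_mono) auto
      let ?V = "japanese x ^ ?K * cmod (stft \<phi> u (x, \<xi>))"
      have "(\<delta> ^ (M + N) * (japanese \<xi> ^ M * ?V)) * japanese \<xi> ^ N = (\<delta> * japanese \<xi>) ^ (M + N) * ?V"
        by (simp only: power_mult_distrib power_add mult_ac)
      also have "\<dots> \<le> japanese x ^ (M + N) * ?V" by (rule mult_right_mono[OF p]) simp
      also have "\<dots> \<le> B * japanese \<xi> ^ N" using B[of x \<xi>] by (simp add: power_add mult_ac)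
      finally have "\<delta> ^ (M + N) * (japanese \<xi> ^ M * ?V) \<le> B" by (rule mult_right_le_imp_le) simp
      then have "japanese \<xi> ^ M * ?V \<le> B / \<delta> ^ (M + N)"
        using \<delta>(1) by (simp add: pos_le_divide_eq mult.commute)
      then show ?thesis by simp
    qed
    then show ?thesis by blast
  qed
  have G_shift: "\<exists>C. \<forall>\<xi>\<in>cone_nbhd \<eta> \<delta>. japanese \<xi> ^ M * cmod (G (\<xi> - \<zeta>)) \<le> C" for M
  proof -
    obtain C where C: "\<forall>\<xi>\<in>cone_nbhd \<eta> \<delta>. \<forall>x. japanese \<xi> ^ M * (japanese x ^ ?K * cmod (stft \<phi> u (x, \<xi>))) \<le> C"
      using stft_dec by blast
    let ?I = "\<integral>x. 1 / japanese (x::'a) ^ ?K \<partial>lborel"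
    have "japanese \<xi> ^ M * cmod (G (\<xi> - \<zeta>)) \<le> C / cmod c * ?I / (cmod c' * cmod (h \<zeta>))"
      if \<xi>: "\<xi> \<in> cone_nbhd \<eta> \<delta>" for \<xi>
    proof -
      let ?F = "fourier_adjoint (f \<xi>)"
      have le: "japanese x ^ ?K * cmod (?F x) \<le> C / cmod c / japanese \<xi> ^ M" for x
      proof -
        have "japanese x ^ ?K * cmod (?F x) * cmod c * japanese \<xi> ^ M \<le> C"
        proof -
          have "japanese \<xi> ^ M * (japanese x ^ ?K * (cmod c * cmod (?F x))) \<le> C"
            using C \<xi> unfolding V by blast
          then show ?thesis by (simp only: mult_ac)
        qed
        then show ?thesis using c(1) by (simp add: pos_le_divide_eq)
      qed
      have F_meas: "?F \<in> borel_measurable borel"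
        using f_int by (intro fourier_adjoint_measurable) (auto dest: borel_measurable_integrable)
      have F_int: "integrable lborel ?F" by (rule integrable_decay[OF F_meas le])
      \<comment> \<open>At the point \<xi> - \<zeta> the inverted function is G(\<xi> - \<zeta>)
        times the conjugate of h(\<zeta>), which is nonzero.\<close>
      have "c' * f \<xi> (\<xi> - \<zeta>) = (\<integral>x. ?F x * cis (- (x \<bullet> (\<xi> - \<zeta>))) \<partial>lborel)"
        by (rule c'(2)[symmetric]) (simp add: fourier_invertible_def f_cont f_bdd f_int F_int)
      also have "cmod \<dots> \<le> (\<integral>x. C / cmod c / japanese \<xi> ^ M * (1 / japanese (x::'a) ^ ?K) \<partial>lborel)"
      proof (rule integral_norm_le)
        show "integrable lborel (\<lambda>x::'a. C / cmod c / japanese \<xi> ^ M * (1 / japanese x ^ ?K))"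
          by (intro integrable_mult_right integrable_japanese)
        show "cmod (?F x * cis (- (x \<bullet> (\<xi> - \<zeta>)))) \<le> C / cmod c / japanese \<xi> ^ M * (1 / japanese x ^ ?K)" for x
        proof -
          have "cmod (?F x) \<le> (C / cmod c / japanese \<xi> ^ M) / japanese x ^ ?K"
            by (subst pos_le_divide_eq) (use le[of x] in \<open>simp_all only: mult.commute japanese_power_pos\<close>)
          then show ?thesis by (simp add: norm_mult)
        qed
      qed
      also have "\<dots> = C / cmod c / japanese \<xi> ^ M * ?I" by (rule integral_mult_right_zero)
      finally have "cmod c' * (cmod (G (\<xi> - \<zeta>)) * cmod (h \<zeta>)) \<le> C / cmod c * ?I / japanese \<xi> ^ M"
        by (simp add: f_def norm_mult)
      then have "cmod c' * (cmod (G (\<xi> - \<zeta>)) * cmod (h \<zeta>)) * japanese \<xi> ^ M \<le> C / cmod c * ?I"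
        by (subst (asm) pos_le_divide_eq) auto
      moreover have pos: "0 < cmod c' * cmod (h \<zeta>)" using c'(1) \<zeta> by (simp add: h_def)
      ultimately show ?thesis unfolding pos_le_divide_eq[OF pos] by (simp only: mult_ac)
    qed
    then show ?thesis by blast
  qed
  have \<eta>_in: "\<eta> \<in> cone_nbhd \<eta> \<delta>" by (rule self_in_cone_nbhd[OF \<Gamma>(4) \<delta>(1)])
  \<comment> \<open>A smaller cone undoes the shift by \<zeta>: for large \<xi> the shift is a small
    relative perturbation, and for bounded \<xi> the growth bound of \<open>G\<close>
    suffices.\<close>
  obtain \<delta>' where \<delta>': "0 < \<delta>'" "\<delta>' \<le> 1"
    "\<And>\<xi> \<tau>. \<xi> \<in> cone_nbhd \<eta> \<delta>' \<Longrightarrow> norm (\<tau> - \<xi>) \<le> \<delta>' * norm \<xi> \<Longrightarrow> \<tau> \<in> cone_nbhd \<eta> \<delta>"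
    using cone_nbhd_subset[OF open_cone_nbhd pos_conic_cone_nbhd \<eta>_in \<Gamma>(4)] by blast
  have "rapidly_decreasing_on (cone_nbhd \<eta> \<delta>') G"
    unfolding rapidly_decreasing_on_iff
  proof
    fix M
    obtain C where C: "\<forall>\<xi>\<in>cone_nbhd \<eta> \<delta>. japanese \<xi> ^ M * cmod (G (\<xi> - \<zeta>)) \<le> C" using G_shift by blast
    have "japanese \<xi> ^ M * cmod (G \<xi>) \<le> max (2 ^ M * japanese \<zeta> ^ M * C) (A0 * (1 + norm \<zeta> / \<delta>') ^ (M + N0))"
      if \<xi>: "\<xi> \<in> cone_nbhd \<eta> \<delta>'" for \<xi>
    proof (cases "norm \<zeta> \<le> \<delta>' * norm \<xi>")
      case True
      then have \<tau>: "\<xi> + \<zeta> \<in> cone_nbhd \<eta> \<delta>" using \<delta>'(3)[OF \<xi>, of "\<xi> + \<zeta>"] by simp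
      have "japanese \<xi> ^ M * cmod (G \<xi>) \<le> 2 ^ M * japanese (\<xi> + \<zeta>) ^ M * japanese (\<xi> - (\<xi> + \<zeta>)) ^ M * cmod (G \<xi>)"
        by (intro mult_right_mono japanese_power_Peetre) auto
      also have "\<dots> = 2 ^ M * japanese \<zeta> ^ M * (japanese (\<xi> + \<zeta>) ^ M * cmod (G (\<xi> + \<zeta> - \<zeta>)))"
        by (simp add: mult_ac)
      also have "\<dots> \<le> 2 ^ M * japanese \<zeta> ^ M * C" using C \<tau> by (intro mult_left_mono) auto
      finally show ?thesis by simp
    next
      case False
      then have "norm \<xi> \<le> norm \<zeta> / \<delta>'" using \<delta>'(1) by (simp add: pos_le_divide_eq mult.commute)
      then have "japanese \<xi> \<le> 1 + norm \<zeta> / \<delta>'" using japanese_le[of \<xi>] by linarith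
      then have "japanese \<xi> ^ (M + N0) \<le> (1 + norm \<zeta> / \<delta>') ^ (M + N0)" by (intro power_mono) auto
      then have A: "A0 * japanese \<xi> ^ (M + N0) \<le> A0 * (1 + norm \<zeta> / \<delta>') ^ (M + N0)" by (rule mult_left_mono[OF _ A0(1)])
      have "japanese \<xi> ^ M * cmod (G \<xi>) \<le> japanese \<xi> ^ M * (A0 * japanese \<xi> ^ N0)"
        by (intro mult_left_mono A0(2)) auto
      also have "\<dots> = A0 * japanese \<xi> ^ (M + N0)" by (simp only: power_add mult_ac)
      also note A
      finally show ?thesis by (rule max.coboundedI2)
    qed
    then show "\<exists>C. \<forall>z\<in>cone_nbhd \<eta> \<delta>'. japanese z ^ M * cmod (G z) \<le> C" by blast
  qed
  then show ?thesis using that \<delta>'(1) by blast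
qed

section \<open>Wave front sets\<close>

lemma fourier_decay_of_not_in_WF:
  fixes u :: "('a::euclidean_space \<Rightarrow> complex) \<Rightarrow> complex"
  assumes v: "v \<in> tempered" and \<theta>: "\<theta> \<in> test_functions"
    and f: "f \<in> schwartz" and u: "\<And>\<psi>. \<psi> \<in> schwartz \<Longrightarrow> u \<psi> = v \<psi> + fun_dist f \<psi>"
    and \<eta>: "\<eta> \<noteq> 0" and WF: "\<And>x. (x, \<eta>) \<notin> WF u"
  obtains \<Gamma> where "open \<Gamma>" "pos_conic \<Gamma>" "0 \<notin> \<Gamma>" "\<eta> \<in> \<Gamma>" "rapidly_decreasing_on \<Gamma> (dist_fourier v \<theta>)"
proof -
  have "\<forall>x. \<exists>\<phi> \<Gamma>. \<phi> \<in> test_functions \<and> \<phi> 0 \<noteq> 0 \<and> open \<Gamma> \<and> pos_conic \<Gamma> \<and> \<eta> \<in> \<Gamma> \<and>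
      rapidly_decreasing_on \<Gamma> (\<lambda>\<xi>. stft \<phi> u (x, \<xi>))"
    using WF \<eta> unfolding WF_def by blast
  then obtain \<phi> \<Gamma> where \<phi>: "\<And>x. \<phi> x \<in> test_functions" "\<And>x. \<phi> x 0 \<noteq> 0"
    and \<Gamma>: "\<And>x. open (\<Gamma> x)" "\<And>x. pos_conic (\<Gamma> x)" "\<And>x. \<eta> \<in> \<Gamma> x"
      "\<And>x. rapidly_decreasing_on (\<Gamma> x) (\<lambda>\<xi>. stft (\<phi> x) u (x, \<xi>))"
    by metis
  define \<Phi> where "\<Phi> x = translate x (\<phi> x)" for x
  have \<Phi>: "\<Phi> x \<in> test_functions" for x
  proof -
    have eq: "\<Phi> x = (\<lambda>y. \<phi> x (1 *\<^sub>R y + - x))" by (simp add: \<Phi>_def translate_def)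
    have "compact ((\<lambda>y. x + y) ` fun_support (\<phi> x))"
      by (rule compact_translation[OF test_functions_compact[OF \<phi>(1)]])
    moreover have "smooth_fun (\<Phi> x)" unfolding eq by (rule smooth_fun_affine_arg[OF test_functions_smooth[OF \<phi>(1)]])
    moreover have "\<Phi> x y = 0" if "y \<notin> (\<lambda>y. x + y) ` fun_support (\<phi> x)" for y
    proof -
      have "y - x \<notin> fun_support (\<phi> x)" using that by (metis add.commute diff_add_cancel imageI)
      then show ?thesis by (simp add: eq not_in_fun_support)
    qed
    ultimately show ?thesis by (intro test_functionsI(1))
  qed
  note \<Phi>S = test_functions_schwartz[OF \<Phi>]
  have dec\<Phi>: "rapidly_decreasing_on (\<Gamma> x) (dist_fourier v (\<Phi> x))" for x
  proof -
    let ?g = "\<lambda>y. cnj (\<Phi> x y) * f y"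
    have g: "?g \<in> schwartz" by (rule schwartz_mult[OF schwartz_slow[OF schwartz_cnj[OF \<Phi>S]] f])
    \<comment> \<open>The hypothesis concerns \<open>u\<close>; the contribution of \<open>f\<close>
      is the transform of a Schwartz function and can be subtracted.\<close>
    have eq: "dist_fourier v (\<Phi> x) \<xi> = stft (\<phi> x) u (x, \<xi>) + - fourier_adjoint ?g (- \<xi>)" for \<xi>
    proof -
      have S: "(\<lambda>y. \<Phi> x y * cis (y \<bullet> \<xi>)) \<in> schwartz" by (rule schwartz_mult_cis[OF \<Phi>S])
      have "stft (\<phi> x) u (x, \<xi>) = u (\<lambda>y. \<Phi> x y * cis (y \<bullet> \<xi>))"
        by (simp add: stft_def modulate_def \<Phi>_def mult.commute)
      also have "\<dots> = dist_fourier v (\<Phi> x) \<xi> + fun_dist f (\<lambda>y. \<Phi> x y * cis (y \<bullet> \<xi>))"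
        unfolding u[OF S] dist_fourier_def ..
      also have "fun_dist f (\<lambda>y. \<Phi> x y * cis (y \<bullet> \<xi>)) = fourier_adjoint ?g (- \<xi>)"
        by (simp add: fun_dist_def fourier_adjoint_def cis_cnj inner_commute mult_ac)
      finally show ?thesis by simp
    qed
    show ?thesis unfolding eq
      by (intro rapidly_decreasing_on_add \<Gamma>(4) rapidly_decreasing_on_uminus rapidly_decreasing_on_schwartz
          schwartz_reflect schwartz_fourier_adjoint g)
  qed
  obtain J \<rho> where J: "finite J" "\<And>j. j \<in> J \<Longrightarrow> \<rho> j \<in> test_functions" and \<theta>_eq: "\<theta> = (\<lambda>x. \<Sum>j\<in>J. \<Phi> j x * \<rho> j x)"
  proof (rule test_function_division[OF \<theta>, of \<Phi>])
    show "\<Phi> x x \<noteq> 0" for x using \<phi>(2) by (simp add: \<Phi>_def translate_def)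
  qed (use \<Phi> in blast)+
  have "\<exists>\<delta>>0. rapidly_decreasing_on (cone_nbhd \<eta> \<delta>) (\<lambda>\<xi>. v (\<lambda>x. \<Phi> j x * \<rho> j x * cis (x \<bullet> \<xi>)))" if j: "j \<in> J" for j
  proof -
    \<comment> \<open>The convolution estimate is applied to the localized distribution with \<rho>
      j as window: its short-time transform at x = 0 is the transform after multiplication by both
      factors, so decay survives the second multiplication.\<close>
    let ?w = "\<lambda>\<psi>. v (\<lambda>x. \<Phi> j x * \<psi> x)"
    have rep: "fourier_rep ?w (dist_fourier v (\<Phi> j))" by (rule fourier_rep_localized[OF v \<Phi>S])
    obtain \<delta> where \<delta>: "0 < \<delta>"
      "\<And>M. \<exists>C. \<forall>\<xi>\<in>cone_nbhd \<eta> \<delta>. \<forall>x. japanese \<xi> ^ M * cmod (stft (\<rho> j) ?w (x, \<xi>)) \<le> C"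
      by (rule stft_decay_of_fourier_decay[OF rep \<Gamma>(1-3) \<eta> dec\<Phi> test_functions_schwartz[OF J(2)[OF j]]]) blast
    have "stft (\<rho> j) ?w (0, \<xi>) = v (\<lambda>x. \<Phi> j x * \<rho> j x * cis (x \<bullet> \<xi>))" for \<xi>
      by (simp add: stft_def modulate_def translate_def mult_ac)
    then have "rapidly_decreasing_on (cone_nbhd \<eta> \<delta>) (\<lambda>\<xi>. v (\<lambda>x. \<Phi> j x * \<rho> j x * cis (x \<bullet> \<xi>)))"
      unfolding rapidly_decreasing_on_iff using \<delta>(2) by metis
    then show ?thesis using \<delta>(1) by blast
  qed
  then obtain \<delta> where \<delta>: "\<And>j. j \<in> J \<Longrightarrow> 0 < \<delta> j"
    "\<And>j. j \<in> J \<Longrightarrow> rapidly_decreasing_on (cone_nbhd \<eta> (\<delta> j)) (\<lambda>\<xi>. v (\<lambda>x. \<Phi> j x * \<rho> j x * cis (x \<bullet> \<xi>)))"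
    by metis
  \<comment> \<open>The first cone covers the case of empty \<open>J\<close>, where the intersection
    over \<open>J\<close> is the whole space and would contain 0.\<close>
  let ?\<Gamma> = "cone_nbhd \<eta> 1 \<inter> (\<Inter>j\<in>J. cone_nbhd \<eta> (\<delta> j))"
  show ?thesis
  proof (rule that)
    show "open ?\<Gamma>" using J(1) by (intro open_Int open_INT open_cone_nbhd) (auto simp: open_cone_nbhd)
    show "pos_conic ?\<Gamma>" using pos_conic_cone_nbhd unfolding pos_conic_def by blast
    show "0 \<notin> ?\<Gamma>" using zero_notin_cone_nbhd by blast
    show "\<eta> \<in> ?\<Gamma>" using self_in_cone_nbhd[OF \<eta>] \<delta>(1) by simp
    have S: "(\<lambda>x. \<Phi> j x * \<rho> j x * cis (x \<bullet> \<xi>)) \<in> schwartz" if "j \<in> J" for j \<xi>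
      by (intro schwartz_mult_cis schwartz_mult schwartz_slow \<Phi>S test_functions_schwartz J that)
    have "dist_fourier v \<theta> \<xi> = (\<Sum>j\<in>J. v (\<lambda>x. \<Phi> j x * \<rho> j x * cis (x \<bullet> \<xi>)))" for \<xi>
      unfolding dist_fourier_def \<theta>_eq sum_distrib_right by (rule tempered_sum1[OF v S])
    moreover have "rapidly_decreasing_on ?\<Gamma> (\<lambda>\<xi>. \<Sum>j\<in>J. v (\<lambda>x. \<Phi> j x * \<rho> j x * cis (x \<bullet> \<xi>)))"
      by (intro rapidly_decreasing_on_sum rapidly_decreasing_on_subset[OF \<delta>(2)]) auto
    ultimately show "rapidly_decreasing_on ?\<Gamma> (dist_fourier v \<theta>)" by (simp add: rapidly_decreasing_on_iff)
  qed
qed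

text \<open>Both equalities are obtained by comparison with \<open>Sigma_dir u\<close>. The window
  is arbitrary and \<open>Sigma_dir u\<close> does not mention it, so independence of
  \<open>WF_G\<close> from the window follows for these \<open>u\<close>.\<close>

theorem corollary3p4:
  fixes u :: "('a::euclidean_space \<Rightarrow> complex) \<Rightarrow> complex"
    and \<phi> :: "'a \<Rightarrow> complex"
  assumes "u \<in> compact_plus_schwartz"
    and "\<phi> \<in> schwartz" and "\<phi> \<noteq> (\<lambda>x. 0)"
  shows "WF_G \<phi> u = {0} \<times> snd ` WF u \<and> {0} \<times> snd ` WF u = {0} \<times> Sigma_dir u"
proof -
  note \<phi> = assms(2,3)
  obtain v f where v: "v \<in> compact_dists" and f: "f \<in> schwartz"
    and u: "\<And>\<psi>. \<psi> \<in> schwartz \<Longrightarrow> u \<psi> = v \<psi> + fun_dist f \<psi>"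
    using assms(1) by (auto simp: compact_plus_schwartz_def)
  have v': "v \<in> tempered" using v by (simp add: compact_dists_def)
  obtain \<theta> where \<theta>: "\<theta> \<in> test_functions" "\<And>\<psi>. \<psi> \<in> schwartz \<Longrightarrow> v \<psi> = v (\<lambda>x. \<theta> x * \<psi> x)"
    using compact_dists_cutoff[OF v] by blast
  note \<theta>S = test_functions_schwartz[OF \<theta>(1)]
  define H where "H \<xi> = fourier_adjoint f (- \<xi>)" for \<xi>
  define G where "G \<xi> = dist_fourier v \<theta> \<xi> + H \<xi>" for \<xi>
  have H: "H \<in> schwartz" unfolding H_def by (intro schwartz_reflect schwartz_fourier_adjoint f)
  have rep: "fourier_rep u G"
    unfolding G_def H_def
    by (rule fourier_rep_add[OF fourier_rep_localized[OF v' \<theta>S] fourier_rep_schwartz[OF f]]) (use u \<theta>(2) in simp)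
  note ff = fourier_fun_eq[OF rep]
  obtain N where N: "\<And>M. \<exists>C. \<forall>x \<xi>. japanese x ^ M * cmod (stft \<phi> u (x, \<xi>)) \<le> C * japanese \<xi> ^ N"
    using stft_bound[OF v' \<theta>S \<theta>(2) f u \<phi>(1)] by blast

  have WF_G_base: "x = 0" if "(x, \<xi>) \<in> WF_G \<phi> u" for x \<xi>
  proof (rule ccontr)
    assume x: "x \<noteq> 0"
    \<comment> \<open>Chosen so that R |x| = |x| + |\<xi>|, which exceeds |\<xi>| because x is
      nonzero.\<close>
    define R where "R = 1 + norm \<xi> / norm x"
    let ?\<Gamma> = "{z. norm (snd z) < R * norm (fst z)} :: ('a \<times> 'a) set"
    have R: "1 \<le> R" by (simp add: R_def)
    have "open ?\<Gamma>" by (intro open_Collect_less continuous_intros)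
    moreover have "pos_conic ?\<Gamma>" unfolding pos_conic_def by (auto simp: mult_ac)
    moreover have "0 \<notin> ?\<Gamma>" by simp
    moreover have "(x, \<xi>) \<in> ?\<Gamma>" using x by (simp add: R_def distrib_right)
    moreover have "rapidly_decreasing_on ?\<Gamma> (stft \<phi> u)"
      unfolding rapidly_decreasing_on_iff
    proof
      fix M
      obtain C where C: "\<And>x \<xi>. japanese x ^ (M + N) * cmod (stft \<phi> u (x, \<xi>)) \<le> C * japanese \<xi> ^ N" using N by blast
      \<comment> \<open>In this cone |z| is at most (1 + R) times the length of its first
        component.\<close>
      let ?\<delta> = "1 / (1 + R)"
      have \<delta>: "0 < ?\<delta>" "?\<delta> \<le> 1" using R by auto
      have "japanese z ^ M * cmod (stft \<phi> u z) \<le> C / ?\<delta> ^ (M + N)" if "z \<in> ?\<Gamma>" for z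
      proof -
        obtain y \<zeta> where z: "z = (y, \<zeta>)" by (cases z)
        have nz: "norm \<zeta> \<le> R * norm y" using that z by simp
        have "norm z \<le> norm y + norm \<zeta>" unfolding z by (rule norm_Pair_le)
        also have "\<dots> \<le> (1 + R) * norm y" using nz by (simp add: distrib_right)
        finally have "?\<delta> * norm z \<le> norm y" using R by (simp add: pos_divide_le_eq mult.commute)
        then have jz: "?\<delta> * japanese z \<le> japanese y" by (rule japanese_le_divide[OF \<delta>])
        have "japanese \<zeta> \<le> japanese z" unfolding z by (intro japanese_mono) (simp add: norm_Pair real_le_rsqrt)
        then have j\<zeta>: "japanese \<zeta> ^ N \<le> japanese z ^ N" by (intro power_mono) auto
        have C0: "0 \<le> C"
        proof -
          have "0 \<le> C * japanese (0::'a) ^ N" by (rule order_trans[OF _ C[of 0 0]]) simp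
          then show ?thesis by (simp add: japanese_def)
        qed
        let ?V = "cmod (stft \<phi> u z)"
        have "(?\<delta> ^ (M + N) * (japanese z ^ M * ?V)) * japanese z ^ N = (?\<delta> * japanese z) ^ (M + N) * ?V"
          by (simp only: power_mult_distrib power_add mult_ac)
        also have "\<dots> \<le> japanese y ^ (M + N) * ?V"
          using \<delta>(1) by (intro mult_right_mono power_mono jz) auto
        also have "\<dots> \<le> C * japanese \<zeta> ^ N" unfolding z by (rule C)
        also have "\<dots> \<le> C * japanese z ^ N" by (rule mult_left_mono[OF j\<zeta> C0])
        finally have "?\<delta> ^ (M + N) * (japanese z ^ M * ?V) \<le> C" by (rule mult_right_le_imp_le) simp
        then show ?thesis using zero_less_power[OF \<delta>(1), of "M + N"] by (subst pos_le_divide_eq) (auto simp only: mult.commute)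
      qed
      then show "\<exists>C. \<forall>z\<in>?\<Gamma>. japanese z ^ M * cmod (stft \<phi> u z) \<le> C" by blast
    qed
    ultimately show False using that unfolding WF_G_def by blast
  qed

  have WF_G_Sigma: "\<eta> \<in> Sigma_dir u" if WFG: "(0, \<eta>) \<in> WF_G \<phi> u" for \<eta>
  proof (rule ccontr)
    assume notin: "\<eta> \<notin> Sigma_dir u"
    have \<eta>: "\<eta> \<noteq> 0" using WFG by (auto simp: WF_G_def zero_prod_def)
    obtain \<Gamma> where \<Gamma>: "open \<Gamma>" "pos_conic \<Gamma>" "\<eta> \<in> \<Gamma>" "rapidly_decreasing_on \<Gamma> G"
      using notin \<eta> unfolding Sigma_dir_def ff by blast
    obtain \<delta> where \<delta>: "0 < \<delta>"
      "\<And>M. \<exists>C. \<forall>\<xi>\<in>cone_nbhd \<eta> \<delta>. \<forall>x. japanese \<xi> ^ M * cmod (stft \<phi> u (x, \<xi>)) \<le> C"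
      by (rule stft_decay_of_fourier_decay[OF rep \<Gamma>(1-3) \<eta> \<Gamma>(4) \<phi>(1)]) blast
    \<comment> \<open>Decay is known in \<xi> only; the condition |x| < |\<xi>| makes the weight of
      z at most twice that of \<xi>.\<close>
    let ?\<Gamma> = "{z. norm (fst z) < norm (snd z)} \<inter> snd -` cone_nbhd \<eta> \<delta> :: ('a \<times> 'a) set"
    have "open ?\<Gamma>"
      by (intro open_Int open_Collect_less open_vimage open_cone_nbhd continuous_intros)
    moreover have "pos_conic ?\<Gamma>" using pos_conic_cone_nbhd[of \<eta> \<delta>] unfolding pos_conic_def by auto
    moreover have "0 \<notin> ?\<Gamma>" by simp
    moreover have "(0, \<eta>) \<in> ?\<Gamma>" using \<eta> self_in_cone_nbhd[OF \<eta> \<delta>(1)] by simp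
    moreover have "rapidly_decreasing_on ?\<Gamma> (stft \<phi> u)"
      unfolding rapidly_decreasing_on_iff
    proof
      fix M
      obtain C where C: "\<forall>\<xi>\<in>cone_nbhd \<eta> \<delta>. \<forall>x. japanese \<xi> ^ M * cmod (stft \<phi> u (x, \<xi>)) \<le> C" using \<delta>(2) by blast
      have "japanese z ^ M * cmod (stft \<phi> u z) \<le> 2 ^ M * C" if "z \<in> ?\<Gamma>" for z
      proof -
        obtain x \<xi> where z: "z = (x, \<xi>)" by (cases z)
        have nz: "norm x \<le> norm \<xi>" "\<xi> \<in> cone_nbhd \<eta> \<delta>" using that z by auto
        have "norm z \<le> 2 * norm \<xi>" using norm_Pair_le[of x \<xi>] nz z by simp
        then have "japanese z ^ M \<le> (2 * japanese \<xi>) ^ M" by (intro power_mono japanese_scaled_le) auto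
        then have "japanese z ^ M * cmod (stft \<phi> u z) \<le> (2 * japanese \<xi>) ^ M * cmod (stft \<phi> u (x, \<xi>))"
          unfolding z by (rule mult_right_mono) simp
        also have "\<dots> = 2 ^ M * (japanese \<xi> ^ M * cmod (stft \<phi> u (x, \<xi>)))" by (simp add: power_mult_distrib)
        also have "\<dots> \<le> 2 ^ M * C" using C nz by (intro mult_left_mono) auto
        finally show ?thesis .
      qed
      then show "\<exists>C. \<forall>z\<in>?\<Gamma>. japanese z ^ M * cmod (stft \<phi> u z) \<le> C" by blast
    qed
    ultimately show False using WFG unfolding WF_G_def by blast
  qed

  have Sigma_WF_G: "(0, \<eta>) \<in> WF_G \<phi> u" if "\<eta> \<in> Sigma_dir u" for \<eta>
  proof (rule ccontr)
    assume notin: "(0, \<eta>) \<notin> WF_G \<phi> u"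
    have \<eta>: "\<eta> \<noteq> 0" using that by (simp add: Sigma_dir_def)
    then obtain \<Gamma> where \<Gamma>: "open \<Gamma>" "pos_conic \<Gamma>" "(0, \<eta>) \<in> \<Gamma>" "rapidly_decreasing_on \<Gamma> (stft \<phi> u)"
      using notin unfolding WF_G_def by (auto simp: zero_prod_def)
    obtain \<delta> where "0 < \<delta>" "rapidly_decreasing_on (cone_nbhd \<eta> \<delta>) G"
      by (rule fourier_decay_of_stft_decay[OF rep \<phi> N \<Gamma>(1-3) \<eta> \<Gamma>(4)]) blast
    then have "\<exists>\<Gamma>. open \<Gamma> \<and> pos_conic \<Gamma> \<and> 0 \<notin> \<Gamma> \<and> \<eta> \<in> \<Gamma> \<and> rapidly_decreasing_on \<Gamma> G"
      by (intro rapidly_decreasing_on_cone_nbhd_imp \<eta>)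
    then show False using that unfolding Sigma_dir_def ff by blast
  qed

  have WF_Sigma: "\<eta> \<in> Sigma_dir u" if WF: "(x, \<eta>) \<in> WF u" for x \<eta>
  proof (rule ccontr)
    assume notin: "\<eta> \<notin> Sigma_dir u"
    have \<eta>: "\<eta> \<noteq> 0" using WF by (simp add: WF_def)
    obtain \<Gamma> where \<Gamma>: "open \<Gamma>" "pos_conic \<Gamma>" "\<eta> \<in> \<Gamma>" "rapidly_decreasing_on \<Gamma> G"
      using notin \<eta> unfolding Sigma_dir_def ff by blast
    \<comment> \<open>Since the decay is uniform in x, one bump at the origin is a suitable window
      for every base point.\<close>
    obtain \<beta> where \<beta>: "(\<lambda>y::'a. complex_of_real (\<beta> y)) \<in> test_functions" "\<And>y. \<beta> y \<noteq> 0 \<longleftrightarrow> dist 0 y < 1"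
      by (rule bump_exists[OF zero_less_one, of "0::'a"]) blast
    let ?b = "\<lambda>y. complex_of_real (\<beta> y)"
    obtain \<delta> where \<delta>: "0 < \<delta>"
      "\<And>M. \<exists>C. \<forall>\<xi>\<in>cone_nbhd \<eta> \<delta>. \<forall>x. japanese \<xi> ^ M * cmod (stft ?b u (x, \<xi>)) \<le> C"
      by (rule stft_decay_of_fourier_decay[OF rep \<Gamma>(1-3) \<eta> \<Gamma>(4) test_functions_schwartz[OF \<beta>(1)]]) blast
    then have "rapidly_decreasing_on (cone_nbhd \<eta> \<delta>) (\<lambda>\<xi>. stft ?b u (x, \<xi>))"
      unfolding rapidly_decreasing_on_iff by meson
    from rapidly_decreasing_on_cone_nbhd_imp[OF \<eta> \<delta>(1) this]
    have ex: "\<exists>\<Gamma>. open \<Gamma> \<and> pos_conic \<Gamma> \<and> 0 \<notin> \<Gamma> \<and> \<eta> \<in> \<Gamma> \<and> rapidly_decreasing_on \<Gamma> (\<lambda>\<xi>. stft ?b u (x, \<xi>))" .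
    have b0: "?b 0 \<noteq> 0" using \<beta>(2)[of 0] by simp
    have "\<exists>\<phi>\<in>test_functions. \<phi> 0 \<noteq> 0 \<and> (\<exists>\<Gamma>. open \<Gamma> \<and> pos_conic \<Gamma> \<and> 0 \<notin> \<Gamma> \<and> \<eta> \<in> \<Gamma> \<and>
        rapidly_decreasing_on \<Gamma> (\<lambda>\<xi>. stft \<phi> u (x, \<xi>)))"
      by (rule bexI[of _ ?b], rule conjI[OF b0 ex], rule \<beta>(1))
    then show False using WF unfolding WF_def mem_Collect_eq case_prod_conv by (elim conjE notE)
  qed

  have Sigma_WF: "\<exists>x. (x, \<eta>) \<in> WF u" if \<Sigma>: "\<eta> \<in> Sigma_dir u" for \<eta>
  proof (rule ccontr)
    assume "\<nexists>x. (x, \<eta>) \<in> WF u"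
    then have notin: "\<And>x. (x, \<eta>) \<notin> WF u" by blast
    have \<eta>: "\<eta> \<noteq> 0" using \<Sigma> by (simp add: Sigma_dir_def)
    obtain \<Gamma> where \<Gamma>: "open \<Gamma>" "pos_conic \<Gamma>" "0 \<notin> \<Gamma>" "\<eta> \<in> \<Gamma>" "rapidly_decreasing_on \<Gamma> (dist_fourier v \<theta>)"
      by (rule fourier_decay_of_not_in_WF[OF v' \<theta>(1) f u \<eta> notin])
    have "rapidly_decreasing_on \<Gamma> G"
      unfolding G_def by (intro rapidly_decreasing_on_add \<Gamma>(5) rapidly_decreasing_on_schwartz H)
    then show False using \<Sigma> \<Gamma>(1-4) unfolding Sigma_dir_def ff by blast
  qed

  have "snd ` WF u = Sigma_dir u" using WF_Sigma Sigma_WF by force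
  moreover have "WF_G \<phi> u = {0} \<times> Sigma_dir u" using WF_G_base WF_G_Sigma Sigma_WF_G by fastforce
  ultimately show ?thesis by simp
qed

end
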